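(* Let $f$ be a convex real-valued function on bipartite states. Then $f$ is LOCC monotone if and only if all of the following hold: (1) (local unitary invariance) for all states $\rho_{AB}$ and all unitaries $U_A$ on $\mathcal H_A$, $U_B$ on $\mathcal H_B$: $f\big((U_A\otimes U_B)\rho_{AB}(U_A\otimes U_B)^\dagger\big)=f(\rho_{AB})$; (2) (invariance under adding local ancilla) for every state $\rho_{AB}$ and every state $\sigma_X$ of an ancilla $X$ held locally by Alice ($X=A'$) or by Bob ($X=B'$): $f(\rho_{AB}\otimes\sigma_X)=f(\rho_{AB})$; (3) (affinity on locally orthogonal states) for every finite family of states $\rho^i_{AB}$, probabilities $p_i$, and orthonormal vectors $|i\rangle_X$ of a local ancilla $X\in\{A',B'\}$: $$f\Big(\sum_i p_i\,\rho^i_{AB}\otimes|i\rangle_X\langle i|\Big)=\sum_i p_i\, f\big(\rho^i_{AB}\otimes|i\rangle_X\langle i|\big).$$ The same equivalence holds for multipartite systems (with local unitaries and local ancillas at any party).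
   Context: States are density operators on finite-dimensional Hilbert spaces. $f$ is defined on states of bipartite systems $\mathcal H_A\otimes\mathcal H_B$ for all finite local dimensions; a state $\rho_{AB}\otimes\sigma_{A'}$ is regarded as a bipartite state with Alice holding $AA'$ and Bob holding $B$ (similarly for $B'$ at Bob's). $f$ is convex: $f(\sum_i p_i\rho_i)\le\sum_i p_i f(\rho_i)$. $f$ is called LOCC monotone if for every operation implementable by local operations and classical communication, which on input $\rho_{AB}$ yields outcome $i$ with probability $p_i$ and post-measurement state $\sigma^i_{AB}$, one has $f(\rho_{AB})\ge\sum_i p_i f(\sigma^i_{AB})$. *)

theory Defs
  imports "Jordan_Normal_Form.Matrix"
begin

text \<open>An n-partite system is described by its list of local dimensions d (party k has
  local Hilbert space C^(d!k)); the global space is the tensor product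
  C^(d!0) (x) ... (x) C^(d!(n-1)) with mixed-radix ordering (party 0 most significant).
  Operators are complex matrices of size prod_list d.\<close>

definition adj :: "complex mat \<Rightarrow> complex mat" where
  "adj A = mat (dim_col A) (dim_row A) (\<lambda>(i,j). cnj (A $$ (j,i)))"

definition mtrace :: "complex mat \<Rightarrow> complex" where
  "mtrace A = (\<Sum>i<dim_row A. A $$ (i,i))"

definition msum :: "nat \<Rightarrow> nat \<Rightarrow> 'i set \<Rightarrow> ('i \<Rightarrow> complex mat) \<Rightarrow> complex mat" where
  "msum r c I g = mat r c (\<lambda>(i,j). \<Sum>x\<in>I. g x $$ (i,j))"

definition kron :: "complex mat \<Rightarrow> complex mat \<Rightarrow> complex mat" where
  "kron A B = mat (dim_row A * dim_row B) (dim_col A * dim_col B)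
     (\<lambda>(i,j). A $$ (i div dim_row B, j div dim_col B) * B $$ (i mod dim_row B, j mod dim_col B))"

fun kron_list :: "complex mat list \<Rightarrow> complex mat" where
  "kron_list [] = 1\<^sub>m 1"
| "kron_list (A # As) = kron A (kron_list As)"

definition swap_mat :: "nat \<Rightarrow> nat \<Rightarrow> complex mat" where
  "swap_mat a e = mat (e * a) (a * e) (\<lambda>(r,c). if r = (c mod e) * a + c div e then 1 else 0)"

definition hermitian :: "complex mat \<Rightarrow> bool" where
  "hermitian A \<longleftrightarrow> adj A = A"

definition psd :: "nat \<Rightarrow> complex mat \<Rightarrow> bool" where
  "psd N A \<longleftrightarrow> A \<in> carrier_mat N N \<and> hermitian A \<and>
     (\<forall>v \<in> carrier_vec N. 0 \<le> Re (conjugate v \<bullet> (A *\<^sub>v v)))"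

definition unitary :: "nat \<Rightarrow> complex mat \<Rightarrow> bool" where
  "unitary m U \<longleftrightarrow> U \<in> carrier_mat m m \<and> U * adj U = 1\<^sub>m m \<and> adj U * U = 1\<^sub>m m"

definition is_state :: "nat list \<Rightarrow> complex mat \<Rightarrow> bool" where
  "is_state d \<rho> \<longleftrightarrow> psd (prod_list d) \<rho> \<and> mtrace \<rho> = 1"

definition embed :: "nat list \<Rightarrow> nat \<Rightarrow> complex mat \<Rightarrow> complex mat" where
  "embed d k K = kron_list ((map (\<lambda>m. 1\<^sub>m m) d)[k := K])"

text \<open>Adding an ancilla in state sigma (of dimension e) held by party k: the result
  is the state rho (x) sigma regarded as a state of the system where party k holds
  C^(d!k) (x) C^e, i.e. with local dimensions d[k := d!k * e].\<close>
definition add_anc :: "nat list \<Rightarrow> nat \<Rightarrow> nat \<Rightarrow> complex mat \<Rightarrow> complex mat \<Rightarrow> complex mat" where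
  "add_anc d k e \<rho> \<sigma> =
     (let b = prod_list (take (Suc k) d); a = prod_list (drop (Suc k) d);
          P = kron (1\<^sub>m b) (swap_mat a e)
      in P * kron \<rho> \<sigma> * adj P)"

definition anc_dims :: "nat list \<Rightarrow> nat \<Rightarrow> nat \<Rightarrow> nat list" where
  "anc_dims d k e = d[k := d ! k * e]"

definition ketbra :: "complex vec \<Rightarrow> complex mat" where
  "ketbra v = mat (dim_vec v) (dim_vec v) (\<lambda>(i,j). v $ i * cnj (v $ j))"

text \<open>An instrument with input system of local dimensions d is a finite list of
  outcomes; outcome i is given by its output local dimensions and the (CP) map
  applied to the input density operator (the unnormalised post-measurement state).\<close>
type_synonym instrument = "(nat list \<times> (complex mat \<Rightarrow> complex mat)) list"

text \<open>A local quantum instrument on a space of dimension m: outcomes x with output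
  dimension e_x and Kraus operators K_(x,j) : C^m -> C^(e_x), complete in total.\<close>
definition local_instrument :: "nat \<Rightarrow> (nat \<times> complex mat list) list \<Rightarrow> bool" where
  "local_instrument m Ks \<longleftrightarrow>
     (\<forall>(e, Kx) \<in> set Ks. \<forall>K \<in> set Kx. K \<in> carrier_mat e m) \<and>
     msum m m {(x, j). x < length Ks \<and> j < length (snd (Ks ! x))}
        (\<lambda>(x, j). adj (snd (Ks ! x) ! j) * (snd (Ks ! x) ! j)) = 1\<^sub>m m"

definition local_map :: "nat list \<Rightarrow> nat \<Rightarrow> nat \<times> complex mat list \<Rightarrow> complex mat \<Rightarrow> complex mat" where
  "local_map d k ex \<rho> =
     (let e = fst ex; Kx = snd ex; N' = prod_list (d[k := e])
      in msum N' N' {..<length Kx} (\<lambda>j. embed d k (Kx ! j) * \<rho> * adj (embed d k (Kx ! j))))"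

text \<open>LOCC instruments (finitely many rounds): the trivial instrument, local
  instruments of a single party, adaptive composition (the next operation may depend
  on all previous classical outcomes), and coarse-graining of outcomes.\<close>
inductive LOCC :: "nat list \<Rightarrow> instrument \<Rightarrow> bool" where
  LOCC_id: "LOCC d [(d, \<lambda>\<rho>. \<rho>)]"
| LOCC_local: "k < length d \<Longrightarrow> local_instrument (d ! k) Ks \<Longrightarrow>
     LOCC d (map (\<lambda>ex. (d[k := fst ex], local_map d k ex)) Ks)"
| LOCC_seq: "LOCC d T \<Longrightarrow> length Ts = length T \<Longrightarrow>
     (\<forall>i < length T. LOCC (fst (T ! i)) (Ts ! i)) \<Longrightarrow>
     LOCC d (concat (map (\<lambda>i. map (\<lambda>(d'', F). (d'', F \<circ> snd (T ! i))) (Ts ! i)) [0..<length T]))"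
| LOCC_merge: "LOCC d (xs @ [(d', E1)] @ ys @ [(d', E2)] @ zs) \<Longrightarrow>
     LOCC d (xs @ [(d', \<lambda>\<rho>. E1 \<rho> + E2 \<rho>)] @ ys @ zs)"

text \<open>f is a function on states of n-partite systems (for all local dimensions);
  f d rho is its value on the state rho of the system with local dimensions d.\<close>

definition convex_measure :: "nat \<Rightarrow> (nat list \<Rightarrow> complex mat \<Rightarrow> real) \<Rightarrow> bool" where
  "convex_measure n f \<longleftrightarrow>
     (\<forall>d (I :: nat set) p \<rho>. length d = n \<longrightarrow> finite I \<longrightarrow> (\<forall>i\<in>I. 0 \<le> p i) \<longrightarrow>
        (\<Sum>i\<in>I. p i) = 1 \<longrightarrow> (\<forall>i\<in>I. is_state d (\<rho> i)) \<longrightarrow>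
        f d (msum (prod_list d) (prod_list d) I (\<lambda>i. complex_of_real (p i) \<cdot>\<^sub>m \<rho> i))
          \<le> (\<Sum>i\<in>I. p i * f d (\<rho> i)))"

definition LOCC_monotone :: "nat \<Rightarrow> (nat list \<Rightarrow> complex mat \<Rightarrow> real) \<Rightarrow> bool" where
  "LOCC_monotone n f \<longleftrightarrow>
     (\<forall>d T \<rho>. length d = n \<longrightarrow> LOCC d T \<longrightarrow> is_state d \<rho> \<longrightarrow>
        (\<Sum>i<length T. let d' = fst (T ! i); \<sigma> = snd (T ! i) \<rho>; p = Re (mtrace \<sigma>)
                       in if 0 < p then p * f d' (complex_of_real (1 / p) \<cdot>\<^sub>m \<sigma>) else 0)
        \<le> f d \<rho>)"

definition local_unitary_invariant :: "nat \<Rightarrow> (nat list \<Rightarrow> complex mat \<Rightarrow> real) \<Rightarrow> bool" where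
  "local_unitary_invariant n f \<longleftrightarrow>
     (\<forall>d \<rho> Us. length d = n \<longrightarrow> is_state d \<rho> \<longrightarrow> length Us = n \<longrightarrow>
        (\<forall>k < n. unitary (d ! k) (Us ! k)) \<longrightarrow>
        f d (kron_list Us * \<rho> * adj (kron_list Us)) = f d \<rho>)"

definition local_ancilla_invariant :: "nat \<Rightarrow> (nat list \<Rightarrow> complex mat \<Rightarrow> real) \<Rightarrow> bool" where
  "local_ancilla_invariant n f \<longleftrightarrow>
     (\<forall>d k e \<rho> \<sigma>. length d = n \<longrightarrow> k < n \<longrightarrow> is_state d \<rho> \<longrightarrow> is_state [e] \<sigma> \<longrightarrow>
        f (anc_dims d k e) (add_anc d k e \<rho> \<sigma>) = f d \<rho>)"

definition flagged_affine :: "nat \<Rightarrow> (nat list \<Rightarrow> complex mat \<Rightarrow> real) \<Rightarrow> bool" where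
  "flagged_affine n f \<longleftrightarrow>
     (\<forall>d k e (I :: nat set) p \<rho> v. length d = n \<longrightarrow> k < n \<longrightarrow> finite I \<longrightarrow>
        (\<forall>i\<in>I. 0 \<le> p i) \<longrightarrow> (\<Sum>i\<in>I. p i) = 1 \<longrightarrow> (\<forall>i\<in>I. is_state d (\<rho> i)) \<longrightarrow>
        (\<forall>i\<in>I. v i \<in> carrier_vec e) \<longrightarrow>
        (\<forall>i\<in>I. \<forall>j\<in>I. conjugate (v i) \<bullet> v j = (if i = j then 1 else 0)) \<longrightarrow>
        (let d' = anc_dims d k e; N' = prod_list d' in
          f d' (msum N' N' I (\<lambda>i. complex_of_real (p i) \<cdot>\<^sub>m add_anc d k e (\<rho> i) (ketbra (v i))))
          = (\<Sum>i\<in>I. p i * f d' (add_anc d k e (\<rho> i) (ketbra (v i))))))"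

end

theory Submission
  imports Defs
begin

text \<open>
  Extend \<^term>\<open>f\<close> to all positive matrices by homogeneity; convexity then means subadditivity, and
  LOCC monotonicity can be propagated along the inductive generation of LOCC instruments once it is
  known for one local instrument with Kraus operators \<open>K\<^sub>x\<close>. For that, invariance under local
  unitaries and ancillas yields invariance under every local isometry, because two isometries with
  orthogonal ranges are exchanged by a Householder reflection. The isometries
  \<open>V\<^sub>s = \<Sum>\<^sub>x \<omega>\<^sup>s\<^sup>x K\<^sub>x \<otimes> |x\<rangle>\<close>, with \<open>\<omega>\<close> a root of unity, all leave \<open>f\<close> unchanged, and averaging over
  \<open>s\<close> produces the flagged state \<open>\<Sum>\<^sub>x K\<^sub>x \<rho> K\<^sub>x\<^sup>\<dagger> \<otimes> |x\<rangle>\<langle>x|\<close>; convexity and affinity on flagged states give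
  the claim. Conversely, each of the three conditions follows by applying explicit local
  instruments: a unitary and its inverse, attaching and tracing out the ancilla, and measuring the flag.
\<close>

section \<open>Kronecker products and operators of a single party\<close>

text \<open>The homogeneous extension makes the induction over LOCC possible: branch probabilities
  and outcomes of probability zero need no separate bookkeeping, and sequential composition becomes
  a chain of inequalities. Convexity enters in three places: averaging over the phases, merging
  outcomes, and the easy half of affinity. The phases are needed because the Stinespring isometry of
  an instrument produces coherences \<open>K x * \<rho> * adj (K y)\<close> between different flags,
  about which affinity says nothing; orthogonality of characters cancels them in the average. Two
  mismatches shape the constructions. Outcomes may have output spaces of different dimensions,
  whereas a flagged family lives on a single system, so outputs are embedded into a common space. An
  isometry changes the dimension of a party, whereas the hypothesis speaks of unitaries only.
  Rank-one decompositions of positive matrices serve twice: Kraus operators are seen to preserve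
  positivity, and adding a mixed ancilla becomes a local instrument.\<close>

lemma index_mult_sum:
  assumes "A \<in> carrier_mat a b" "B \<in> carrier_mat b c" "i < a" "j < c"
  shows "(A * B) $$ (i,j) = (\<Sum>k<b. A $$ (i,k) * B $$ (k,j))"
  using assms by (simp add: scalar_prod_def atLeast0LessThan)

lemma dim_adj[simp]: "dim_row (adj A) = dim_col A" "dim_col (adj A) = dim_row A"
  by (simp_all add: adj_def)

lemma index_adj[simp]: "i < dim_col A \<Longrightarrow> j < dim_row A \<Longrightarrow> adj A $$ (i,j) = cnj (A $$ (j,i))"
  by (simp add: adj_def)

lemma adj_carrier[simp, intro]: "A \<in> carrier_mat a b \<Longrightarrow> adj A \<in> carrier_mat b a"
  by (intro carrier_matI) auto

lemma adj_adj[simp]: "adj (adj A) = A"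
  by (rule eq_matI) auto

lemma adj_one[simp]: "adj (1\<^sub>m n) = 1\<^sub>m n"
  by (rule eq_matI) auto

lemma adj_mult:
  assumes "A \<in> carrier_mat a b" "B \<in> carrier_mat b c"
  shows "adj (A * B) = adj B * adj A"
  using assms by (intro eq_matI) (auto simp: scalar_prod_def mult.commute)

lemma adj_add:
  assumes "A \<in> carrier_mat a b" "B \<in> carrier_mat a b"
  shows "adj (A + B) = adj A + adj B"
  using assms by (intro eq_matI) auto

lemma adj_minus:
  assumes "A \<in> carrier_mat a b" "B \<in> carrier_mat a b"
  shows "adj (A - B) = adj A - adj B"
  using assms by (intro eq_matI) auto

lemma adj_smult: "adj (c \<cdot>\<^sub>m A) = cnj c \<cdot>\<^sub>m adj A"
  by (intro eq_matI) auto

section \<open>Finite sums of matrices and the trace\<close>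

lemma msum_carrier[simp, intro]: "msum r c I g \<in> carrier_mat r c"
  by (simp add: msum_def)

lemma dim_msum[simp]: "dim_row (msum r c I g) = r" "dim_col (msum r c I g) = c"
  by (simp_all add: msum_def)

lemma index_msum[simp]: "i < r \<Longrightarrow> j < c \<Longrightarrow> msum r c I g $$ (i,j) = (\<Sum>x\<in>I. g x $$ (i,j))"
  by (simp add: msum_def)

lemma msum_cong: "I = J \<Longrightarrow> (\<And>x. x \<in> J \<Longrightarrow> g x = h x) \<Longrightarrow> msum r c I g = msum r c J h"
  by (simp add: msum_def)

text \<open>The \<open>=simp=>\<close> premise lets the simplifier use membership in the index set
  while it rewrites a summand, as is needed when summands are list accesses that make sense only for
  indices in range.\<close>

lemma msum_cong_simp:
  "I = J \<Longrightarrow> (\<And>x. x \<in> J =simp=> g x = h x) \<Longrightarrow> msum r c I g = msum r c J h"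
  by (simp add: msum_def simp_implies_def)

lemma msum_reindex:
  assumes "bij_betw h I J"
  shows "msum r c I (\<lambda>x. g (h x)) = msum r c J g"
  unfolding msum_def using sum.reindex_bij_betw[OF assms]
  by (intro eq_matI) auto

lemma msum_empty: "msum r c {} g = 0\<^sub>m r c"
  by (rule eq_matI) auto

lemma msum_insert:
  assumes "finite I" "x \<notin> I" "g x \<in> carrier_mat r c"
  shows "msum r c (insert x I) g = g x + msum r c I g"
  using assms by (intro eq_matI) auto

lemma msum_singleton: "g x \<in> carrier_mat r c \<Longrightarrow> msum r c {x} g = g x"
  by (rule eq_matI) auto

lemma msum_mono_neutral:
  assumes "finite J" "I \<subseteq> J" "\<And>x. x \<in> J - I \<Longrightarrow> g x = 0\<^sub>m r c"
  shows "msum r c J g = msum r c I g"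
  using assms by (intro eq_matI) (auto intro!: sum.mono_neutral_right)

lemma mult_msum:
  assumes "A \<in> carrier_mat p r" "\<And>x. x \<in> I \<Longrightarrow> g x \<in> carrier_mat r c"
  shows "A * msum r c I g = msum p c I (\<lambda>x. A * g x)"
proof (rule eq_matI)
  fix i j assume ij: "i < dim_row (msum p c I (\<lambda>x. A * g x))" "j < dim_col (msum p c I (\<lambda>x. A * g x))"
  have "(A * msum r c I g) $$ (i,j) = (\<Sum>k<r. \<Sum>x\<in>I. A $$ (i,k) * g x $$ (k,j))"
    using ij assms(1) by (simp add: index_mult_sum[OF assms(1) msum_carrier] sum_distrib_left del: index_mult_mat)
  also have "\<dots> = (\<Sum>x\<in>I. (A * g x) $$ (i,j))"
    using ij by (subst sum.swap) (auto simp: index_mult_sum[OF assms(1) assms(2)] simp del: index_mult_mat)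
  finally show "(A * msum r c I g) $$ (i,j) = msum p c I (\<lambda>x. A * g x) $$ (i,j)" using ij by simp
qed (use assms in auto)

lemma msum_mult:
  assumes "A \<in> carrier_mat c p" "\<And>x. x \<in> I \<Longrightarrow> g x \<in> carrier_mat r c"
  shows "msum r c I g * A = msum r p I (\<lambda>x. g x * A)"
proof (rule eq_matI)
  fix i j assume ij: "i < dim_row (msum r p I (\<lambda>x. g x * A))" "j < dim_col (msum r p I (\<lambda>x. g x * A))"
  have "(msum r c I g * A) $$ (i,j) = (\<Sum>k<c. \<Sum>x\<in>I. g x $$ (i,k) * A $$ (k,j))"
    using ij assms(1) by (simp add: index_mult_sum[OF msum_carrier assms(1)] sum_distrib_right del: index_mult_mat)
  also have "\<dots> = (\<Sum>x\<in>I. (g x * A) $$ (i,j))"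
    using ij by (subst sum.swap) (auto simp: index_mult_sum[OF assms(2) assms(1)] simp del: index_mult_mat)
  finally show "(msum r c I g * A) $$ (i,j) = msum r p I (\<lambda>x. g x * A) $$ (i,j)" using ij by simp
qed (use assms in auto)

lemma adj_msum:
  assumes "\<And>x. x \<in> I \<Longrightarrow> g x \<in> carrier_mat r c"
  shows "adj (msum r c I g) = msum c r I (\<lambda>x. adj (g x))"
proof (rule eq_matI)
  fix i j assume "i < dim_row (msum c r I (\<lambda>x. adj (g x)))" "j < dim_col (msum c r I (\<lambda>x. adj (g x)))"
  moreover have "adj (g x) $$ (i,j) = cnj (g x $$ (j,i))" if "x \<in> I" "i < c" "j < r" for x
    using assms[OF that(1)] that by auto
  ultimately show "adj (msum r c I g) $$ (i,j) = msum c r I (\<lambda>x. adj (g x)) $$ (i,j)"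
    by simp
qed auto

lemma smult_msum:
  assumes "\<And>x. x \<in> I \<Longrightarrow> g x \<in> carrier_mat r c"
  shows "a \<cdot>\<^sub>m msum r c I g = msum r c I (\<lambda>x. a \<cdot>\<^sub>m g x)"
proof -
  have D: "dim_row (g x) = r" "dim_col (g x) = c" if "x \<in> I" for x using assms[OF that] by auto
  show ?thesis
    using D by (intro eq_matI) (auto simp: D sum_distrib_left intro!: sum.cong)
qed

lemma mtrace_msum:
  assumes "\<And>x. x \<in> I \<Longrightarrow> g x \<in> carrier_mat r r"
  shows "mtrace (msum r r I g) = (\<Sum>x\<in>I. mtrace (g x))"
proof -
  have "mtrace (msum r r I g) = (\<Sum>x\<in>I. \<Sum>i<r. g x $$ (i,i))"
    unfolding mtrace_def by (simp, rule sum.swap)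
  also have "\<dots> = (\<Sum>x\<in>I. mtrace (g x))"
    using assms by (intro sum.cong) (auto simp: mtrace_def)
  finally show ?thesis .
qed

lemma mtrace_smult: "A \<in> carrier_mat n n \<Longrightarrow> mtrace (c \<cdot>\<^sub>m A) = c * mtrace A"
  by (simp add: mtrace_def sum_distrib_left)

lemma mtrace_zero[simp]: "mtrace (0\<^sub>m n n) = 0"
  by (simp add: mtrace_def)

lemma mtrace_add:
  assumes "A \<in> carrier_mat n n" "B \<in> carrier_mat n n"
  shows "mtrace (A + B) = mtrace A + mtrace B"
  using assms by (simp add: mtrace_def sum.distrib)

lemma mtrace_comm:
  assumes "A \<in> carrier_mat a b" "B \<in> carrier_mat b a"
  shows "mtrace (A * B) = mtrace (B * A)"
proof -
  have "mtrace (A * B) = (\<Sum>i<a. \<Sum>k<b. A $$ (i,k) * B $$ (k,i))"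
    using assms by (auto simp: mtrace_def index_mult_sum[OF assms] simp del: index_mult_mat(1) intro!: sum.cong)
  also have "\<dots> = mtrace (B * A)"
    using assms by (subst sum.swap) (auto simp: mtrace_def index_mult_sum[OF assms(2,1)] mult.commute simp del: index_mult_mat(1) intro!: sum.cong)
  finally show ?thesis .
qed

section \<open>Mixed-radix indices and the Kronecker product\<close>

lemma less_mult_divmod:
  assumes "(i::nat) < a * b"
  shows "i div b < a" "i mod b < b"
proof -
  have "0 < b" using assms by (cases "b = 0") auto
  then show "i mod b < b" by simp
  show "i div b < a" using assms by (rule less_mult_imp_div_less)
qed

text \<open>Division with remainder identifies the composite index of a tensor product with a pair
  of digits.\<close>

lemma sum_div_mod:
  fixes f :: "nat \<Rightarrow> nat \<Rightarrow> 'a::comm_monoid_add"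
  shows "(\<Sum>k<a*b. f (k div b) (k mod b)) = (\<Sum>x<a. \<Sum>y<b. f x y)"
proof (cases "b = 0")
  case False
  have "x * b + y < a * b" if "x < a" "y < b" for x y
  proof -
    have "x * b + y < Suc x * b" using that by simp
    also have "\<dots> \<le> a * b" using that by (intro mult_le_mono1) simp
    finally show ?thesis .
  qed
  moreover have "(x * b + y) div b = x" "(x * b + y) mod b = y" if "y < b" for x y
    using that by auto
  ultimately have "(\<Sum>k<a*b. f (k div b) (k mod b)) = (\<Sum>(x,y)\<in>{..<a}\<times>{..<b}. f x y)"
    by (intro sum.reindex_bij_witness[of _ "\<lambda>(x,y). x * b + y" "\<lambda>k. (k div b, k mod b)"])
       (auto simp: less_mult_divmod)
  then show ?thesis by (simp add: sum.cartesian_product)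
qed simp

lemma dim_kron[simp]: "dim_row (kron A B) = dim_row A * dim_row B"
  "dim_col (kron A B) = dim_col A * dim_col B"
  by (simp_all add: kron_def)

lemma kron_carrier[simp, intro]:
  "A \<in> carrier_mat a b \<Longrightarrow> B \<in> carrier_mat c e \<Longrightarrow> kron A B \<in> carrier_mat (a * c) (b * e)"
  by (intro carrier_matI) auto

lemma index_kron:
  "i < dim_row A * dim_row B \<Longrightarrow> j < dim_col A * dim_col B \<Longrightarrow>
    kron A B $$ (i,j) = A $$ (i div dim_row B, j div dim_col B) * B $$ (i mod dim_row B, j mod dim_col B)"
  by (simp add: kron_def)

text \<open>The composite summation index splits into its two digits, after which the double sum
  factors.\<close>

lemma kron_mult:
  assumes A: "A \<in> carrier_mat a b" and B: "B \<in> carrier_mat a' b'"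
    and C: "C \<in> carrier_mat b c" and D: "D \<in> carrier_mat b' c'"
  shows "kron A B * kron C D = kron (A * C) (B * D)"
proof (rule eq_matI)
  fix i j assume "i < dim_row (kron (A * C) (B * D))" "j < dim_col (kron (A * C) (B * D))"
  then have ij: "i < a * a'" "j < c * c'" using assms by auto
  note dm = less_mult_divmod[OF ij(1)] less_mult_divmod[OF ij(2)]
  have "(kron A B * kron C D) $$ (i,j) = (\<Sum>k<b*b'. kron A B $$ (i,k) * kron C D $$ (k,j))"
    by (rule index_mult_sum[OF _ _ ij]) (use assms in auto)
  also have "\<dots> = (\<Sum>k<b*b'. (A $$ (i div a', k div b') * B $$ (i mod a', k mod b')) *
      (C $$ (k div b', j div c') * D $$ (k mod b', j mod c')))"
    using assms ij by (intro sum.cong) (auto simp: index_kron)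
  also have "\<dots> = (\<Sum>x<b. \<Sum>y<b'. (A $$ (i div a', x) * B $$ (i mod a', y)) *
      (C $$ (x, j div c') * D $$ (y, j mod c')))"
    by (rule sum_div_mod)
  also have "\<dots> = (A * C) $$ (i div a', j div c') * (B * D) $$ (i mod a', j mod c')"
    unfolding index_mult_sum[OF A C dm(1,3)] index_mult_sum[OF B D dm(2,4)] sum_product
    by (intro sum.cong refl) (simp only: mult_ac)
  also have "\<dots> = kron (A * C) (B * D) $$ (i,j)"
    using assms ij by (simp add: index_kron del: index_mult_mat(1))
  finally show "(kron A B * kron C D) $$ (i,j) = kron (A * C) (B * D) $$ (i,j)" .
qed (use assms in auto)

lemma kron_assoc: "kron (kron A B) C = kron A (kron B C)"
proof (rule eq_matI)
  fix i j assume "i < dim_row (kron A (kron B C))" "j < dim_col (kron A (kron B C))"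
  then have ij: "i < dim_row A * dim_row B * dim_row C" "j < dim_col A * dim_col B * dim_col C" 
    by (auto simp: mult.assoc)
  note dm = less_mult_divmod[OF ij(1)] less_mult_divmod[OF ij(2)]
  have ij': "i < dim_row A * (dim_row B * dim_row C)" "j < dim_col A * (dim_col B * dim_col C)" 
    using ij by (auto simp: mult.assoc)
  note dm' = less_mult_divmod[OF ij'(1)] less_mult_divmod[OF ij'(2)]
  \<comment> \<open>A three-digit index has the same digits whichever bracketing is used to read
    them off.\<close>
  have e: "x mod (b * c) div c = x div c mod b" "x mod (b * c) mod c = x mod c"
    "x div (b * c) = x div c div b" for x b c :: nat
  proof -
    have bc: "b * c = c * b" by simp
    have m: "x mod (b * c) = x mod c + c * (x div c mod b)" unfolding bc mod_mult2_eq by simp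
    show "x mod (b * c) mod c = x mod c" unfolding m by simp
    show "x mod (b * c) div c = x div c mod b" unfolding m by (cases "c = 0") auto
    show "x div (b * c) = x div c div b" unfolding bc by (rule div_mult2_eq)
  qed
  show "kron (kron A B) C $$ (i,j) = kron A (kron B C) $$ (i,j)"
    using ij ij' dm dm' by (simp add: index_kron e)
qed (auto simp: mult.assoc)

lemma kron_one: "kron (1\<^sub>m a) (1\<^sub>m b) = 1\<^sub>m (a * b)"
proof (rule eq_matI)
  fix i j assume "i < dim_row (1\<^sub>m (a * b))" "j < dim_col (1\<^sub>m (a * b))"
  then have ij: "i < a * b" "j < a * b" by auto
  note dm = less_mult_divmod[OF ij(1)] less_mult_divmod[OF ij(2)]
  have eq: "i = j" if "i div b = j div b" "i mod b = j mod b"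
  proof -
    have "i = i div b * b + i mod b" by (rule div_mult_mod_eq[symmetric])
    also have "\<dots> = j div b * b + j mod b" by (simp only: that)
    finally show ?thesis by (simp only: div_mult_mod_eq)
  qed
  show "kron (1\<^sub>m a) (1\<^sub>m b) $$ (i,j) = (1\<^sub>m (a * b) :: complex mat) $$ (i,j)"
    using ij dm eq by (auto simp: index_kron)
qed auto

lemma kron_one_right[simp]: "kron A (1\<^sub>m (Suc 0)) = A"
  by (rule eq_matI) (auto simp: index_kron)

lemma kron_one_left[simp]: "kron (1\<^sub>m (Suc 0)) A = A"
proof (rule eq_matI)
  fix i j assume "i < dim_row A" "j < dim_col A"
  then show "kron (1\<^sub>m (Suc 0)) A $$ (i,j) = A $$ (i,j)" by (simp add: index_kron)
qed auto

lemma adj_kron: "adj (kron A B) = kron (adj A) (adj B)"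
  by (rule eq_matI) (auto simp: index_kron less_mult_divmod)

lemma kron_msum_left:
  assumes "\<And>x. x \<in> I \<Longrightarrow> g x \<in> carrier_mat r c" "B \<in> carrier_mat p q"
  shows "kron (msum r c I g) B = msum (r * p) (c * q) I (\<lambda>x. kron (g x) B)"
proof -
  have D: "dim_row (g x) = r" "dim_col (g x) = c" if "x \<in> I" for x using assms(1)[OF that] by auto
  show ?thesis
    using assms(2) by (intro eq_matI) (auto simp: D index_kron less_mult_divmod sum_distrib_right intro!: sum.cong)
qed

lemma kron_msum_right:
  assumes "\<And>x. x \<in> I \<Longrightarrow> g x \<in> carrier_mat r c" "B \<in> carrier_mat p q"
  shows "kron B (msum r c I g) = msum (p * r) (q * c) I (\<lambda>x. kron B (g x))"
proof -
  have D: "dim_row (g x) = r" "dim_col (g x) = c" if "x \<in> I" for x using assms(1)[OF that] by auto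
  show ?thesis
    using assms(2) by (intro eq_matI) (auto simp: D index_kron less_mult_divmod sum_distrib_left intro!: sum.cong)
qed

lemma kron_smult_left: "kron (a \<cdot>\<^sub>m A) B = a \<cdot>\<^sub>m kron A B"
  by (intro eq_matI) (auto simp: index_kron less_mult_divmod)

lemma kron_smult_right: "kron A (a \<cdot>\<^sub>m B) = a \<cdot>\<^sub>m kron A B"
  by (intro eq_matI) (auto simp: index_kron less_mult_divmod)

lemma kron_list_append: "kron_list (As @ Bs) = kron (kron_list As) (kron_list Bs)"
  by (induction As) (auto simp: kron_assoc)

lemma kron_list_one: "kron_list (map (\<lambda>m. 1\<^sub>m m) d) = 1\<^sub>m (prod_list d)"
  by (induction d) (auto simp: kron_one)

section \<open>Operators acting on one tensor factor\<close>

lemma embed_kron: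
  assumes "k < length d"
  shows "embed d k K = kron (1\<^sub>m (prod_list (take k d))) (kron K (1\<^sub>m (prod_list (drop (Suc k) d))))"
  using assms by (simp add: embed_def upd_conv_take_nth_drop kron_list_append kron_list_one 
     drop_map take_map)

lemma prod_list_update:
  fixes d :: "nat list"
  assumes "k < length d"
  shows "prod_list (d[k := e]) = prod_list (take k d) * (e * prod_list (drop (Suc k) d))"
  using assms by (simp add: upd_conv_take_nth_drop)

text \<open>\<open>embed\<close> overwrites entry k of the list of identities, so it gives the same
  operator before and after the dimension of party k changes. Hence successive operators of one
  party compose even when their dimensions differ.\<close>

lemma embed_update[simp]: "k < length d \<Longrightarrow> embed (d[k := e]) k K = embed d k K"
  by (simp add: embed_def map_update)

lemma embed_carrier[intro]:
  assumes "k < length d" "K \<in> carrier_mat e m"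
  shows "embed d k K \<in> carrier_mat (prod_list (d[k := e])) (prod_list (d[k := m]))"
  unfolding embed_kron[OF assms(1)] prod_list_update[OF assms(1)]
  by (rule kron_carrier[OF one_carrier_mat kron_carrier[OF assms(2) one_carrier_mat]])

lemma embed_mult:
  assumes "k < length d" "A \<in> carrier_mat a b" "B \<in> carrier_mat b c"
  shows "embed d k (A * B) = embed d k A * embed d k B"
proof -
  let ?L = "1\<^sub>m (prod_list (take k d)) :: complex mat" and ?R = "1\<^sub>m (prod_list (drop (Suc k) d)) :: complex mat"
  have "kron ?L (kron A ?R) * kron ?L (kron B ?R) = kron (?L * ?L) (kron A ?R * kron B ?R)"
    by (rule kron_mult[OF one_carrier_mat kron_carrier[OF assms(2) one_carrier_mat] one_carrier_mat kron_carrier[OF assms(3) one_carrier_mat]])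
  also have "kron A ?R * kron B ?R = kron (A * B) (?R * ?R)"
    by (rule kron_mult[OF assms(2) one_carrier_mat assms(3) one_carrier_mat])
  finally show ?thesis
    unfolding embed_kron[OF assms(1)] left_mult_one_mat[OF one_carrier_mat] by simp
qed

lemma adj_embed: "k < length d \<Longrightarrow> adj (embed d k K) = embed d k (adj K)"
  by (simp add: embed_kron adj_kron)

lemma embed_one: "k < length d \<Longrightarrow> embed d k (1\<^sub>m m) = 1\<^sub>m (prod_list (d[k := m]))"
  by (simp add: embed_kron kron_one prod_list_update)

lemma embed_smult: "k < length d \<Longrightarrow> embed d k (c \<cdot>\<^sub>m K) = c \<cdot>\<^sub>m embed d k K"
  by (simp add: embed_kron kron_smult_left kron_smult_right)

lemma embed_msum:
  assumes "k < length d" "\<And>x. x \<in> I \<Longrightarrow> g x \<in> carrier_mat r c"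
  shows "embed d k (msum r c I g) = msum (prod_list (d[k := r])) (prod_list (d[k := c])) I (\<lambda>x. embed d k (g x))"
proof -
  let ?l = "prod_list (take k d)" and ?r = "prod_list (drop (Suc k) d)"
  have "kron (msum r c I g) (1\<^sub>m ?r) = msum (r * ?r) (c * ?r) I (\<lambda>x. kron (g x) (1\<^sub>m ?r))"
    by (rule kron_msum_left) (use assms(2) in auto)
  moreover have "kron (1\<^sub>m ?l) (msum (r * ?r) (c * ?r) I (\<lambda>x. kron (g x) (1\<^sub>m ?r))) 
     = msum (?l * (r * ?r)) (?l * (c * ?r)) I (\<lambda>x. kron (1\<^sub>m ?l) (kron (g x) (1\<^sub>m ?r)))"
    by (rule kron_msum_right) (use assms(2) in auto)
  ultimately show ?thesis 
    unfolding embed_kron[OF assms(1)] prod_list_update[OF assms(1)] by (simp only:)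
qed

section \<open>Positive semidefinite matrices\<close>

text \<open>Vectors are plain functions here, so that changing one coordinate is a pointwise
  modification.\<close>

definition qform :: "nat \<Rightarrow> complex mat \<Rightarrow> (nat \<Rightarrow> complex) \<Rightarrow> complex" where
  "qform N A v = (\<Sum>i<N. \<Sum>j<N. cnj (v i) * A $$ (i,j) * v j)"

lemma psd_iff_qform:
  "psd N A \<longleftrightarrow> A \<in> carrier_mat N N \<and> hermitian A \<and> (\<forall>v. 0 \<le> Re (qform N A v))"
proof -
  have q: "conjugate v \<bullet> (A *\<^sub>v v) = qform N A (\<lambda>i. v $ i)"
    if "A \<in> carrier_mat N N" "v \<in> carrier_vec N" for v
    using that by (auto simp: qform_def scalar_prod_def atLeast0LessThan sum_distrib_left mult.assoc intro!: sum.cong)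
  have r: "qform N A v = conjugate (vec N v) \<bullet> (A *\<^sub>v vec N v)" if "A \<in> carrier_mat N N" for v
    unfolding q[OF that vec_carrier] by (simp add: qform_def)
  show ?thesis
  proof (cases "A \<in> carrier_mat N N")
    case True
    have "(\<forall>v \<in> carrier_vec N. 0 \<le> Re (conjugate v \<bullet> (A *\<^sub>v v))) \<longleftrightarrow> (\<forall>v. 0 \<le> Re (qform N A v))"
    proof safe
      fix v assume "\<forall>v \<in> carrier_vec N. 0 \<le> Re (conjugate v \<bullet> (A *\<^sub>v v))"
      then show "0 \<le> Re (qform N A v)" unfolding r[OF True] using vec_carrier by blast
    next
      fix v :: "complex vec" assume "\<forall>v. 0 \<le> Re (qform N A v)" "v \<in> carrier_vec N"
      then show "0 \<le> Re (conjugate v \<bullet> (A *\<^sub>v v))" using q[OF True] by simp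
    qed
    then show ?thesis by (simp add: psd_def)
  qed (simp add: psd_def)
qed

lemma psd_carrier: "psd N A \<Longrightarrow> A \<in> carrier_mat N N"
  by (simp add: psd_def)

lemma psd_zero: "psd N (0\<^sub>m N N)"
  unfolding psd_iff_qform by (auto simp: qform_def hermitian_def)

lemma psd_add:
  assumes "psd N A" "psd N B"
  shows "psd N (A + B)"
proof -
  have "qform N (A + B) v = qform N A v + qform N B v" for v
    unfolding qform_def sum.distrib[symmetric] using assms
    by (intro sum.cong refl) (auto simp: psd_def algebra_simps)
  then show ?thesis using assms
    unfolding psd_iff_qform hermitian_def by (auto simp: adj_add)
qed

lemma psd_smult: "psd N A \<Longrightarrow> 0 \<le> c \<Longrightarrow> psd N (complex_of_real c \<cdot>\<^sub>m A)"
  unfolding psd_iff_qform hermitian_def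
proof safe
  fix v assume A: "A \<in> carrier_mat N N" and "\<forall>v. 0 \<le> Re (qform N A v)" "0 \<le> c"
  moreover have "qform N (complex_of_real c \<cdot>\<^sub>m A) v = complex_of_real c * qform N A v"
    using A by (simp add: qform_def sum_distrib_left mult_ac)
  ultimately show "0 \<le> Re (qform N (complex_of_real c \<cdot>\<^sub>m A) v)" by simp
qed (simp_all add: adj_smult)

lemma psd_msum:
  assumes "finite I" "\<And>x. x \<in> I \<Longrightarrow> psd N (g x)"
  shows "psd N (msum N N I g)"
  using assms
proof (induction I rule: finite_induct)
  case (insert x I)
  then show ?case by (simp add: msum_insert psd_carrier psd_add)
qed (simp add: msum_empty psd_zero)

text \<open>The form at v is the squared norm of \<open>adj B\<close> applied to v, written as a sum
  of squared moduli.\<close>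

lemma psd_mult_adj:
  assumes B: "B \<in> carrier_mat N M"
  shows "psd N (B * adj B)"
  unfolding psd_iff_qform hermitian_def
proof (intro conjI allI)
  fix v
  have "qform N (B * adj B) v = (\<Sum>i<N. \<Sum>j<N. \<Sum>k<M. (cnj (v i) * B $$ (i,k)) * cnj (cnj (v j) * B $$ (j,k)))"
    unfolding qform_def using B
    by (intro sum.cong refl) (auto simp: index_mult_sum[OF B adj_carrier[OF B]] sum_distrib_left sum_distrib_right mult_ac
        simp del: index_mult_mat intro!: sum.cong)
  also have "\<dots> = (\<Sum>i<N. \<Sum>k<M. \<Sum>j<N. (cnj (v i) * B $$ (i,k)) * cnj (cnj (v j) * B $$ (j,k)))"
    by (intro sum.cong refl sum.swap)
  also have "\<dots> = (\<Sum>k<M. \<Sum>i<N. \<Sum>j<N. (cnj (v i) * B $$ (i,k)) * cnj (cnj (v j) * B $$ (j,k)))"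
    by (rule sum.swap)
  also have "\<dots> = (\<Sum>k<M. (\<Sum>i<N. cnj (v i) * B $$ (i,k)) * cnj (\<Sum>i<N. cnj (v i) * B $$ (i,k)))"
    by (simp only: sum_product cnj_sum)
  also have "Re \<dots> \<ge> 0"
    by (simp only: complex_mult_cnj Re_sum Re_complex_of_real) (intro sum_nonneg, simp)
  finally show "0 \<le> Re (qform N (B * adj B) v)" .
qed (use B in \<open>auto simp: adj_mult[OF B adj_carrier[OF B]]\<close>)

text \<open>Positivity is exploited by shifting a test vector along one coordinate: v = 0 yields the
  diagonal entries, a basis vector v yields the vanishing rows, and a general v yields the Schur
  complement.\<close>

lemma qform_perturb:
  assumes "i < N"
  shows "qform N A (\<lambda>j. v j + (if j = i then t else 0)) =
    qform N A v + cnj t * (\<Sum>j<N. A $$ (i,j) * v j) + t * (\<Sum>j<N. cnj (v j) * A $$ (j,i)) + cnj t * t * A $$ (i,i)"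
proof -
  let ?d = "\<lambda>j. if j = i then t else 0" and ?dc = "\<lambda>j. if j = i then cnj t else 0"
  have "cnj (v a + ?d a) * A $$ (a,b) * (v b + ?d b) = cnj (v a) * A $$ (a,b) * v b
     + (if a = i then cnj t * (A $$ (i,b) * v b) else 0)
     + (if b = i then t * (cnj (v a) * A $$ (a,i)) else 0)
     + (if a = i then (if b = i then cnj t * t * A $$ (i,i) else 0) else 0)" for a b
    by (simp add: algebra_simps)
  then have "qform N A (\<lambda>j. v j + ?d j) = qform N A v
     + (\<Sum>a<N. \<Sum>b<N. if a = i then cnj t * (A $$ (i,b) * v b) else 0)
     + (\<Sum>a<N. \<Sum>b<N. if b = i then t * (cnj (v a) * A $$ (a,i)) else 0)
     + (\<Sum>a<N. \<Sum>b<N. if a = i then (if b = i then cnj t * t * A $$ (i,i) else 0) else 0)"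
    by (simp only: qform_def sum.distrib)
  moreover have "(\<Sum>a<N. \<Sum>b<N. if a = i then cnj t * (A $$ (i,b) * v b) else 0) = cnj t * (\<Sum>j<N. A $$ (i,j) * v j)"
    using assms by (subst sum.swap) (simp add: sum_distrib_left)
  moreover have "(\<Sum>a<N. \<Sum>b<N. if b = i then t * (cnj (v a) * A $$ (a,i)) else 0) = t * (\<Sum>j<N. cnj (v j) * A $$ (j,i))"
    using assms by (simp add: sum_distrib_left)
  moreover have "(\<Sum>a<N. \<Sum>b<N. if a = i then (if b = i then cnj t * t * A $$ (i,i) else 0) else 0) = cnj t * t * A $$ (i,i)"
    using assms by (subst sum.swap) simp
  ultimately show ?thesis by simp
qed

lemma hermitian_index:
  assumes "hermitian A" "A \<in> carrier_mat N N" "i < N" "j < N"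
  shows "A $$ (j,i) = cnj (A $$ (i,j))"
  using assms index_adj[of j A i] by (auto simp: hermitian_def)

lemma psd_diag:
  assumes "psd N A" "i < N"
  shows "A $$ (i,i) = complex_of_real (Re (A $$ (i,i)))" "0 \<le> Re (A $$ (i,i))"
proof -
  have A: "A \<in> carrier_mat N N" "hermitian A" and q: "\<And>v. 0 \<le> Re (qform N A v)"
    using assms(1) by (auto simp: psd_iff_qform)
  show "A $$ (i,i) = complex_of_real (Re (A $$ (i,i)))"
    using hermitian_index[OF A(2,1) assms(2,2)] by (simp add: complex_eq_iff)
  show "0 \<le> Re (A $$ (i,i))"
    using q[of "\<lambda>j. 0 + (if j = i then 1 else 0)"] unfolding qform_perturb[OF assms(2)]
    by (simp add: qform_def)
qed

text \<open>If the diagonal entry vanishes, then the form is real affine in the shift t along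
  coordinate i, and a non-constant affine function cannot stay non-negative.\<close>

lemma psd_diag_zero:
  assumes P: "psd N A" and ij: "i < N" "j < N" and z: "A $$ (i,i) = 0"
  shows "A $$ (i,j) = 0"
proof (rule ccontr)
  assume nz: "A $$ (i,j) \<noteq> 0"
  have A: "A \<in> carrier_mat N N" "hermitian A" and q: "\<And>v. 0 \<le> Re (qform N A v)"
    using P by (auto simp: psd_iff_qform)
  let ?v = "\<lambda>l. 0 + (if l = j then 1 else 0) :: complex"
  have v: "qform N A ?v = A $$ (j,j)" unfolding qform_perturb[OF ij(2)] by (simp add: qform_def)
  have "(\<Sum>l<N. A $$ (i,l) * ?v l) = (\<Sum>l<N. if l = j then A $$ (i,l) else 0)" by (intro sum.cong) auto
  then have s1: "(\<Sum>l<N. A $$ (i,l) * ?v l) = A $$ (i,j)" using ij by simp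
  have "(\<Sum>l<N. cnj (?v l) * A $$ (l,i)) = (\<Sum>l<N. if l = j then A $$ (l,i) else 0)" by (intro sum.cong) auto
  then have s2: "(\<Sum>l<N. cnj (?v l) * A $$ (l,i)) = cnj (A $$ (i,j))"
    using ij hermitian_index[OF A(2,1) ij] by simp
  \<comment> \<open>At the shifted vector the form equals
    \<open>Re (A $$ (j,j)) - 2 * s * (cmod (A $$ (i,j)))\<^sup>2\<close>; this scale makes it
    exactly -1.\<close>
  define s where "s = (Re (A $$ (j,j)) + 1) / (2 * (cmod (A $$ (i,j)))\<^sup>2)"
  define t where "t = - complex_of_real s * A $$ (i,j)"
  have "0 \<le> Re (qform N A (\<lambda>l. ?v l + (if l = i then t else 0)))" by (rule q)
  also have "\<dots> = Re (A $$ (j,j)) + Re (cnj t * A $$ (i,j) + cnj (cnj t * A $$ (i,j)))"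
    unfolding qform_perturb[OF ij(1)] v s1 s2 z by simp
  also have "\<dots> = Re (A $$ (j,j)) - 2 * s * (cmod (A $$ (i,j)))\<^sup>2"
    unfolding t_def cmod_power2 by (simp add: power2_eq_square algebra_simps)
  also have "\<dots> = -1" using nz by (simp add: s_def field_simps)
  finally show False by simp
qed

section \<open>Schur complements and rank-one decompositions\<close>

lemma ketbra_carrier[simp, intro]: "v \<in> carrier_vec N \<Longrightarrow> ketbra v \<in> carrier_mat N N"
  by (auto simp: ketbra_def)

lemma dim_ketbra[simp]: "dim_row (ketbra v) = dim_vec v" "dim_col (ketbra v) = dim_vec v"
  by (simp_all add: ketbra_def)

lemma index_ketbra:
  "v \<in> carrier_vec N \<Longrightarrow> a < N \<Longrightarrow> b < N \<Longrightarrow> ketbra v $$ (a,b) = v $ a * cnj (v $ b)"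
  by (simp add: ketbra_def)

text \<open>One elimination step. The vector w is column i divided by the square root of the pivot,
  and subtracting \<open>ketbra w\<close> leaves the Schur complement, bordered by a zero row and
  column. The last conclusion, that w inherits the zeros of column i, is what keeps rows clear that
  were cleared earlier. A zero pivot already has a zero row, so w = 0 serves.\<close>

lemma psd_pivot:
  assumes P: "psd N A" and i: "i < N"
  obtains w where "w \<in> carrier_vec N" "psd N (A - ketbra w)"
    "\<And>j. j < N \<Longrightarrow> (A - ketbra w) $$ (i,j) = 0"
    "\<And>l. l < N \<Longrightarrow> A $$ (l,i) = 0 \<Longrightarrow> w $ l = 0"
proof (cases "A $$ (i,i) = 0")
  case True
  have A: "A \<in> carrier_mat N N" by (rule psd_carrier[OF P])
  have eq: "A - ketbra (0\<^sub>v N) = A"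
    using A by (intro eq_matI) (auto simp: ketbra_def)
  show ?thesis
    by (rule that[of "0\<^sub>v N"]) (use eq P psd_diag_zero[OF P i _ True] in auto)
next
  case False
  have A: "A \<in> carrier_mat N N" "hermitian A" and q: "\<And>v. 0 \<le> Re (qform N A v)"
    using P by (auto simp: psd_iff_qform)
  define c where "c = Re (A $$ (i,i))"
  have c: "c > 0" "A $$ (i,i) = complex_of_real c" 
    using psd_diag[OF P i] False unfolding c_def by (auto simp: order_less_le)
  define w where "w = vec N (\<lambda>l. A $$ (l,i) / complex_of_real (sqrt c))"
  have sc: "complex_of_real (sqrt c) * complex_of_real (sqrt c) = complex_of_real c"
    unfolding of_real_mult[symmetric] using c by simp
  have w: "w \<in> carrier_vec N" by (simp add: w_def)
  have ww: "ketbra w $$ (a,b) = A $$ (a,i) * A $$ (i,b) / complex_of_real c" if "a < N" "b < N" for a b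
    unfolding index_ketbra[OF w that] using that hermitian_index[OF A(2,1) i that(2)] by (simp add: w_def sc)
  have D: "(A - ketbra w) $$ (a,b) = A $$ (a,b) - A $$ (a,i) * A $$ (i,b) / complex_of_real c" if "a < N" "b < N" for a b
    using that A w ww[OF that] by (simp add: ketbra_def)
  have "psd N (A - ketbra w)"
    unfolding psd_iff_qform
  proof (intro conjI allI)
    show "hermitian (A - ketbra w)"
      unfolding hermitian_def
    proof (rule eq_matI)
      fix a b assume "a < dim_row (A - ketbra w)" "b < dim_col (A - ketbra w)"
      then have ab: "a < N" "b < N" using w by auto
      have "cnj (A $$ (b,a)) = A $$ (a,b)" using hermitian_index[OF A(2,1) ab] by simp
      then show "adj (A - ketbra w) $$ (a,b) = (A - ketbra w) $$ (a,b)"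
        using ab A(1) w by (simp add: index_ketbra[OF w])
    qed (use A(1) w in auto)
    fix v
    define u where "u = (\<Sum>j<N. A $$ (i,j) * v j)"
    have b: "(\<Sum>j<N. cnj (v j) * A $$ (j,i)) = cnj u"
      unfolding u_def cnj_sum using i by (intro sum.cong refl) (simp add: hermitian_index[OF A(2,1) i])
    have "qform N (A - ketbra w) v = (\<Sum>a<N. \<Sum>b<N. cnj (v a) * A $$ (a,b) * v b
        - (cnj (v a) * A $$ (a,i)) * (A $$ (i,b) * v b) / complex_of_real c)"
      unfolding qform_def by (intro sum.cong refl) (simp add: D algebra_simps del: index_minus_mat)
    also have "\<dots> = qform N A v - (\<Sum>a<N. \<Sum>b<N. (cnj (v a) * A $$ (a,i)) * (A $$ (i,b) * v b)) / complex_of_real c"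
      by (simp only: sum_subtractf qform_def sum_divide_distrib)
    also have "\<dots> = qform N A v - cnj u * u / complex_of_real c"
      unfolding sum_product[symmetric] b u_def[symmetric] ..
    finally have 1: "qform N (A - ketbra w) v = qform N A v - cnj u * u / complex_of_real c" .
    \<comment> \<open>This shift minimises the form along coordinate i, and the minimum is the value
      of the Schur complement at v, which is therefore non-negative.\<close>
    define t where "t = - u / complex_of_real c"
    have "qform N A (\<lambda>l. v l + (if l = i then t else 0)) = qform N A v - cnj u * u / complex_of_real c"
      unfolding qform_perturb[OF i] u_def[symmetric] b c(2) t_def using c(1) by (simp add: field_simps)
    then show "0 \<le> Re (qform N (A - ketbra w) v)"
      using q[of "\<lambda>l. v l + (if l = i then t else 0)"] unfolding 1 by simp
    show "A - ketbra w \<in> carrier_mat N N" using A w by (intro minus_carrier_mat) auto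
  qed
  moreover have "(A - ketbra w) $$ (i,j) = 0" if "j < N" for j
    using that i c D[OF i that] by simp
  moreover have "w $ l = 0" if "l < N" "A $$ (l,i) = 0" for l
    using that by (simp add: w_def)
  ultimately show ?thesis using that w by blast
qed

text \<open>Symmetric Gaussian elimination, so that no spectral theorem is needed.\<close>
lemma psd_eq_sum_ketbra:
  assumes "psd N A"
  obtains w where "\<And>i. i < N \<Longrightarrow> w i \<in> carrier_vec N" "A = msum N N {..<N} (\<lambda>i. ketbra (w i))"
proof -
  have "\<exists>w. (\<forall>i<N. w i \<in> carrier_vec N) \<and> psd N (A - msum N N {..<r} (\<lambda>i. ketbra (w i))) \<and>
     (\<forall>i<r. \<forall>j<N. (A - msum N N {..<r} (\<lambda>i. ketbra (w i))) $$ (i,j) = 0)" if "r \<le> N" for r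
    using that
  proof (induction r)
    case 0
    have "A - msum N N {..<0::nat} (\<lambda>i. ketbra (0\<^sub>v N)) = A"
      using psd_carrier[OF assms] by (intro eq_matI) (simp_all add: msum_empty)
    then show ?case using assms by (intro exI[of _ "\<lambda>_. 0\<^sub>v N"]) (simp only: less_nat_zero_code, simp)
  next
    case (Suc r)
    from Suc_leD[OF Suc.prems] obtain w where w: "\<And>i. i < N \<Longrightarrow> w i \<in> carrier_vec N"
      and P: "psd N (A - msum N N {..<r} (\<lambda>i. ketbra (w i)))"
      and Z: "\<And>i j. i < r \<Longrightarrow> j < N \<Longrightarrow> (A - msum N N {..<r} (\<lambda>i. ketbra (w i))) $$ (i,j) = 0"
      using Suc.IH by blast
    let ?B = "A - msum N N {..<r} (\<lambda>i. ketbra (w i))"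
    have r: "r < N" using Suc by simp
    obtain u where u: "u \<in> carrier_vec N" "psd N (?B - ketbra u)"
       "\<And>j. j < N \<Longrightarrow> (?B - ketbra u) $$ (r,j) = 0"
       "\<And>l. l < N \<Longrightarrow> ?B $$ (l,r) = 0 \<Longrightarrow> u $ l = 0"
      using psd_pivot[OF P r] by blast
    have A: "A \<in> carrier_mat N N" by (rule psd_carrier[OF assms])
    have eq: "A - msum N N {..<Suc r} (\<lambda>i. ketbra ((w(r:=u)) i)) = ?B - ketbra u"
      using A u(1) by (intro eq_matI) auto
    have z: "(?B - ketbra u) $$ (i,j) = 0" if "i < Suc r" "j < N" for i j
    proof (cases "i = r")
      case False
      then have i: "i < r" using that by simp
      \<comment> \<open>A row cleared earlier has a zero in column r, so \<open>u\<close> vanishes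
        at that row and subtracting \<open>ketbra u\<close> leaves it unchanged.\<close>
      then have "u $ i = 0" using Z[OF i r] u(4)[of i] r by simp
      then have "ketbra u $$ (i,j) = 0" using i r that by (simp add: index_ketbra[OF u(1)])
      moreover have "(?B - ketbra u) $$ (i,j) = ?B $$ (i,j) - ketbra u $$ (i,j)"
        using i r that u(1) by (intro index_minus_mat(1)) auto
      ultimately show ?thesis using Z[OF i that(2)] by simp
    qed (use u(3) that in simp)
    show ?case
      by (rule exI[of _ "w(r:=u)"]) (unfold eq, use w u(1,2) z in auto)
  qed
  from this[OF order_refl] obtain w where w: "\<And>i. i < N \<Longrightarrow> w i \<in> carrier_vec N"
    "\<And>i j. i < N \<Longrightarrow> j < N \<Longrightarrow> (A - msum N N {..<N} (\<lambda>i. ketbra (w i))) $$ (i,j) = 0" by blast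
  have "A = msum N N {..<N} (\<lambda>i. ketbra (w i))"
    using w(2) psd_carrier[OF assms] by (intro eq_matI) auto
  then show ?thesis using that w(1) by blast
qed

text \<open>The columns of B are the vectors of the rank-one decomposition.\<close>

lemma psd_eq_mult_adj:
  assumes "psd N A"
  obtains B where "B \<in> carrier_mat N N" "A = B * adj B"
proof -
  obtain w where w: "\<And>i. i < N \<Longrightarrow> w i \<in> carrier_vec N" "A = msum N N {..<N} (\<lambda>i. ketbra (w i))"
    using psd_eq_sum_ketbra[OF assms] by blast
  let ?B = "mat N N (\<lambda>(i,j). w j $ i)"
  have B: "?B \<in> carrier_mat N N" by simp
  have "A = ?B * adj ?B"
  proof (rule eq_matI)
    fix i j assume "i < dim_row (?B * adj ?B)" "j < dim_col (?B * adj ?B)"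
    then have ij: "i < N" "j < N" by auto
    show "A $$ (i,j) = (?B * adj ?B) $$ (i,j)"
      unfolding index_mult_sum[OF B adj_carrier[OF B] ij] w(2) index_msum[OF ij]
      using ij w(1) by (intro sum.cong refl) (auto simp: index_ketbra[of _ N])
  qed (use w in auto)
  then show ?thesis using that B by blast
qed

text \<open>Once A is factored as \<open>B * adj B\<close>, the conjugated matrix is
  \<open>(K * B) * adj (K * B)\<close>, which is positive by its shape, also for rectangular
  K.\<close>

lemma psd_congruence:
  assumes "psd N A" "K \<in> carrier_mat M N"
  shows "psd M (K * A * adj K)"
proof -
  obtain B where B: "B \<in> carrier_mat N N" "A = B * adj B" using psd_eq_mult_adj[OF assms(1)] .
  note aB = adj_carrier[OF B(1)] and aK = adj_carrier[OF assms(2)]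
  have "K * A * adj K = K * (B * (adj B * adj K))"
    unfolding B(2) assoc_mult_mat[OF assms(2) mult_carrier_mat[OF B(1) aB] aK] assoc_mult_mat[OF B(1) aB aK] ..
  also have "\<dots> = (K * B) * adj (K * B)"
    unfolding adj_mult[OF assms(2) B(1)] assoc_mult_mat[OF assms(2) B(1) mult_carrier_mat[OF aB aK]] ..
  finally have "K * A * adj K = (K * B) * adj (K * B)" .
  then show ?thesis using psd_mult_adj[of "K * B" M N] assms(2) B(1) by simp
qed

lemma mtrace_psd:
  assumes "psd N A"
  shows "0 \<le> Re (mtrace A)" "mtrace A = complex_of_real (Re (mtrace A))"
  using assms psd_diag[OF assms] psd_carrier[OF assms]
  by (auto simp: mtrace_def complex_eq_iff intro!: sum_nonneg sum.neutral)

text \<open>Non-negative diagonal entries with sum zero all vanish, and the rows vanish with them.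
  An outcome of probability zero thus has the zero matrix as its unnormalised state.\<close>

lemma psd_trace_zero:
  assumes "psd N A" "Re (mtrace A) = 0"
  shows "A = 0\<^sub>m N N"
proof (rule eq_matI)
  fix i j assume "i < dim_row (0\<^sub>m N N :: complex mat)" "j < dim_col (0\<^sub>m N N :: complex mat)"
  then have ij: "i < N" "j < N" by auto
  have "(\<Sum>i<N. Re (A $$ (i,i))) = 0" using assms psd_carrier[OF assms(1)] by (simp add: mtrace_def)
  then have "Re (A $$ (i,i)) = 0"
    using psd_diag(2)[OF assms(1)] ij by (subst (asm) sum_nonneg_eq_0_iff) auto
  then have "A $$ (i,i) = 0" using psd_diag(1)[OF assms(1) ij(1)] by simp
  then show "A $$ (i,j) = 0\<^sub>m N N $$ (i,j)" using psd_diag_zero[OF assms(1) ij] ij by simp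
qed (use psd_carrier[OF assms(1)] in auto)

section \<open>Local Kraus operators\<close>

definition ket :: "complex vec \<Rightarrow> complex mat" where
  "ket v = mat (dim_vec v) 1 (\<lambda>(i,j). v $ i)"

text \<open>This operator sends a vector to its tensor product with v. It is an isometry for a unit
  vector v, and its adjoints for the basis vectors are the Kraus operators of the partial trace over
  the ancilla.\<close>

definition attach :: "nat \<Rightarrow> complex vec \<Rightarrow> complex mat" where
  "attach m v = kron (1\<^sub>m m) (ket v)"

definition lconj :: "nat list \<Rightarrow> nat \<Rightarrow> complex mat \<Rightarrow> complex mat \<Rightarrow> complex mat" where
  "lconj d k K \<rho> = embed d k K * \<rho> * adj (embed d k K)"

lemma dim_ket[simp]: "dim_row (ket v) = dim_vec v" "dim_col (ket v) = 1"
  by (simp_all add: ket_def)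

lemma ket_carrier: "v \<in> carrier_vec e \<Longrightarrow> ket v \<in> carrier_mat e 1"
  by (auto simp: ket_def)

lemma index_ket[simp]: "i < dim_vec v \<Longrightarrow> ket v $$ (i, 0) = v $ i"
  by (simp add: ket_def)

lemma ketbra_eq: "ketbra v = ket v * adj (ket v)"
proof (rule eq_matI)
  fix i j assume "i < dim_row (ket v * adj (ket v))" "j < dim_col (ket v * adj (ket v))"
  then have ij: "i < dim_vec v" "j < dim_vec v" by auto
  have c: "ket v \<in> carrier_mat (dim_vec v) 1" by (rule ket_carrier) simp
  show "ketbra v $$ (i,j) = (ket v * adj (ket v)) $$ (i,j)"
    unfolding index_mult_sum[OF c adj_carrier[OF c] ij] using ij by (simp add: ketbra_def)
qed auto

lemma bra_ket:
  assumes "v \<in> carrier_vec e" "w \<in> carrier_vec e"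
  shows "adj (ket v) * ket w = (conjugate v \<bullet> w) \<cdot>\<^sub>m 1\<^sub>m 1"
proof (rule eq_matI)
  fix i j assume "i < dim_row ((conjugate v \<bullet> w) \<cdot>\<^sub>m 1\<^sub>m 1)" "j < dim_col ((conjugate v \<bullet> w) \<cdot>\<^sub>m 1\<^sub>m 1)"
  then have ij: "i = 0" "j = 0" by auto
  have z: "(0::nat) < 1" by simp
  show "(adj (ket v) * ket w) $$ (i,j) = ((conjugate v \<bullet> w) \<cdot>\<^sub>m 1\<^sub>m 1) $$ (i,j)"
    unfolding ij index_mult_sum[OF adj_carrier[OF ket_carrier[OF assms(1)]] ket_carrier[OF assms(2)] z z]
    using assms by (simp add: scalar_prod_def atLeast0LessThan)
qed auto

lemma attach_carrier: "v \<in> carrier_vec e \<Longrightarrow> attach m v \<in> carrier_mat (m * e) m"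
  unfolding attach_def using kron_carrier[OF one_carrier_mat ket_carrier, of v e m] by simp

lemma adj_attach_attach:
  assumes "v \<in> carrier_vec e" "w \<in> carrier_vec e"
  shows "adj (attach m v) * attach m w = (conjugate v \<bullet> w) \<cdot>\<^sub>m 1\<^sub>m m"
proof -
  have "adj (attach m v) * attach m w = kron (1\<^sub>m m * 1\<^sub>m m) (adj (ket v) * ket w)"
    unfolding attach_def adj_kron adj_one
    by (rule kron_mult[OF one_carrier_mat adj_carrier[OF ket_carrier[OF assms(1)]] one_carrier_mat ket_carrier[OF assms(2)]])
  then show ?thesis by (simp add: bra_ket[OF assms] kron_smult_right)
qed

section \<open>Attaching an ancilla to one party\<close>

lemma swap_mat_carrier: "swap_mat a e \<in> carrier_mat (e * a) (a * e)"
  by (simp add: swap_mat_def)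

text \<open>A Kronecker product appends the ancilla behind the last party, whereas it has to sit
  directly behind party k; the swap carries its ket in front of the identity on the later
  parties.\<close>

lemma swap_mat_kron_ket:
  assumes v: "v \<in> carrier_vec e"
  shows "swap_mat a e * kron (1\<^sub>m a) (ket v) = kron (ket v) (1\<^sub>m a)"
proof (rule eq_matI)
  fix i j assume "i < dim_row (kron (ket v) (1\<^sub>m a))" "j < dim_col (kron (ket v) (1\<^sub>m a))"
  then have ij: "i < e * a" "j < a" using v by auto
  have dv: "dim_vec v = e" using v by simp
  note dm = less_mult_divmod[OF ij(1)]
  have k: "kron (1\<^sub>m a) (ket v) \<in> carrier_mat (a * e) a"
    using attach_carrier[OF v, of a] by (simp add: attach_def)
  have "(swap_mat a e * kron (1\<^sub>m a) (ket v)) $$ (i,j) =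
      (\<Sum>l<a*e. (if i = (l mod e) * a + l div e then 1 else 0) * ((if l div e = j then 1 else 0) * v $ (l mod e)))"
    unfolding index_mult_sum[OF swap_mat_carrier k ij]
    using ij dv by (intro sum.cong refl) (auto simp: index_kron swap_mat_def less_mult_divmod)
  also have "\<dots> = (\<Sum>x<a. \<Sum>y<e. (if i = y * a + x then 1 else 0) * ((if x = j then 1 else 0) * v $ y))"
    by (rule sum_div_mod)
  also have "\<dots> = (\<Sum>y<e. \<Sum>x<a. if x = j then (if i = y * a + x then v $ y else 0) else 0)"
    by (subst sum.swap) (intro sum.cong refl, simp)
  also have "\<dots> = (\<Sum>y<e. if i = y * a + j then v $ y else 0)"
    using ij by simp
  \<comment> \<open>Because \<open>j < a\<close>, the equation says that y and j are quotient and
    remainder of i by a, which leaves a single term in y.\<close>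
  also have "\<dots> = (\<Sum>y<e. if y = i div a then (if i mod a = j then v $ y else 0) else 0)"
  proof (intro sum.cong refl)
    fix y
    have "i = y * a + j \<longleftrightarrow> y = i div a \<and> i mod a = j"
    proof
      assume "i = y * a + j" then show "y = i div a \<and> i mod a = j" using ij(2) by simp
    next
      assume "y = i div a \<and> i mod a = j"
      then show "i = y * a + j" using div_mult_mod_eq[of i a] by simp
    qed
    then show "(if i = y * a + j then v $ y else 0) = (if y = i div a then (if i mod a = j then v $ y else 0) else 0)"
      by simp
  qed
  also have "\<dots> = kron (ket v) (1\<^sub>m a) $$ (i,j)"
    using ij dm dv by (simp add: index_kron)
  finally show "(swap_mat a e * kron (1\<^sub>m a) (ket v)) $$ (i,j) = kron (ket v) (1\<^sub>m a) $$ (i,j)" .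
qed (use v in \<open>auto simp: swap_mat_def\<close>)

lemma smult_smult: "a \<cdot>\<^sub>m (b \<cdot>\<^sub>m A) = (a * b) \<cdot>\<^sub>m A"
  for a b :: complex
  by (rule eq_matI) auto

lemma mult_assoc_conj:
  fixes A :: "'a::semiring_0 mat"
  assumes A: "A \<in> carrier_mat a b" and B: "B \<in> carrier_mat b c" and R: "R \<in> carrier_mat c c'"
    and C: "C \<in> carrier_mat c' b'" and D: "D \<in> carrier_mat b' a'"
  shows "A * (B * R * C) * D = (A * B) * R * (C * D)"
proof -
  have "A * (B * R * C) * D = A * (B * (R * (C * D)))"
    unfolding assoc_mult_mat[OF A mult_carrier_mat[OF mult_carrier_mat[OF B R] C] D]
      assoc_mult_mat[OF mult_carrier_mat[OF B R] C D] assoc_mult_mat[OF B R mult_carrier_mat[OF C D]] ..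
  also have "\<dots> = (A * B) * R * (C * D)"
    unfolding assoc_mult_mat[OF mult_carrier_mat[OF A B] R mult_carrier_mat[OF C D]]
      assoc_mult_mat[OF A B mult_carrier_mat[OF R mult_carrier_mat[OF C D]]] ..
  finally show ?thesis .
qed

lemma prod_list_split:
  fixes d :: "nat list"
  shows "prod_list d = prod_list (take k d) * prod_list (drop k d)"
  by (simp flip: prod_list.append)

lemma prod_list_take_Suc:
  fixes d :: "nat list"
  assumes "k < length d"
  shows "prod_list (take (Suc k) d) = prod_list (take k d) * d ! k"
  using assms by (simp add: take_Suc_conv_app_nth)

text \<open>Appending a ket at the end and permuting it into place amounts to an operator of party k
  alone. Attaching a pure ancilla is therefore conjugation by a local isometry.\<close>

lemma embed_attach:
  assumes "k < length d" "v \<in> carrier_vec e"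
  shows "kron (1\<^sub>m (prod_list (take (Suc k) d))) (swap_mat (prod_list (drop (Suc k) d)) e) *
     kron (1\<^sub>m (prod_list d)) (ket v) = embed d k (attach (d ! k) v)"
proof -
  let ?b = "prod_list (take (Suc k) d)" and ?a = "prod_list (drop (Suc k) d)" and ?l = "prod_list (take k d)"
  have K: "kron (1\<^sub>m ?a) (ket v) \<in> carrier_mat (?a * e) (?a * 1)"
    by (intro kron_carrier one_carrier_mat ket_carrier assms)
  have "kron (1\<^sub>m (prod_list d)) (ket v) = kron (1\<^sub>m ?b) (kron (1\<^sub>m ?a) (ket v))"
    unfolding prod_list_split[of d "Suc k"] kron_one[symmetric] kron_assoc ..
  then have "kron (1\<^sub>m ?b) (swap_mat ?a e) * kron (1\<^sub>m (prod_list d)) (ket v)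
      = kron (1\<^sub>m ?b * 1\<^sub>m ?b) (swap_mat ?a e * kron (1\<^sub>m ?a) (ket v))"
    using kron_mult[OF one_carrier_mat swap_mat_carrier one_carrier_mat K] by simp
  also have "\<dots> = kron (1\<^sub>m (?l * d ! k)) (kron (ket v) (1\<^sub>m ?a))"
    by (simp add: swap_mat_kron_ket[OF assms(2)] prod_list_take_Suc[OF assms(1)])
  also have "\<dots> = embed d k (attach (d ! k) v)"
    unfolding embed_kron[OF assms(1)] attach_def kron_one[symmetric] kron_assoc ..
  finally show ?thesis .
qed

lemma add_anc_ketbra:
  assumes k: "k < length d" and r: "\<rho> \<in> carrier_mat (prod_list d) (prod_list d)" and v: "v \<in> carrier_vec e"
  shows "add_anc d k e \<rho> (ketbra v) = lconj d k (attach (d ! k) v) \<rho>"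
proof -
  let ?N = "prod_list d"
  let ?b = "prod_list (take (Suc k) d)" and ?a = "prod_list (drop (Suc k) d)"
  let ?P = "kron (1\<^sub>m ?b) (swap_mat ?a e)" and ?T = "kron (1\<^sub>m ?N) (ket v)"
  note K = ket_carrier[OF v]
  have "?T * kron \<rho> (1\<^sub>m 1) = kron (1\<^sub>m ?N * \<rho>) (ket v * 1\<^sub>m 1)"
    by (rule kron_mult[OF one_carrier_mat K r one_carrier_mat])
  then have "?T * \<rho> = kron \<rho> (ket v)" using r K by simp
  moreover have "kron \<rho> (ket v) * adj ?T = kron (\<rho> * 1\<^sub>m ?N) (ket v * adj (ket v))"
    unfolding adj_kron adj_one by (rule kron_mult[OF r K one_carrier_mat adj_carrier[OF K]])
  ultimately have kr: "kron \<rho> (ketbra v) = ?T * \<rho> * adj ?T" using r by (simp add: ketbra_eq)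
  have P: "?P \<in> carrier_mat (?b * (e * ?a)) (?N * e)"
    using kron_carrier[OF one_carrier_mat swap_mat_carrier, of ?b ?a e] by (simp add: prod_list_split[of d "Suc k"] mult.assoc)
  have T: "?T \<in> carrier_mat (?N * e) ?N"
    using kron_carrier[OF one_carrier_mat K, of ?N] by simp
  have "?P * (?T * \<rho> * adj ?T) * adj ?P = (?P * ?T) * \<rho> * (adj ?T * adj ?P)"
    by (rule mult_assoc_conj[OF P T r adj_carrier[OF T] adj_carrier[OF P]])
  also have "\<dots> = (?P * ?T) * \<rho> * adj (?P * ?T)" by (simp add: adj_mult[OF P T])
  finally show ?thesis
    by (simp add: add_anc_def Let_def kr lconj_def embed_attach[OF k v])
qed

text \<open>Together with a rank-one decomposition of the ancilla state, linearity reduces a mixed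
  ancilla to attached vectors.\<close>

lemma add_anc_msum:
  assumes k: "k < length d" and r: "\<rho> \<in> carrier_mat (prod_list d) (prod_list d)"
    and g: "\<And>x. x \<in> I \<Longrightarrow> g x \<in> carrier_mat e e"
  shows "add_anc d k e \<rho> (msum e e I g) =
     msum (prod_list (d[k := d ! k * e])) (prod_list (d[k := d ! k * e])) I (\<lambda>x. add_anc d k e \<rho> (g x))"
proof -
  let ?N = "prod_list d" and ?N' = "prod_list (d[k := d ! k * e])"
  let ?b = "prod_list (take (Suc k) d)" and ?a = "prod_list (drop (Suc k) d)"
  let ?P = "kron (1\<^sub>m ?b) (swap_mat ?a e)"
  have "?b * (e * ?a) = ?N'"
    by (simp add: prod_list_update[OF k] prod_list_take_Suc[OF k] mult_ac)
  moreover have "?P \<in> carrier_mat (?b * (e * ?a)) (?N * e)"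
    using kron_carrier[OF one_carrier_mat swap_mat_carrier, of ?b ?a e] by (simp add: prod_list_split[of d "Suc k"] mult.assoc)
  ultimately have P: "?P \<in> carrier_mat ?N' (?N * e)" by simp
  have c: "kron \<rho> (g x) \<in> carrier_mat (?N * e) (?N * e)" if "x \<in> I" for x
    using kron_carrier[OF r g[OF that]] .
  have "kron \<rho> (msum e e I g) = msum (?N * e) (?N * e) I (\<lambda>x. kron \<rho> (g x))"
    by (rule kron_msum_right[OF _ r]) (rule g)
  moreover have "?P * \<dots> = msum ?N' (?N * e) I (\<lambda>x. ?P * kron \<rho> (g x))"
    by (rule mult_msum[OF P]) (rule c)
  moreover have "\<dots> * adj ?P = msum ?N' ?N' I (\<lambda>x. ?P * kron \<rho> (g x) * adj ?P)"
    by (rule msum_mult[OF adj_carrier[OF P]]) (rule mult_carrier_mat[OF P c])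
  ultimately show ?thesis by (simp add: add_anc_def Let_def)
qed

section \<open>Conjugation by a Kraus operator of one party\<close>

lemma embed_carrier':
  assumes "k < length d" "K \<in> carrier_mat e (d ! k)"
  shows "embed d k K \<in> carrier_mat (prod_list (d[k := e])) (prod_list d)"
  using embed_carrier[OF assms] by simp

lemma lconj_carrier:
  assumes "k < length d" "K \<in> carrier_mat e (d ! k)" "\<rho> \<in> carrier_mat (prod_list d) (prod_list d)"
  shows "lconj d k K \<rho> \<in> carrier_mat (prod_list (d[k := e])) (prod_list (d[k := e]))"
  unfolding lconj_def using embed_carrier'[OF assms(1,2)] assms(3)
  by (intro mult_carrier_mat adj_carrier)

lemma lconj_lconj:
  assumes k: "k < length d" and K: "K \<in> carrier_mat e (d ! k)" and M: "M \<in> carrier_mat e' e"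
    and r: "\<rho> \<in> carrier_mat (prod_list d) (prod_list d)"
  shows "lconj (d[k := e]) k M (lconj d k K \<rho>) = lconj d k (M * K) \<rho>"
proof -
  let ?K = "embed d k K" and ?M = "embed d k M"
  have eK: "?K \<in> carrier_mat (prod_list (d[k := e])) (prod_list d)" by (rule embed_carrier'[OF k K])
  have eM: "?M \<in> carrier_mat (prod_list (d[k := e'])) (prod_list (d[k := e]))" by (rule embed_carrier[OF k M])
  have "?M * (?K * \<rho> * adj ?K) * adj ?M = (?M * ?K) * \<rho> * (adj ?K * adj ?M)"
    by (rule mult_assoc_conj[OF eM eK r adj_carrier[OF eK] adj_carrier[OF eM]])
  then show ?thesis
    by (simp add: lconj_def k embed_mult[OF k M K] adj_mult[OF eM eK])
qed

lemma lconj_one: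
  assumes "k < length d" "\<rho> \<in> carrier_mat (prod_list d) (prod_list d)"
  shows "lconj d k (1\<^sub>m (d ! k)) \<rho> = \<rho>"
  using assms by (simp add: lconj_def embed_one)

lemma lconj_psd:
  assumes "k < length d" "K \<in> carrier_mat e (d ! k)" "psd (prod_list d) \<rho>"
  shows "psd (prod_list (d[k := e])) (lconj d k K \<rho>)"
  unfolding lconj_def by (rule psd_congruence[OF assms(3) embed_carrier'[OF assms(1,2)]])

lemma lconj_smult:
  assumes "k < length d" "K \<in> carrier_mat e (d ! k)" "\<rho> \<in> carrier_mat (prod_list d) (prod_list d)"
  shows "lconj d k K (c \<cdot>\<^sub>m \<rho>) = c \<cdot>\<^sub>m lconj d k K \<rho>"
proof -
  note E = embed_carrier'[OF assms(1,2)]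
  show ?thesis unfolding lconj_def
    by (simp add: mult_smult_distrib[OF E assms(3)] mult_smult_assoc_mat[OF mult_carrier_mat[OF E assms(3)] adj_carrier[OF E]])
qed

lemma lconj_smult_op:
  assumes "k < length d" "K \<in> carrier_mat e (d ! k)" "\<rho> \<in> carrier_mat (prod_list d) (prod_list d)"
  shows "lconj d k (c \<cdot>\<^sub>m K) \<rho> = (c * cnj c) \<cdot>\<^sub>m lconj d k K \<rho>"
proof -
  note E = embed_carrier'[OF assms(1,2)]
  note X = mult_carrier_mat[OF E assms(3)] and aE = adj_carrier[OF E]
  have "(c \<cdot>\<^sub>m embed d k K) * \<rho> * (cnj c \<cdot>\<^sub>m adj (embed d k K)) = c \<cdot>\<^sub>m (cnj c \<cdot>\<^sub>m (embed d k K * \<rho> * adj (embed d k K)))"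
    unfolding mult_smult_assoc_mat[OF E assms(3)] mult_smult_distrib[OF smult_carrier_mat[OF X] aE] mult_smult_assoc_mat[OF X aE]
    by (simp add: smult_smult mult.commute)
  then show ?thesis unfolding lconj_def embed_smult[OF assms(1)] adj_smult smult_smult .
qed

lemma lconj_msum:
  assumes "k < length d" "K \<in> carrier_mat e (d ! k)"
    "\<And>x. x \<in> I \<Longrightarrow> g x \<in> carrier_mat (prod_list d) (prod_list d)"
  shows "lconj d k K (msum (prod_list d) (prod_list d) I g) =
    msum (prod_list (d[k := e])) (prod_list (d[k := e])) I (\<lambda>x. lconj d k K (g x))"
proof -
  note E = embed_carrier'[OF assms(1,2)]
  have "embed d k K * msum (prod_list d) (prod_list d) I g
      = msum (prod_list (d[k := e])) (prod_list d) I (\<lambda>x. embed d k K * g x)"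
    by (rule mult_msum[OF E]) (rule assms(3))
  moreover have "\<dots> * adj (embed d k K) = msum (prod_list (d[k := e])) (prod_list (d[k := e])) I (\<lambda>x. embed d k K * g x * adj (embed d k K))"
    by (rule msum_mult[OF adj_carrier[OF E]]) (rule mult_carrier_mat[OF E assms(3)])
  ultimately show ?thesis by (simp add: lconj_def)
qed

lemma mtrace_lconj:
  assumes "k < length d" "K \<in> carrier_mat e (d ! k)" "\<rho> \<in> carrier_mat (prod_list d) (prod_list d)"
  shows "mtrace (lconj d k K \<rho>) = mtrace (embed d k (adj K * K) * \<rho>)"
proof -
  note E = embed_carrier'[OF assms(1,2)]
  have "mtrace (lconj d k K \<rho>) = mtrace (adj (embed d k K) * (embed d k K * \<rho>))"
    unfolding lconj_def by (rule mtrace_comm[OF mult_carrier_mat[OF E assms(3)] adj_carrier[OF E]])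
  also have "adj (embed d k K) * (embed d k K * \<rho>) = embed d k (adj K * K) * \<rho>"
    unfolding embed_mult[OF assms(1) adj_carrier[OF assms(2)] assms(2)] adj_embed[OF assms(1), symmetric]
    using assoc_mult_mat[OF adj_carrier[OF E] E assms(3)] by simp
  finally show ?thesis .
qed

text \<open>Cyclicity of the trace turns each term into one with \<open>adj (K x) * K x\<close>, and
  completeness sums these to the identity: total probability is preserved.\<close>

lemma mtrace_lconj_complete:
  assumes k: "k < length d" and K: "\<And>x. x \<in> I \<Longrightarrow> K x \<in> carrier_mat (e x) (d ! k)"
    and r: "\<rho> \<in> carrier_mat (prod_list d) (prod_list d)"
    and one: "msum (d ! k) (d ! k) I (\<lambda>x. adj (K x) * K x) = 1\<^sub>m (d ! k)"
  shows "(\<Sum>x\<in>I. mtrace (lconj d k (K x) \<rho>)) = mtrace \<rho>"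
proof -
  let ?N = "prod_list d"
  have c: "adj (K x) * K x \<in> carrier_mat (d ! k) (d ! k)" if "x \<in> I" for x using K[OF that] by auto
  have cE: "embed d k (adj (K x) * K x) \<in> carrier_mat ?N ?N" if "x \<in> I" for x
    using embed_carrier'[OF k c[OF that]] by simp
  have "(\<Sum>x\<in>I. mtrace (lconj d k (K x) \<rho>)) = (\<Sum>x\<in>I. mtrace (embed d k (adj (K x) * K x) * \<rho>))"
    by (intro sum.cong refl mtrace_lconj[OF k K r])
  also have "\<dots> = mtrace (msum ?N ?N I (\<lambda>x. embed d k (adj (K x) * K x) * \<rho>))"
    by (rule mtrace_msum[symmetric]) (rule mult_carrier_mat[OF cE r])
  also have "msum ?N ?N I (\<lambda>x. embed d k (adj (K x) * K x) * \<rho>) = msum ?N ?N I (\<lambda>x. embed d k (adj (K x) * K x)) * \<rho>"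
    by (rule msum_mult[OF r, symmetric]) (rule cE)
  also have "msum ?N ?N I (\<lambda>x. embed d k (adj (K x) * K x)) = embed d k (1\<^sub>m (d ! k))"
    using embed_msum[OF k, of I "\<lambda>x. adj (K x) * K x" "d ! k" "d ! k"] c by (simp add: one)
  finally show ?thesis using r k by (simp add: embed_one)
qed

lemma mtrace_lconj_isometry:
  assumes "k < length d" "V \<in> carrier_mat e (d ! k)" "\<rho> \<in> carrier_mat (prod_list d) (prod_list d)"
    "adj V * V = 1\<^sub>m (d ! k)"
  shows "mtrace (lconj d k V \<rho>) = mtrace \<rho>"
  using mtrace_lconj[OF assms(1-3)] assms by (simp add: embed_one)

text \<open>All cross terms are kept explicitly, since these coherences are what the phase average
  has to remove.\<close>

lemma lconj_msum_op:
  assumes k: "k < length d" and K: "\<And>x. x \<in> I \<Longrightarrow> K x \<in> carrier_mat e (d ! k)"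
    and r: "\<rho> \<in> carrier_mat (prod_list d) (prod_list d)"
  shows "lconj d k (msum e (d ! k) I K) \<rho> = msum (prod_list (d[k := e])) (prod_list (d[k := e])) I
     (\<lambda>x. msum (prod_list (d[k := e])) (prod_list (d[k := e])) I (\<lambda>y. embed d k (K x) * \<rho> * adj (embed d k (K y))))"
proof -
  let ?N = "prod_list d" and ?N' = "prod_list (d[k := e])"
  let ?E = "\<lambda>x. embed d k (K x)"
  have cE: "?E x \<in> carrier_mat ?N' ?N" if "x \<in> I" for x
    using embed_carrier'[OF k K[OF that]] .
  have 1: "embed d k (msum e (d ! k) I K) = msum ?N' ?N I ?E"
    using embed_msum[OF k, of I K e "d ! k"] K by simp
  have 2: "msum ?N' ?N I ?E * \<rho> = msum ?N' ?N I (\<lambda>x. ?E x * \<rho>)"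
    by (rule msum_mult[OF r]) (rule cE)
  have 3: "adj (msum ?N' ?N I ?E) = msum ?N ?N' I (\<lambda>y. adj (?E y))"
    by (rule adj_msum) (rule cE)
  have 4: "msum ?N' ?N I (\<lambda>x. ?E x * \<rho>) * msum ?N ?N' I (\<lambda>y. adj (?E y))
      = msum ?N' ?N' I (\<lambda>x. ?E x * \<rho> * msum ?N ?N' I (\<lambda>y. adj (?E y)))"
    by (rule msum_mult[OF msum_carrier]) (rule mult_carrier_mat[OF cE r])
  also have "\<dots> = msum ?N' ?N' I (\<lambda>x. msum ?N' ?N' I (\<lambda>y. ?E x * \<rho> * adj (?E y)))"
    by (intro msum_cong refl mult_msum) (auto intro: mult_carrier_mat[OF cE r] adj_carrier[OF cE])
  finally show ?thesis unfolding lconj_def 1 2 3 .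
qed

section \<open>The homogeneous extension of a measure and local isometries\<close>

text \<open>With p the trace, this is exactly the summand occurring in \<open>LOCC_monotone\<close>;
  the default 0 makes outcomes of probability zero contribute nothing.\<close>

definition hext :: "(nat list \<Rightarrow> complex mat \<Rightarrow> real) \<Rightarrow> nat list \<Rightarrow> complex mat \<Rightarrow> real" where
  "hext f d \<sigma> = (let p = Re (mtrace \<sigma>) in if 0 < p then p * f d (complex_of_real (1 / p) \<cdot>\<^sub>m \<sigma>) else 0)"

lemma one_smult_mat: "(1::complex) \<cdot>\<^sub>m A = A"
  by (rule eq_matI) auto

lemma is_stateD: "is_state d \<rho> \<Longrightarrow> psd (prod_list d) \<rho>" "is_state d \<rho> \<Longrightarrow> mtrace \<rho> = 1"
  "is_state d \<rho> \<Longrightarrow> \<rho> \<in> carrier_mat (prod_list d) (prod_list d)"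
  by (auto simp: is_state_def psd_carrier)

lemma hext_state: "is_state d \<rho> \<Longrightarrow> hext f d \<rho> = f d \<rho>"
  by (simp add: hext_def is_stateD(2) one_smult_mat)

lemma hext_trace_zero: "Re (mtrace \<sigma>) = 0 \<Longrightarrow> hext f d \<sigma> = 0"
  by (simp add: hext_def)

lemma hext_zero[simp]: "hext f d (0\<^sub>m N N) = 0"
  by (rule hext_trace_zero) simp

lemma is_state_normalize:
  assumes "psd (prod_list d) \<sigma>" "0 < Re (mtrace \<sigma>)"
  shows "is_state d (complex_of_real (1 / Re (mtrace \<sigma>)) \<cdot>\<^sub>m \<sigma>)"
proof -
  have "mtrace (complex_of_real (1 / Re (mtrace \<sigma>)) \<cdot>\<^sub>m \<sigma>) = complex_of_real (1 / Re (mtrace \<sigma>)) * complex_of_real (Re (mtrace \<sigma>))"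
    using mtrace_smult[OF psd_carrier[OF assms(1)]] mtrace_psd(2)[OF assms(1)] by simp
  also have "\<dots> = 1" unfolding of_real_mult[symmetric] using assms(2) by simp
  finally show ?thesis unfolding is_state_def using psd_smult[OF assms(1), of "1 / Re (mtrace \<sigma>)"] assms(2) by simp
qed

lemma hext_smult:
  assumes "\<sigma> \<in> carrier_mat N N" "0 \<le> c"
  shows "hext f d (complex_of_real c \<cdot>\<^sub>m \<sigma>) = c * hext f d \<sigma>"
proof (cases "c = 0")
  case True
  have "complex_of_real c \<cdot>\<^sub>m \<sigma> = 0\<^sub>m N N" using assms True by (intro eq_matI) auto
  then show ?thesis using True by simp
next
  case False
  then have c: "c > 0" using assms(2) by simp
  have t: "Re (mtrace (complex_of_real c \<cdot>\<^sub>m \<sigma>)) = c * Re (mtrace \<sigma>)"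
    by (simp add: mtrace_smult[OF assms(1)])
  have "complex_of_real (1 / (c * p)) \<cdot>\<^sub>m (complex_of_real c \<cdot>\<^sub>m \<sigma>) = complex_of_real (1 / p) \<cdot>\<^sub>m \<sigma>" for p
    unfolding smult_smult of_real_mult[symmetric] using c by simp
  then show ?thesis unfolding hext_def Let_def t using c by (simp add: zero_less_mult_iff)
qed

text \<open>For traces p and q this is convexity with weights p / (p + q) and q / (p + q) at the
  normalised matrices, multiplied by p + q. If one trace vanishes, then so does the matrix, and
  equality holds.\<close>

lemma hext_add_le:
  assumes cv: "convex_measure n f" and d: "length d = n"
    and A: "psd (prod_list d) A" and B: "psd (prod_list d) B"
  shows "hext f d (A + B) \<le> hext f d A + hext f d B"
proof -
  let ?N = "prod_list d" and ?p = "Re (mtrace A)" and ?q = "Re (mtrace B)"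
  note cA = psd_carrier[OF A] and cB = psd_carrier[OF B]
  consider "?p = 0" | "?q = 0" | "?p > 0" "?q > 0"
    using mtrace_psd(1)[OF A] mtrace_psd(1)[OF B] by linarith
  then show ?thesis
  proof cases
    case 1
    then have "A = 0\<^sub>m ?N ?N" by (rule psd_trace_zero[OF A])
    then show ?thesis using cB by simp
  next
    case 2
    then have "B = 0\<^sub>m ?N ?N" by (rule psd_trace_zero[OF B])
    then show ?thesis using cA by simp
  next
    case 3
    define w where "w = (\<lambda>i::nat. if i = 0 then ?p / (?p + ?q) else ?q / (?p + ?q))"
    define s where "s = (\<lambda>i::nat. if i = 0 then complex_of_real (1 / ?p) \<cdot>\<^sub>m A else complex_of_real (1 / ?q) \<cdot>\<^sub>m B)"
    have m: "msum ?N ?N {0,1} (\<lambda>i. complex_of_real (w i) \<cdot>\<^sub>m s i) = complex_of_real (1 / (?p + ?q)) \<cdot>\<^sub>m (A + B)"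
    proof (rule eq_matI)
      fix i j assume "i < dim_row (complex_of_real (1 / (?p + ?q)) \<cdot>\<^sub>m (A + B))" "j < dim_col (complex_of_real (1 / (?p + ?q)) \<cdot>\<^sub>m (A + B))"
      then have ij: "i < ?N" "j < ?N" using cA cB by auto
      show "msum ?N ?N {0,1} (\<lambda>i. complex_of_real (w i) \<cdot>\<^sub>m s i) $$ (i,j) = (complex_of_real (1 / (?p + ?q)) \<cdot>\<^sub>m (A + B)) $$ (i,j)"
        unfolding index_msum[OF ij] w_def s_def using ij cA cB 3 by (simp add: add_divide_distrib)
    qed (use cA cB in auto)
    have "f d (msum ?N ?N {0,1} (\<lambda>i. complex_of_real (w i) \<cdot>\<^sub>m s i)) \<le> (\<Sum>i\<in>{0,1::nat}. w i * f d (s i))"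
    proof (rule cv[unfolded convex_measure_def, rule_format])
      show "(\<Sum>i\<in>{0,1}. w i) = 1" using 3 by (simp add: w_def flip: add_divide_distrib)
    qed (use d 3 is_state_normalize[OF A] is_state_normalize[OF B] in \<open>auto simp: w_def s_def\<close>)
    then have "f d (complex_of_real (1 / (?p + ?q)) \<cdot>\<^sub>m (A + B)) \<le>
      (?p * f d (complex_of_real (1 / ?p) \<cdot>\<^sub>m A) + ?q * f d (complex_of_real (1 / ?q) \<cdot>\<^sub>m B)) / (?p + ?q)"
      unfolding m by (simp add: w_def s_def add_divide_distrib)
    then have "(?p + ?q) * f d (complex_of_real (1 / (?p + ?q)) \<cdot>\<^sub>m (A + B)) \<le>
      ?p * f d (complex_of_real (1 / ?p) \<cdot>\<^sub>m A) + ?q * f d (complex_of_real (1 / ?q) \<cdot>\<^sub>m B)"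
      using 3 by (simp add: pos_le_divide_eq mult.commute)
    then show ?thesis unfolding hext_def Let_def mtrace_add[OF cA cB] using 3 by simp
  qed
qed

lemma hext_msum_le:
  assumes "convex_measure n f" "length d = n" "finite I" "\<And>x. x \<in> I \<Longrightarrow> psd (prod_list d) (g x)"
  shows "hext f d (msum (prod_list d) (prod_list d) I g) \<le> (\<Sum>x\<in>I. hext f d (g x))"
  using assms(3,4)
proof (induction I rule: finite_induct)
  case (insert x I)
  have "hext f d (g x + msum (prod_list d) (prod_list d) I g) \<le> hext f d (g x) + hext f d (msum (prod_list d) (prod_list d) I g)"
    using insert by (intro hext_add_le[OF assms(1,2)] psd_msum) auto
  moreover have "msum (prod_list d) (prod_list d) (insert x I) g = g x + msum (prod_list d) (prod_list d) I g"
    using insert by (intro msum_insert psd_carrier) auto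
  ultimately show ?case using insert by fastforce
qed (simp add: msum_empty)

section \<open>Isometries and reflections of one party\<close>

lemma is_state_lconj:
  assumes "k < length d" "V \<in> carrier_mat e (d ! k)" "adj V * V = 1\<^sub>m (d ! k)" "is_state d \<rho>"
  shows "is_state (d[k := e]) (lconj d k V \<rho>)"
  unfolding is_state_def
  using lconj_psd[OF assms(1,2)] mtrace_lconj_isometry[OF assms(1,2)] assms(3,4) is_stateD by metis

text \<open>A zero dimension would give an empty matrix, whose trace is 0 and not 1. Positive
  dimensions guarantee the basis vectors with index 0 that serve as padding ancillas.\<close>

lemma is_state_pos:
  assumes "is_state d \<rho>" "k < length d"
  shows "0 < d ! k"
proof (rule ccontr)
  assume "\<not> 0 < d ! k"
  then have "0 \<in> set d" using assms(2) by (metis neq0_conv nth_mem)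
  then have "prod_list d = 0" by (simp add: prod_list_zero_iff)
  then have "mtrace \<rho> = 0" using is_stateD(3)[OF assms(1)] by (simp add: mtrace_def)
  then show False using is_stateD(2)[OF assms(1)] by simp
qed

lemma is_state_ketbra:
  assumes "v \<in> carrier_vec e" "conjugate v \<bullet> v = 1"
  shows "is_state [e] (ketbra v)"
proof -
  have "mtrace (ketbra v) = mtrace (adj (ket v) * ket v)"
    unfolding ketbra_eq by (rule mtrace_comm) (auto intro: ket_carrier adj_carrier assms)
  also have "\<dots> = 1" unfolding bra_ket[OF assms(1,1)] assms(2) by (simp add: mtrace_def)
  finally show ?thesis
    using psd_mult_adj[OF ket_carrier[OF assms(1)]] by (simp add: is_state_def ketbra_eq)
qed

lemma attach_isometry:
  assumes "v \<in> carrier_vec e" "conjugate v \<bullet> v = 1"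
  shows "adj (attach m v) * attach m v = 1\<^sub>m m"
  by (simp add: adj_attach_attach[OF assms(1,1)] assms(2) one_smult_mat)

lemma mult_isometry:
  assumes "A \<in> carrier_mat a b" "B \<in> carrier_mat b c" "adj A * A = 1\<^sub>m b" "adj B * B = 1\<^sub>m c"
  shows "adj (A * B) * (A * B) = 1\<^sub>m c"
proof -
  have "adj (A * B) * (A * B) = adj B * (adj A * A) * B"
    unfolding adj_mult[OF assms(1,2)]
    using assoc_mult_mat[OF adj_carrier[OF assms(2)] adj_carrier[OF assms(1)] mult_carrier_mat[OF assms(1,2)]]
      assoc_mult_mat[OF adj_carrier[OF assms(1)] assms(1,2)]
      assoc_mult_mat[OF adj_carrier[OF assms(2)] mult_carrier_mat[OF adj_carrier[OF assms(1)] assms(1)] assms(2)]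
    by simp
  then show ?thesis using assms(3,4) right_mult_one_mat[OF adj_carrier[OF assms(2)]] by simp
qed

lemma conjugate_unit_vec:
  assumes "i < e" "j < e"
  shows "conjugate (unit_vec e i) \<bullet> (unit_vec e j :: complex vec) = (if i = j then 1 else 0)"
  using assms by (simp add: scalar_prod_right_unit)

text \<open>The columns of Z are orthonormal up to the factor \<open>sqrt 2\<close>, so
  \<open>Z * adj Z\<close> is twice a projection P, and 1 - 2P is a Hermitian involution.\<close>

lemma unitary_householder:
  assumes Z: "Z \<in> carrier_mat N m" and ZZ: "adj Z * Z = 2 \<cdot>\<^sub>m 1\<^sub>m m"
  shows "unitary N (1\<^sub>m N - Z * adj Z)"
proof -
  let ?T = "Z * adj Z" and ?U = "1\<^sub>m N - Z * adj Z"
  note aZ = adj_carrier[OF Z]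
  have T: "?T \<in> carrier_mat N N" using Z aZ by (rule mult_carrier_mat)
  have U: "?U \<in> carrier_mat N N" using T by (rule minus_carrier_mat)
  have adjU: "adj ?U = ?U" unfolding adj_minus[OF one_carrier_mat T] adj_mult[OF Z aZ] by simp
  have "?T * ?T = Z * (adj Z * Z * adj Z)"
    unfolding assoc_mult_mat[OF Z aZ T] assoc_mult_mat[OF aZ Z aZ] ..
  also have "\<dots> = 2 \<cdot>\<^sub>m ?T" unfolding ZZ
    using mult_smult_assoc_mat[OF one_carrier_mat aZ, of 2] mult_smult_distrib[OF Z aZ, of 2] left_mult_one_mat[OF aZ] by simp
  finally have TT: "?T * ?T = 2 \<cdot>\<^sub>m ?T" .
  have "?U * ?U = 1\<^sub>m N * ?U - ?T * ?U" by (rule minus_mult_distrib_mat[OF one_carrier_mat T U])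
  also have "?T * ?U = ?T - 2 \<cdot>\<^sub>m ?T"
    unfolding mult_minus_distrib_mat[OF T one_carrier_mat T] TT right_mult_one_mat[OF T] ..
  also have "1\<^sub>m N * ?U - (?T - 2 \<cdot>\<^sub>m ?T) = 1\<^sub>m N"
    unfolding left_mult_one_mat[OF U] using T by (intro eq_matI) auto
  finally show ?thesis unfolding unitary_def adjU using U by simp
qed

text \<open>Reflect in the range of \<open>W - Y\<close>. Orthogonality of the ranges gives this
  difference the Gram matrix 2, as a reflection requires, and \<open>adj (W - Y) * W = 1\<close>, so
  W is sent to W - (W - Y).\<close>

lemma unitary_exchanging_isometries:
  assumes W: "W \<in> carrier_mat N m" and Y: "Y \<in> carrier_mat N m"
    and WW: "adj W * W = 1\<^sub>m m" and YY: "adj Y * Y = 1\<^sub>m m"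
    and WY: "adj W * Y = 0\<^sub>m m m"
  obtains U where "unitary N U" "U * W = Y"
proof -
  let ?Z = "W - Y"
  note aW = adj_carrier[OF W] and aY = adj_carrier[OF Y]
  have Z: "?Z \<in> carrier_mat N m" using Y by (rule minus_carrier_mat)
  have aZ: "adj ?Z = adj W - adj Y" by (rule adj_minus[OF W Y])
  have YW: "adj Y * W = 0\<^sub>m m m"
    using arg_cong[OF WY, of adj] unfolding adj_mult[OF aW Y] by simp (auto simp: adj_def)
  have ZW: "adj ?Z * W = 1\<^sub>m m"
    unfolding aZ minus_mult_distrib_mat[OF aW aY W] WW YW by (rule eq_matI) auto
  have ZY: "adj ?Z * Y = - 1\<^sub>m m"
    unfolding aZ minus_mult_distrib_mat[OF aW aY Y] YY WY by (rule eq_matI) auto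
  have ZZ: "adj ?Z * ?Z = 2 \<cdot>\<^sub>m 1\<^sub>m m"
    unfolding mult_minus_distrib_mat[OF adj_carrier[OF Z] W Y] ZW ZY by (rule eq_matI) auto
  let ?U = "1\<^sub>m N - ?Z * adj ?Z"
  have "?U * W = 1\<^sub>m N * W - ?Z * adj ?Z * W"
    by (rule minus_mult_distrib_mat[OF one_carrier_mat mult_carrier_mat[OF Z adj_carrier[OF Z]] W])
  also have "?Z * adj ?Z * W = ?Z"
    unfolding assoc_mult_mat[OF Z adj_carrier[OF Z] W] ZW by (rule right_mult_one_mat[OF Z])
  also have "1\<^sub>m N * W - ?Z = Y" using W Y by (intro eq_matI) auto
  finally show ?thesis using that unitary_householder[OF Z ZZ] by blast
qed

lemma invariant_lconj_unitary:
  assumes "local_unitary_invariant n f" "length d = n" "k < n" "is_state d \<rho>" "unitary (d ! k) U"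
  shows "f d (lconj d k U \<rho>) = f d \<rho>"
proof -
  have u: "unitary m (1\<^sub>m m)" for m by (simp add: unitary_def)
  show ?thesis unfolding lconj_def embed_def
    by (rule assms(1)[unfolded local_unitary_invariant_def, rule_format])
      (use assms u in \<open>auto simp: nth_list_update\<close>)
qed

lemma invariant_attach:
  assumes "local_ancilla_invariant n f" "length d = n" "k < n" "is_state d \<rho>"
    "v \<in> carrier_vec e" "conjugate v \<bullet> v = 1"
  shows "f (d[k := d ! k * e]) (lconj d k (attach (d ! k) v) \<rho>) = f d \<rho>"
proof -
  have "f (anc_dims d k e) (add_anc d k e \<rho> (ketbra v)) = f d \<rho>"
    by (rule assms(1)[unfolded local_ancilla_invariant_def, rule_format])
      (use assms is_state_ketbra in auto)
  then show ?thesis using assms add_anc_ketbra[of k d \<rho> v e] is_stateD(3)[OF assms(4)] by (simp add: anc_dims_def)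
qed

text \<open>Two ancillas are used on each side of an isometry: one equalises the dimensions, the
  other carries the flag.\<close>

lemma invariant_attach_twice:
  assumes anc: "local_ancilla_invariant n f" and d: "length d = n" "k < n" and s: "is_state d \<rho>"
    and v: "v \<in> carrier_vec e" "conjugate v \<bullet> v = 1" and w: "w \<in> carrier_vec e'" "conjugate w \<bullet> w = 1"
  shows "f (d[k := d ! k * e * e']) (lconj d k (attach (d ! k * e) w * attach (d ! k) v) \<rho>) = f d \<rho>"
proof -
  let ?d = "d[k := d ! k * e]"
  have s': "is_state ?d (lconj d k (attach (d ! k) v) \<rho>)"
    using d s v by (intro is_state_lconj attach_carrier attach_isometry) auto
  have "f (?d[k := ?d ! k * e']) (lconj ?d k (attach (?d ! k) w) (lconj d k (attach (d ! k) v) \<rho>)) = f ?d (lconj d k (attach (d ! k) v) \<rho>)"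
    by (rule invariant_attach[OF anc _ _ s' w]) (use d in auto)
  also have "\<dots> = f d \<rho>" by (rule invariant_attach[OF anc d s v])
  also have "lconj ?d k (attach (?d ! k) w) (lconj d k (attach (d ! k) v) \<rho>) = lconj d k (attach (d ! k * e) w * attach (d ! k) v) \<rho>"
    using d lconj_lconj[OF _ attach_carrier[OF v(1)] attach_carrier[OF w(1)] is_stateD(3)[OF s]] by simp
  finally show ?thesis using d by simp
qed

text \<open>Pad input and output of the isometry to a common dimension with orthogonal ancilla flags;
  the reflection exchanging the two ranges is then a local unitary.\<close>
lemma invariant_isometry:
  assumes un: "local_unitary_invariant n f" and anc: "local_ancilla_invariant n f"
    and d: "length d = n" "k < n" and s: "is_state d \<rho>"
    and V: "V \<in> carrier_mat M (d ! k)" "adj V * V = 1\<^sub>m (d ! k)"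
  shows "f (d[k := M]) (lconj d k V \<rho>) = f d \<rho>"
proof -
  define m where "m = d ! k"
  have k: "k < length d" using d by simp
  note r = is_stateD(3)[OF s]
  have m: "0 < m" using is_state_pos[OF s k] by (simp add: m_def)
  have s1: "is_state (d[k := M]) (lconj d k V \<rho>)" by (rule is_state_lconj[OF k V s])
  have M: "0 < M" using is_state_pos[OF s1, of k] k by simp
  \<comment> \<open>Both paddings end in dimension m * M: \<open>a\<close> extends the output space
    of V by an ancilla of dimension m, and \<open>b\<close> extends the input space by one of
    dimension M. \<open>F j\<close> adds a qubit in basis state j.\<close>
  define a where "a = attach M (unit_vec m 0)"
  define b where "b = attach m (unit_vec M 0)"
  define F where "F = (\<lambda>j. attach (m * M) (unit_vec 2 j))"
  have uv: "unit_vec l 0 \<in> carrier_vec l" "conjugate (unit_vec l 0) \<bullet> (unit_vec l 0 :: complex vec) = 1" if "0 < l" for l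
    using conjugate_unit_vec[of 0 l 0] that by auto
  have a: "a \<in> carrier_mat (m * M) M" "adj a * a = 1\<^sub>m M"
    using attach_carrier[OF uv(1)[OF m]] attach_isometry[OF uv[OF m]] by (auto simp: a_def mult.commute[of m])
  have b: "b \<in> carrier_mat (m * M) m" "adj b * b = 1\<^sub>m m"
    using attach_carrier[OF uv(1)[OF M]] attach_isometry[OF uv[OF M]] by (auto simp: b_def)
  have F: "F j \<in> carrier_mat (m * M * 2) (m * M)" for j
    unfolding F_def by (rule attach_carrier) simp
  have FF: "adj (F i) * F j = (if i = j then 1 else 0) \<cdot>\<^sub>m 1\<^sub>m (m * M)" if "i < 2" "j < 2" for i j
    unfolding F_def using conjugate_unit_vec[of i 2 j] that by (subst adj_attach_attach[of _ 2]) auto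
  have FF1: "adj (F j) * F j = 1\<^sub>m (m * M)" if "j < 2" for j
    using FF[OF that that] by (simp add: one_smult_mat)
  have V': "V \<in> carrier_mat M m" using V by (simp add: m_def)
  have Fa: "F 1 * a \<in> carrier_mat (m * M * 2) M" using F a(1) by (rule mult_carrier_mat)
  have Fb: "F 0 * b \<in> carrier_mat (m * M * 2) m" using F b(1) by (rule mult_carrier_mat)
  \<comment> \<open>V followed by padding with flag 1. It will be compared with
    \<open>F 0 * b\<close>, padding with flag 0; the different flags make the two ranges orthogonal
    whatever V is.\<close>
  define Y where "Y = F 1 * a * V"
  have Y: "Y \<in> carrier_mat (m * M * 2) m" unfolding Y_def using Fa V' by (rule mult_carrier_mat)
  have YY: "adj Y * Y = 1\<^sub>m m" unfolding Y_def
    by (rule mult_isometry[OF Fa V' mult_isometry[OF F a(1) FF1 a(2)]]) (use V in \<open>auto simp: m_def\<close>)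
  have WW: "adj (F 0 * b) * (F 0 * b) = 1\<^sub>m m"
    by (rule mult_isometry[OF F b(1) FF1 b(2)]) simp
  have aV: "a * V \<in> carrier_mat (m * M) m" using a(1) V' by (rule mult_carrier_mat)
  have "adj (F 0 * b) * Y = adj b * (adj (F 0) * (F 1 * (a * V)))"
    unfolding Y_def assoc_mult_mat[OF F a(1) V'] adj_mult[OF F b(1)]
    by (rule assoc_mult_mat[OF adj_carrier[OF b(1)] adj_carrier[OF F] mult_carrier_mat[OF F aV]])
  also have "adj (F 0) * (F 1 * (a * V)) = adj (F 0) * F 1 * (a * V)"
    by (rule assoc_mult_mat[OF adj_carrier[OF F] F aV, symmetric])
  also have "adj (F 0) * F 1 = 0\<^sub>m (m * M) (m * M)" using FF[of 0 1] by (simp, intro eq_matI) auto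
  finally have WY: "adj (F 0 * b) * Y = 0\<^sub>m m m" using left_mult_zero_mat[OF aV] right_mult_zero_mat[OF adj_carrier[OF b(1)]] by simp
  obtain U where U: "unitary (m * M * 2) U" "U * (F 0 * b) = Y"
    using unitary_exchanging_isometries[OF Fb Y WW YY WY] .
  have cU: "U \<in> carrier_mat (m * M * 2) (m * M * 2)" using U(1) by (simp add: unitary_def)
  let ?D = "d[k := m * M * 2]"
  have Fb': "F 0 * b \<in> carrier_mat (m * M * 2) (d ! k)" using Fb by (simp add: m_def)
  have "f (d[k := d ! k * M * 2]) (lconj d k (attach (d ! k * M) (unit_vec 2 0) * attach (d ! k) (unit_vec M 0)) \<rho>) = f d \<rho>"
    by (rule invariant_attach_twice[OF anc d s uv[OF M] uv]) simp_all
  then have 1: "f d \<rho> = f ?D (lconj d k (F 0 * b) \<rho>)" by (simp add: F_def b_def m_def)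
  have sW: "is_state ?D (lconj d k (F 0 * b) \<rho>)"
    using is_state_lconj[OF k Fb' _ s] WW by (simp add: m_def)
  have "f ?D (lconj ?D k U (lconj d k (F 0 * b) \<rho>)) = f ?D (lconj d k (F 0 * b) \<rho>)"
    by (rule invariant_lconj_unitary[OF un _ _ sW]) (use d U in auto)
  also have "lconj ?D k U (lconj d k (F 0 * b) \<rho>) = lconj d k Y \<rho>"
    unfolding lconj_lconj[OF k Fb' cU r] U(2) ..
  \<comment> \<open>Seen from the output side, the rotated state is the image of \<rho> under V with
    two ancillas attached, so ancilla invariance applies a second time.\<close>
  also have "\<dots> = lconj (d[k := M]) k (F 1 * a) (lconj d k V \<rho>)"
    unfolding Y_def by (rule lconj_lconj[OF k V(1) Fa r, symmetric])
  finally have 2: "f ?D (lconj d k (F 0 * b) \<rho>) = f ?D (lconj (d[k := M]) k (F 1 * a) (lconj d k V \<rho>))" by simp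
  let ?d = "d[k := M]"
  have "f (?d[k := ?d ! k * m * 2]) (lconj ?d k (attach (?d ! k * m) (unit_vec 2 1) * attach (?d ! k) (unit_vec m 0)) (lconj d k V \<rho>)) = f ?d (lconj d k V \<rho>)"
    by (rule invariant_attach_twice[OF anc _ _ s1 uv[OF m]]) (use d conjugate_unit_vec[of 1 2 1] in auto)
  then have 3: "f ?D (lconj (d[k := M]) k (F 1 * a) (lconj d k V \<rho>)) = f ?d (lconj d k V \<rho>)"
    using k by (simp add: F_def a_def mult.commute[of M m])
  show ?thesis using 1 2 3 by simp
qed

lemma hext_isometry:
  assumes un: "local_unitary_invariant n f" and anc: "local_ancilla_invariant n f"
    and d: "length d = n" "k < n" and s: "psd (prod_list d) \<rho>"
    and V: "V \<in> carrier_mat M (d ! k)" "adj V * V = 1\<^sub>m (d ! k)"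
  shows "hext f (d[k := M]) (lconj d k V \<rho>) = hext f d \<rho>"
proof -
  have k: "k < length d" using d by simp
  note r = psd_carrier[OF s]
  have t: "mtrace (lconj d k V \<rho>) = mtrace \<rho>" by (rule mtrace_lconj_isometry[OF k V(1) r V(2)])
  show ?thesis
  proof (cases "0 < Re (mtrace \<rho>)")
    case True
    show ?thesis unfolding hext_def Let_def t
      using True invariant_isometry[OF un anc d is_state_normalize[OF s True] V] lconj_smult[OF k V(1) r] by simp
  qed (simp add: hext_def t)
qed

section \<open>Monotonicity under local instruments\<close>

text \<open>Affinity splits the sum over orthonormal flags, and each flag can then be dropped
  because attaching it is a local isometry. The matrices are unnormalised, so the probabilities are
  their traces divided by the total trace.\<close>

lemma hext_flagged:
  fixes J :: nat
  assumes un: "local_unitary_invariant n f" and anc: "local_ancilla_invariant n f" and fl: "flagged_affine n f"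
    and d: "length d = n" "k < n" and s: "\<And>x. x < J \<Longrightarrow> psd (prod_list d) (\<sigma> x)"
    and v: "\<And>x. x < J \<Longrightarrow> v x \<in> carrier_vec e"
      "\<And>x y. x < J \<Longrightarrow> y < J \<Longrightarrow> conjugate (v x) \<bullet> v y = (if x = y then 1 else 0)"
  shows "hext f (d[k := d ! k * e]) (msum (prod_list (d[k := d ! k * e])) (prod_list (d[k := d ! k * e])) {..<J}
      (\<lambda>x. lconj d k (attach (d ! k) (v x)) (\<sigma> x))) = (\<Sum>x<J. hext f d (\<sigma> x))"
proof -
  let ?D = "d[k := d ! k * e]" and ?N = "prod_list d"
  let ?N' = "prod_list ?D"
  let ?V = "\<lambda>x. attach (d ! k) (v x)"
  let ?t = "\<lambda>x. Re (mtrace (\<sigma> x))"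
  have k: "k < length d" using d by simp
  have V: "?V x \<in> carrier_mat (d ! k * e) (d ! k)" "adj (?V x) * ?V x = 1\<^sub>m (d ! k)" if "x < J" for x
    using attach_carrier[OF v(1)[OF that]] attach_isometry[OF v(1)[OF that]] v(2)[OF that that] by auto
  note r = psd_carrier[OF s]
  have cL: "lconj d k (?V x) (\<sigma> x) \<in> carrier_mat ?N' ?N'" if "x < J" for x
    by (rule lconj_carrier[OF k V(1)[OF that] r[OF that]])
  have tL: "mtrace (lconj d k (?V x) (\<sigma> x)) = mtrace (\<sigma> x)" if "x < J" for x
    by (rule mtrace_lconj_isometry[OF k V(1)[OF that] r[OF that] V(2)[OF that]])
  let ?S = "msum ?N' ?N' {..<J} (\<lambda>x. lconj d k (?V x) (\<sigma> x))"
  define P where "P = (\<Sum>x<J. ?t x)"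
  have tS: "Re (mtrace ?S) = P"
    using mtrace_msum[of "{..<J}" "\<lambda>x. lconj d k (?V x) (\<sigma> x)" ?N'] cL tL by (simp add: P_def)
  have t0: "0 \<le> ?t x" if "x < J" for x by (rule mtrace_psd(1)[OF s[OF that]])
  \<comment> \<open>Only terms of positive trace can be normalised to states; the others are zero
    matrices and are put back at the end.\<close>
  define I where "I = {x. x < J \<and> 0 < ?t x}"
  have I: "finite I" "I \<subseteq> {..<J}" by (auto simp: I_def)
  have IJ: "x < J" if "x \<in> I" for x using that by (simp add: I_def)
  have z: "?t x = 0" if "x \<in> {..<J} - I" for x using that t0[of x] by (auto simp: I_def)
  have PI: "P = (\<Sum>x\<in>I. ?t x)" unfolding P_def using I z by (intro sum.mono_neutral_right) auto
  have RI: "(\<Sum>x<J. hext f d (\<sigma> x)) = (\<Sum>x\<in>I. hext f d (\<sigma> x))"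
    using I z by (intro sum.mono_neutral_right) (auto intro: hext_trace_zero)
  show ?thesis
  proof (cases "I = {}")
    case True
    then show ?thesis unfolding RI using tS PI by (simp add: hext_trace_zero)
  next
    case False
    then have P: "0 < P" unfolding PI using I(1) by (intro sum_pos) (auto simp: I_def)
    let ?\<rho> = "\<lambda>x. complex_of_real (1 / ?t x) \<cdot>\<^sub>m \<sigma> x"
    have st: "is_state d (?\<rho> x)" if "x \<in> I" for x
      using that is_state_normalize[OF s] by (auto simp: I_def)
    have aL: "add_anc d k e (?\<rho> x) (ketbra (v x)) = complex_of_real (1 / ?t x) \<cdot>\<^sub>m lconj d k (?V x) (\<sigma> x)" if "x \<in> I" for x
    proof -
      have x: "x < J" using that by (simp add: I_def)
      show ?thesis
        unfolding add_anc_ketbra[OF k is_stateD(3)[OF st[OF that]] v(1)[OF x]] lconj_smult[OF k V(1)[OF x] r[OF x]] ..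
    qed
    have "f ?D (msum ?N' ?N' I (\<lambda>x. complex_of_real (?t x / P) \<cdot>\<^sub>m add_anc d k e (?\<rho> x) (ketbra (v x))))
       = (\<Sum>x\<in>I. ?t x / P * f ?D (add_anc d k e (?\<rho> x) (ketbra (v x))))"
    proof (rule fl[unfolded flagged_affine_def Let_def anc_dims_def, THEN spec, THEN spec, THEN spec, THEN spec, THEN spec, THEN spec, THEN spec, THEN mp, THEN mp, THEN mp, THEN mp, THEN mp, THEN mp, THEN mp, THEN mp])
      show "(\<Sum>x\<in>I. ?t x / P) = 1" unfolding sum_divide_distrib[symmetric] using P PI by simp
      show "\<forall>i\<in>I. \<forall>j\<in>I. conjugate (v i) \<bullet> v j = (if i = j then 1 else 0)"
        using IJ v(2) by blast
    qed (use d I P st v(1) t0 IJ in auto)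
    also have "msum ?N' ?N' I (\<lambda>x. complex_of_real (?t x / P) \<cdot>\<^sub>m add_anc d k e (?\<rho> x) (ketbra (v x)))
       = msum ?N' ?N' I (\<lambda>x. complex_of_real (1 / P) \<cdot>\<^sub>m lconj d k (?V x) (\<sigma> x))"
    proof (intro msum_cong refl)
      fix x assume x: "x \<in> I"
      then have "?t x \<noteq> 0" by (simp add: I_def)
      then show "complex_of_real (?t x / P) \<cdot>\<^sub>m add_anc d k e (?\<rho> x) (ketbra (v x)) = complex_of_real (1 / P) \<cdot>\<^sub>m lconj d k (?V x) (\<sigma> x)"
        unfolding aL[OF x] smult_smult of_real_mult[symmetric] by simp
    qed
    also have "\<dots> = complex_of_real (1 / P) \<cdot>\<^sub>m msum ?N' ?N' I (\<lambda>x. lconj d k (?V x) (\<sigma> x))"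
      by (rule smult_msum[symmetric]) (use cL I in auto)
    also have "msum ?N' ?N' I (\<lambda>x. lconj d k (?V x) (\<sigma> x)) = ?S"
    proof (rule msum_mono_neutral[OF _ I(2), symmetric])
      fix x assume x: "x \<in> {..<J} - I"
      then have "psd ?N' (lconj d k (?V x) (\<sigma> x))" "Re (mtrace (lconj d k (?V x) (\<sigma> x))) = 0"
        using lconj_psd[OF k V(1) s] tL z[OF x] by auto
      then show "lconj d k (?V x) (\<sigma> x) = 0\<^sub>m ?N' ?N'" by (rule psd_trace_zero)
    qed simp
    finally have "P * f ?D (complex_of_real (1 / P) \<cdot>\<^sub>m ?S) = P * (\<Sum>x\<in>I. ?t x / P * f ?D (add_anc d k e (?\<rho> x) (ketbra (v x))))"
      by simp
    also have "\<dots> = (\<Sum>x\<in>I. ?t x * f ?D (add_anc d k e (?\<rho> x) (ketbra (v x))))"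
      unfolding sum_distrib_left using P by (intro sum.cong refl) simp
    also have "\<dots> = (\<Sum>x\<in>I. hext f ?D (lconj d k (?V x) (\<sigma> x)))"
    proof (intro sum.cong refl)
      fix x assume x: "x \<in> I"
      then have "x < J" "0 < ?t x" by (auto simp: I_def)
      then show "?t x * f ?D (add_anc d k e (?\<rho> x) (ketbra (v x))) = hext f ?D (lconj d k (?V x) (\<sigma> x))"
        unfolding hext_def Let_def aL[OF x] using tL by simp
    qed
    also have "\<dots> = (\<Sum>x\<in>I. hext f d (\<sigma> x))"
      using I by (intro sum.cong refl hext_isometry[OF un anc d s V]) auto
    finally have 1: "P * f ?D (complex_of_real (1 / P) \<cdot>\<^sub>m ?S) = (\<Sum>x\<in>I. hext f d (\<sigma> x))" .
    have "hext f ?D ?S = P * f ?D (complex_of_real (1 / P) \<cdot>\<^sub>m ?S)"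
      unfolding hext_def Let_def tS using P by simp
    then show ?thesis unfolding RI 1 .
  qed
qed

text \<open>These are the orthogonality relations of the characters of a cyclic group: for x
  \<noteq> y the quotient of the phases is a J-th root of unity other than 1, so the geometric sum
  vanishes.\<close>

lemma sum_roots_of_unity_cross:
  fixes J :: nat
  assumes "x < J" "y < J"
  defines "z \<equiv> \<lambda>l. cis (2 * pi * real l / real J)"
  shows "(\<Sum>s<J. z x ^ s * cnj (z y ^ s)) = (if x = y then of_nat J else 0)"
proof -
  have J: "0 < J" using assms by simp
  have zz: "z l * cnj (z l) = 1" for l by (simp add: z_def cis_cnj cis_mult)
  have zJ: "z l ^ J = 1" for l using J by (simp add: z_def DeMoivre)
  let ?w = "z x * cnj (z y)"
  have eq: "(\<Sum>s<J. z x ^ s * cnj (z y ^ s)) = (\<Sum>s<J. ?w ^ s)"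
    by (simp add: power_mult_distrib)
  show ?thesis
  proof (cases "x = y")
    case True
    then show ?thesis unfolding eq by (simp add: zz)
  next
    case False
    have "z x \<noteq> z y"
      using bij_betw_roots_unity[OF J] assms(1,2) False unfolding bij_betw_def inj_on_def z_def by auto
    then have w: "?w \<noteq> 1"
      using zz[of y] by (metis mult.assoc mult.commute mult.right_neutral)
    have "?w ^ J = 1" unfolding power_mult_distrib complex_cnj_power[symmetric] zJ by simp
    then show ?thesis unfolding eq using geometric_sum[OF w, of J] False by simp
  qed
qed

text \<open>Averaging over the phases \<^term>\<open>z x ^ s\<close> dephases the flag register
  of the Stinespring dilation of the instrument.\<close>
lemma instrument_monotone:
  fixes J :: nat
  assumes cv: "convex_measure n f"
    and un: "local_unitary_invariant n f" and anc: "local_ancilla_invariant n f" and fl: "flagged_affine n f"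
    and d: "length d = n" "k < n" and s: "psd (prod_list d) \<rho>"
    and K: "\<And>x. x < J \<Longrightarrow> K x \<in> carrier_mat (e x) (d ! k)"
    and one: "msum (d ! k) (d ! k) {..<J} (\<lambda>x. adj (K x) * K x) = 1\<^sub>m (d ! k)"
  shows "(\<Sum>x<J. hext f (d[k := e x]) (lconj d k (K x) \<rho>)) \<le> hext f d \<rho>"
proof -
  have k: "k < length d" using d by simp
  define m where "m = d ! k"
  \<comment> \<open>A common upper bound for the output dimensions; the maps
    \<open>\<iota> x\<close> below include each output space into dimension M as its first
    coordinates.\<close>
  define M where "M = (\<Sum>x<J. e x)"
  define E where "E = d[k := M]"
  have E: "length E = n" "E ! k = M" "E[k := a] = d[k := a]" "k < length E" for a using d by (auto simp: E_def)
  define \<iota> where "\<iota> = (\<lambda>x. mat M (e x) (\<lambda>(i,j). if i = j then 1 else 0 :: complex))"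
  have eM: "e x \<le> M" if "x < J" for x
    unfolding M_def using that by (intro member_le_sum) auto
  have \<iota>c: "\<iota> x \<in> carrier_mat M (e x)" for x by (simp add: \<iota>_def)
  have \<iota>\<iota>: "adj (\<iota> x) * \<iota> x = 1\<^sub>m (e x)" if x: "x < J" for x
  proof (rule eq_matI)
    fix i j assume "i < dim_row (1\<^sub>m (e x) :: complex mat)" "j < dim_col (1\<^sub>m (e x) :: complex mat)"
    then have ij: "i < e x" "j < e x" by auto
    have "(adj (\<iota> x) * \<iota> x) $$ (i,j) = (\<Sum>l<M. if l = i then (if i = j then 1 else 0) else 0)"
      unfolding index_mult_sum[OF adj_carrier[OF \<iota>c] \<iota>c ij] using ij by (intro sum.cong refl) (auto simp: \<iota>_def)
    also have "\<dots> = 1\<^sub>m (e x) $$ (i,j)" using ij eM[OF x] by simp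
    finally show "(adj (\<iota> x) * \<iota> x) $$ (i,j) = 1\<^sub>m (e x) $$ (i,j)" .
  qed (use \<iota>c[of x] in auto)
  have Kc: "K x \<in> carrier_mat (e x) m" if "x < J" for x using K[OF that] by (simp add: m_def)
  define L where "L = (\<lambda>x. \<iota> x * K x)"
  have Lc: "L x \<in> carrier_mat M m" if "x < J" for x unfolding L_def using \<iota>c Kc[OF that] by (rule mult_carrier_mat)
  have LL: "adj (L x) * L x = adj (K x) * K x" if x: "x < J" for x
  proof -
    have "adj (L x) * L x = adj (K x) * (adj (\<iota> x) * (\<iota> x * K x))"
      unfolding L_def adj_mult[OF \<iota>c Kc[OF x]]
      by (rule assoc_mult_mat[OF adj_carrier[OF Kc[OF x]] adj_carrier[OF \<iota>c] mult_carrier_mat[OF \<iota>c Kc[OF x]]])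
    also have "adj (\<iota> x) * (\<iota> x * K x) = adj (\<iota> x) * \<iota> x * K x"
      by (rule assoc_mult_mat[OF adj_carrier[OF \<iota>c] \<iota>c Kc[OF x], symmetric])
    finally show ?thesis unfolding \<iota>\<iota>[OF x] left_mult_one_mat[OF Kc[OF x]] .
  qed
  define u where "u = (\<lambda>x. unit_vec J x :: complex vec)"
  have u: "u x \<in> carrier_vec J" for x by (simp add: u_def)
  have uu: "conjugate (u x) \<bullet> u y = (if x = y then 1 else 0)" if "x < J" "y < J" for x y
    unfolding u_def by (rule conjugate_unit_vec[OF that])
  define A where "A = (\<lambda>x. attach M (u x))"
  have Ac: "A x \<in> carrier_mat (M * J) M" for x unfolding A_def by (rule attach_carrier[OF u])
  have AA: "adj (A x) * A y = (if x = y then 1 else 0) \<cdot>\<^sub>m 1\<^sub>m M" if "x < J" "y < J" for x y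
    unfolding A_def adj_attach_attach[OF u u] uu[OF that] ..
  define G where "G = (\<lambda>x. A x * L x)"
  have Gc: "G x \<in> carrier_mat (M * J) m" if "x < J" for x
    unfolding G_def using Ac Lc[OF that] by (rule mult_carrier_mat)
  have GG: "adj (G x) * G y = (if x = y then adj (K x) * K x else 0\<^sub>m m m)" if xy: "x < J" "y < J" for x y
  proof -
    note lx = Lc[OF xy(1)] and ly = Lc[OF xy(2)]
    have "adj (G x) * G y = adj (L x) * (adj (A x) * (A y * L y))"
      unfolding G_def adj_mult[OF Ac lx]
      by (rule assoc_mult_mat[OF adj_carrier[OF lx] adj_carrier[OF Ac] mult_carrier_mat[OF Ac ly]])
    also have "adj (A x) * (A y * L y) = adj (A x) * A y * L y"
      by (rule assoc_mult_mat[OF adj_carrier[OF Ac] Ac ly, symmetric])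
    also have "\<dots> = (if x = y then 1 else 0) \<cdot>\<^sub>m L y"
      unfolding AA[OF xy] mult_smult_assoc_mat[OF one_carrier_mat ly] left_mult_one_mat[OF ly] ..
    also have "adj (L x) * \<dots> = (if x = y then 1 else 0) \<cdot>\<^sub>m (adj (L x) * L y)"
      by (rule mult_smult_distrib[OF adj_carrier[OF lx] ly])
    also have "\<dots> = (if x = y then adj (K x) * K x else 0\<^sub>m m m)"
      using lx ly LL[OF xy(1)] by (auto simp: one_smult_mat intro!: eq_matI)
    finally show ?thesis .
  qed
  define z where "z = (\<lambda>l. cis (2 * pi * real l / real J))"
  have zn: "cnj (z l ^ s) * z l ^ s = 1" for l s
    by (simp add: z_def cis_cnj cis_mult flip: power_mult_distrib)
  define V where "V = (\<lambda>s. msum (M * J) m {..<J} (\<lambda>x. z x ^ s \<cdot>\<^sub>m G x))"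
  have Vc: "V s \<in> carrier_mat (M * J) m" for s by (simp add: V_def)
  \<comment> \<open>Distinct flags remove the terms with x \<noteq> y and the phases have modulus
    one, so completeness of the Kraus operators is all that remains.\<close>
  have VV: "adj (V s) * V s = 1\<^sub>m m" for s
  proof -
    have c1: "z x ^ s \<cdot>\<^sub>m G x \<in> carrier_mat (M * J) m" if "x \<in> {..<J}" for x using Gc that by auto
    have "adj (V s) * V s = msum m (M * J) {..<J} (\<lambda>x. adj (z x ^ s \<cdot>\<^sub>m G x)) * V s"
      unfolding V_def using adj_msum[of "{..<J}" "\<lambda>x. z x ^ s \<cdot>\<^sub>m G x"] c1 by simp
    also have "\<dots> = msum m m {..<J} (\<lambda>x. adj (z x ^ s \<cdot>\<^sub>m G x) * V s)"
      by (rule msum_mult[OF Vc]) (rule adj_carrier[OF c1])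
    also have "\<dots> = msum m m {..<J} (\<lambda>x. adj (K x) * K x)"
    proof (rule msum_cong[OF refl])
      fix x assume x: "x \<in> {..<J}"
      then have xJ: "x < J" by simp
      have "adj (z x ^ s \<cdot>\<^sub>m G x) * V s = msum m m {..<J} (\<lambda>y. adj (z x ^ s \<cdot>\<^sub>m G x) * (z y ^ s \<cdot>\<^sub>m G y))"
        unfolding V_def by (rule mult_msum[OF adj_carrier[OF c1[OF x]]]) (rule c1)
      also have "\<dots> = msum m m {..<J} (\<lambda>y. if y = x then adj (K x) * K x else 0\<^sub>m m m)"
      proof (rule msum_cong[OF refl])
        fix y assume "y \<in> {..<J}"
        then have y: "y < J" by simp
        have "adj (z x ^ s \<cdot>\<^sub>m G x) * (z y ^ s \<cdot>\<^sub>m G y) = (cnj (z x ^ s) * z y ^ s) \<cdot>\<^sub>m (adj (G x) * G y)"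
          unfolding adj_smult mult_smult_assoc_mat[OF adj_carrier[OF Gc[OF xJ]] smult_carrier_mat[OF Gc[OF y]]]
            mult_smult_distrib[OF adj_carrier[OF Gc[OF xJ]] Gc[OF y]] smult_smult ..
        also have "\<dots> = (if y = x then adj (K x) * K x else 0\<^sub>m m m)"
          unfolding GG[OF xJ y] using zn[of x s] by (simp add: one_smult_mat)
        finally show "adj (z x ^ s \<cdot>\<^sub>m G x) * (z y ^ s \<cdot>\<^sub>m G y) = (if y = x then adj (K x) * K x else 0\<^sub>m m m)" .
      qed
      also have "\<dots> = msum m m {x} (\<lambda>y. if y = x then adj (K x) * K x else 0\<^sub>m m m)"
        by (rule msum_mono_neutral) (use x in auto)
      also have "\<dots> = adj (K x) * K x"
        using msum_singleton[of "\<lambda>y. if y = x then adj (K x) * K x else 0\<^sub>m m m" x m m]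
          mult_carrier_mat[OF adj_carrier[OF Kc[OF xJ]] Kc[OF xJ]] by simp
      finally show "adj (z x ^ s \<cdot>\<^sub>m G x) * V s = adj (K x) * K x" .
    qed
    finally show ?thesis using one by (simp add: m_def)
  qed
  let ?D = "d[k := M * J]"
  let ?N = "prod_list ?D"
  note r = psd_carrier[OF s]
  show ?thesis
  proof (cases "J = 0")
    case True
    \<comment> \<open>With no Kraus operators at all, completeness forces the trace to be zero, and
      both sides are 0.\<close>
    have "mtrace \<rho> = 0"
      using mtrace_lconj_complete[OF k _ r one] K True by auto
    then show ?thesis using True by (simp add: hext_trace_zero)
  next
    case False
    then have J: "0 < J" by simp
    have Vc': "V s \<in> carrier_mat (M * J) (d ! k)" for s using Vc by (simp add: m_def)
    have Gc': "G x \<in> carrier_mat (M * J) (d ! k)" if "x < J" for x using Gc[OF that] by (simp add: m_def)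
    let ?E = "\<lambda>x. embed d k (G x)"
    have Ec: "?E x \<in> carrier_mat ?N (prod_list d)" if "x < J" for x
      by (rule embed_carrier'[OF k Gc'[OF that]])
    let ?X = "\<lambda>x y. ?E x * \<rho> * adj (?E y)"
    have Xc: "?X x y \<in> carrier_mat ?N ?N" if "x < J" "y < J" for x y
      by (rule mult_carrier_mat[OF mult_carrier_mat[OF Ec[OF that(1)] r] adj_carrier[OF Ec[OF that(2)]]])
    have lV: "lconj d k (V s) \<rho> = msum ?N ?N {..<J} (\<lambda>x. msum ?N ?N {..<J} (\<lambda>y. (z x ^ s * cnj (z y ^ s)) \<cdot>\<^sub>m ?X x y))" for s
    proof -
      have "lconj d k (V s) \<rho> = msum ?N ?N {..<J} (\<lambda>x. msum ?N ?N {..<J} (\<lambda>y. embed d k (z x ^ s \<cdot>\<^sub>m G x) * \<rho> * adj (embed d k (z y ^ s \<cdot>\<^sub>m G y))))"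
        unfolding V_def m_def by (rule lconj_msum_op[OF k _ r]) (use Gc' in auto)
      also have "\<dots> = msum ?N ?N {..<J} (\<lambda>x. msum ?N ?N {..<J} (\<lambda>y. (z x ^ s * cnj (z y ^ s)) \<cdot>\<^sub>m ?X x y))"
      proof (intro msum_cong refl)
        fix x y assume "x \<in> {..<J}" "y \<in> {..<J}"
        then have x: "x < J" and y: "y < J" by auto
        note XE = mult_carrier_mat[OF Ec[OF x] r] and aE = adj_carrier[OF Ec[OF y]]
        show "embed d k (z x ^ s \<cdot>\<^sub>m G x) * \<rho> * adj (embed d k (z y ^ s \<cdot>\<^sub>m G y)) = (z x ^ s * cnj (z y ^ s)) \<cdot>\<^sub>m ?X x y"
          unfolding embed_smult[OF k] adj_smult mult_smult_assoc_mat[OF Ec[OF x] r]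
            mult_smult_distrib[OF smult_carrier_mat[OF XE] aE] mult_smult_assoc_mat[OF XE aE] smult_smult
          by (simp add: mult.commute)
      qed
      finally show ?thesis .
    qed
    \<comment> \<open>In the sum over s the term for the pair x, y acquires the factor
      \<open>\<Sum>s<J. z x ^ s * cnj (z y ^ s)\<close>, so only x = y survives: the average is the
      dephased, flagged matrix.\<close>
    have avg: "msum ?N ?N {..<J} (\<lambda>s. complex_of_real (1 / real J) \<cdot>\<^sub>m lconj d k (V s) \<rho>) = msum ?N ?N {..<J} (\<lambda>x. lconj d k (G x) \<rho>)"
    proof (rule eq_matI)
      fix i j assume "i < dim_row (msum ?N ?N {..<J} (\<lambda>x. lconj d k (G x) \<rho>))" "j < dim_col (msum ?N ?N {..<J} (\<lambda>x. lconj d k (G x) \<rho>))"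
      then have ij: "i < ?N" "j < ?N" by auto
      have Xd: "dim_row (?X x y) = ?N" "dim_col (?X x y) = ?N" if "x < J" "y < J" for x y
        using Xc[OF that] by auto
      have "msum ?N ?N {..<J} (\<lambda>s. complex_of_real (1 / real J) \<cdot>\<^sub>m lconj d k (V s) \<rho>) $$ (i,j)
          = (\<Sum>s<J. complex_of_real (1 / real J) * (\<Sum>x<J. \<Sum>y<J. (z x ^ s * cnj (z y ^ s)) * ?X x y $$ (i,j)))"
        unfolding index_msum[OF ij] lV using ij Xd by (intro sum.cong refl) simp
      also have "\<dots> = complex_of_real (1 / real J) * (\<Sum>s<J. \<Sum>x<J. \<Sum>y<J. (z x ^ s * cnj (z y ^ s)) * ?X x y $$ (i,j))"
        by (simp only: sum_distrib_left)
      also have "(\<Sum>s<J. \<Sum>x<J. \<Sum>y<J. (z x ^ s * cnj (z y ^ s)) * ?X x y $$ (i,j))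
          = (\<Sum>x<J. \<Sum>s<J. \<Sum>y<J. (z x ^ s * cnj (z y ^ s)) * ?X x y $$ (i,j))"
        by (rule sum.swap)
      also have "\<dots> = (\<Sum>x<J. \<Sum>y<J. \<Sum>s<J. (z x ^ s * cnj (z y ^ s)) * ?X x y $$ (i,j))"
        by (intro sum.cong refl sum.swap)
      also have "\<dots> = (\<Sum>x<J. \<Sum>y<J. (if y = x then of_nat J * ?X x x $$ (i,j) else 0))"
      proof (intro sum.cong refl)
        fix x y assume "x \<in> {..<J}" "y \<in> {..<J}"
        then have "(\<Sum>s<J. z x ^ s * cnj (z y ^ s)) = (if x = y then of_nat J else 0)"
          unfolding z_def by (intro sum_roots_of_unity_cross) auto
        then show "(\<Sum>s<J. (z x ^ s * cnj (z y ^ s)) * ?X x y $$ (i,j)) = (if y = x then of_nat J * ?X x x $$ (i,j) else 0)"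
          unfolding sum_distrib_right[symmetric] by simp
      qed
      also have "\<dots> = of_nat J * (\<Sum>x<J. ?X x x $$ (i,j))"
        by (simp add: sum_distrib_left)
      finally show "msum ?N ?N {..<J} (\<lambda>s. complex_of_real (1 / real J) \<cdot>\<^sub>m lconj d k (V s) \<rho>) $$ (i,j) = msum ?N ?N {..<J} (\<lambda>x. lconj d k (G x) \<rho>) $$ (i,j)"
        unfolding index_msum[OF ij] lconj_def using J by simp
    qed auto
    have lp: "psd ?N (lconj d k (V s) \<rho>)" for s by (rule lconj_psd[OF k Vc' s])
    have Lc': "L x \<in> carrier_mat M (d ! k)" if "x < J" for x using Lc[OF that] by (simp add: m_def)
    \<comment> \<open>Including each output into the common space is a local isometry, so no value
      changes.\<close>
    have "(\<Sum>x<J. hext f (d[k := e x]) (lconj d k (K x) \<rho>)) = (\<Sum>x<J. hext f E (lconj d k (L x) \<rho>))"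
    proof (intro sum.cong refl)
      fix x assume "x \<in> {..<J}"
      then have x: "x < J" by simp
      have "hext f (d[k := e x, k := M]) (lconj (d[k := e x]) k (\<iota> x) (lconj d k (K x) \<rho>)) = hext f (d[k := e x]) (lconj d k (K x) \<rho>)"
        by (rule hext_isometry[OF un anc _ d(2) lconj_psd[OF k K[OF x] s]]) (use d \<iota>c \<iota>\<iota>[OF x] in auto)
      then show "hext f (d[k := e x]) (lconj d k (K x) \<rho>) = hext f E (lconj d k (L x) \<rho>)"
        unfolding lconj_lconj[OF k K[OF x] \<iota>c r] L_def by (simp add: E_def)
    qed
    also have "\<dots> = hext f (E[k := E ! k * J]) (msum (prod_list (E[k := E ! k * J])) (prod_list (E[k := E ! k * J])) {..<J}
        (\<lambda>x. lconj E k (attach (E ! k) (u x)) (lconj d k (L x) \<rho>)))"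
      by (rule hext_flagged[OF un anc fl E(1) d(2) _ u uu, symmetric])
        (use lconj_psd[OF k Lc' s] in \<open>auto simp: E_def\<close>)
    also have "\<dots> = hext f ?D (msum ?N ?N {..<J} (\<lambda>x. lconj d k (G x) \<rho>))"
    proof -
      have "lconj E k (attach M (u x)) (lconj d k (L x) \<rho>) = lconj d k (G x) \<rho>" if "x < J" for x
        using lconj_lconj[OF k Lc'[OF that] Ac r, of x] by (simp add: E_def G_def A_def)
      then have "msum ?N ?N {..<J} (\<lambda>x. lconj E k (attach M (u x)) (lconj d k (L x) \<rho>)) = msum ?N ?N {..<J} (\<lambda>x. lconj d k (G x) \<rho>)"
        by (intro msum_cong refl) auto
      then show ?thesis by (simp add: E)
    qed
    \<comment> \<open>The only inequality in the chain: convexity, applied to the average over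
      s.\<close>
    also have "\<dots> \<le> (\<Sum>s<J. hext f ?D (complex_of_real (1 / real J) \<cdot>\<^sub>m lconj d k (V s) \<rho>))"
      unfolding avg[symmetric] by (rule hext_msum_le[OF cv]) (use d lp psd_smult[of ?N _ "1 / real J"] in auto)
    also have "\<dots> = (\<Sum>s<J. 1 / real J * hext f d \<rho>)"
    proof (intro sum.cong refl)
      fix s'
      have "hext f ?D (complex_of_real (1 / real J) \<cdot>\<^sub>m lconj d k (V s') \<rho>) = 1 / real J * hext f ?D (lconj d k (V s') \<rho>)"
        by (rule hext_smult[OF psd_carrier[OF lp]]) simp
      also have "hext f ?D (lconj d k (V s') \<rho>) = hext f d \<rho>"
        by (rule hext_isometry[OF un anc d s Vc']) (use VV in \<open>simp add: m_def\<close>)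
      finally show "hext f ?D (complex_of_real (1 / real J) \<cdot>\<^sub>m lconj d k (V s') \<rho>) = 1 / real J * hext f d \<rho>" .
    qed
    also have "\<dots> = hext f d \<rho>" using J by simp
    finally show ?thesis .
  qed
qed

section \<open>LOCC instruments\<close>

lemma local_map_lconj:
  "local_map d k ex \<rho> = msum (prod_list (d[k := fst ex])) (prod_list (d[k := fst ex])) {..<length (snd ex)}
     (\<lambda>j. lconj d k (snd ex ! j) \<rho>)"
  by (simp add: local_map_def Let_def lconj_def)

lemma psd_local_map:
  assumes "k < length d" "\<And>K. K \<in> set (snd ex) \<Longrightarrow> K \<in> carrier_mat (fst ex) (d ! k)" "psd (prod_list d) \<rho>"
  shows "psd (prod_list (d[k := fst ex])) (local_map d k ex \<rho>)"
  unfolding local_map_lconj using assms by (intro psd_msum lconj_psd) auto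

lemma local_instrument_carrier:
  assumes "local_instrument m Ks" "x < length Ks" "j < length (snd (Ks ! x))"
  shows "snd (Ks ! x) ! j \<in> carrier_mat (fst (Ks ! x)) m"
proof -
  have "Ks ! x \<in> set Ks" "snd (Ks ! x) ! j \<in> set (snd (Ks ! x))" using assms by auto
  then show ?thesis using assms(1) unfolding local_instrument_def by (metis (no_types, lifting) case_prod_conv prod.collapse)
qed

text \<open>An outcome may comprise several Kraus operators. By subadditivity, revealing which of
  them occurred can only raise the average, so it suffices to bound the finest instrument, with one
  outcome per Kraus operator.\<close>

lemma local_instrument_monotone:
  assumes cv: "convex_measure n f"
    and un: "local_unitary_invariant n f" and anc: "local_ancilla_invariant n f" and fl: "flagged_affine n f"
    and d: "length d = n" "k < n" and s: "psd (prod_list d) \<rho>" and Ks: "local_instrument (d ! k) Ks"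
  shows "(\<Sum>x<length Ks. hext f (d[k := fst (Ks ! x)]) (local_map d k (Ks ! x) \<rho>)) \<le> hext f d \<rho>"
proof -
  have k: "k < length d" using d by simp
  let ?S = "{(x, j). x < length Ks \<and> j < length (snd (Ks ! x))}"
  let ?e = "\<lambda>p. fst (Ks ! fst p)" and ?K = "\<lambda>p. snd (Ks ! fst p) ! snd p"
  have S: "?S = Sigma {..<length Ks} (\<lambda>x. {..<length (snd (Ks ! x))})" by auto
  then have fin: "finite ?S" by simp
  \<comment> \<open>The phases require the Kraus operators to be numbered consecutively from 0, so
    the pairs are enumerated.\<close>
  obtain h where h: "bij_betw h {0..<card ?S} ?S" using ex_bij_betw_nat_finite[OF fin] by blast
  then have h: "bij_betw h {..<card ?S} ?S" by (simp add: atLeast0LessThan)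
  have Kc: "?K p \<in> carrier_mat (?e p) (d ! k)" if "p \<in> ?S" for p
    using local_instrument_carrier[OF Ks] that by auto
  have "(\<Sum>x<length Ks. hext f (d[k := fst (Ks ! x)]) (local_map d k (Ks ! x) \<rho>))
      \<le> (\<Sum>x<length Ks. \<Sum>j<length (snd (Ks ! x)). hext f (d[k := fst (Ks ! x)]) (lconj d k (snd (Ks ! x) ! j) \<rho>))"
    unfolding local_map_lconj
    by (intro sum_mono hext_msum_le[OF cv] lconj_psd[OF k _ s]) (use d local_instrument_carrier[OF Ks] in auto)
  also have "\<dots> = (\<Sum>p\<in>?S. hext f (d[k := ?e p]) (lconj d k (?K p) \<rho>))"
    unfolding S by (subst sum.Sigma) (auto simp: case_prod_unfold)
  also have "\<dots> = (\<Sum>i<card ?S. hext f (d[k := ?e (h i)]) (lconj d k (?K (h i)) \<rho>))"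
    by (rule sum.reindex_bij_betw[OF h, symmetric])
  also have "\<dots> \<le> hext f d \<rho>"
  proof (rule instrument_monotone[OF cv un anc fl d s])
    show "?K (h x) \<in> carrier_mat (?e (h x)) (d ! k)" if "x < card ?S" for x
      using Kc h that by (meson bij_betwE lessThan_iff)
    show "msum (d ! k) (d ! k) {..<card ?S} (\<lambda>x. adj (?K (h x)) * ?K (h x)) = 1\<^sub>m (d ! k)"
      using msum_reindex[OF h, of "d ! k" "d ! k" "\<lambda>p. adj (?K p) * ?K p"] Ks
      by (simp add: local_instrument_def case_prod_unfold)
  qed
  finally show ?thesis .
qed

text \<open>The number of parties and positivity are carried along so that the hypothesis for a
  later round applies to the outputs of an earlier one. Quantifying over all positive matrices lets
  these outputs stay unnormalised.\<close>

lemma LOCC_hext_monotone: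
  assumes cv: "convex_measure n f"
    and un: "local_unitary_invariant n f" and anc: "local_ancilla_invariant n f" and fl: "flagged_affine n f"
    and "LOCC d T" "length d = n"
  shows "(\<forall>t\<in>set T. length (fst t) = n \<and> (\<forall>\<rho>. psd (prod_list d) \<rho> \<longrightarrow> psd (prod_list (fst t)) (snd t \<rho>))) \<and>
    (\<forall>\<rho>. psd (prod_list d) \<rho> \<longrightarrow> (\<Sum>t\<leftarrow>T. hext f (fst t) (snd t \<rho>)) \<le> hext f d \<rho>)"
  using assms(5,6)
proof (induction rule: LOCC.induct)
  case (LOCC_id d)
  then show ?case by simp
next
  case (LOCC_local k d Ks)
  have c: "K \<in> carrier_mat (fst ex) (d ! k)" if "ex \<in> set Ks" "K \<in> set (snd ex)" for ex K
    using LOCC_local that unfolding local_instrument_def by fastforce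
  have "(\<Sum>ex\<leftarrow>Ks. hext f (d[k := fst ex]) (local_map d k ex \<rho>)) \<le> hext f d \<rho>" if "psd (prod_list d) \<rho>" for \<rho>
    using local_instrument_monotone[OF cv un anc fl _ _ that LOCC_local(2)] LOCC_local
    by (simp add: sum_list_sum_nth atLeast0LessThan)
  moreover have "psd (prod_list (d[k := fst ex])) (local_map d k ex \<rho>)" if "psd (prod_list d) \<rho>" "ex \<in> set Ks" for ex \<rho>
    by (rule psd_local_map[OF LOCC_local(1) c that(1)]) (use that in auto)
  ultimately show ?case using LOCC_local by (auto simp: o_def)
next
  case (LOCC_seq d T Ts)
  have T1: "length (fst (T ! i)) = n" "\<And>\<rho>. psd (prod_list d) \<rho> \<Longrightarrow> psd (prod_list (fst (T ! i))) (snd (T ! i) \<rho>)"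
    if "i < length T" for i
    using LOCC_seq.IH LOCC_seq.prems nth_mem[OF that] by auto
  have T2: "(\<Sum>i<length T. hext f (fst (T ! i)) (snd (T ! i) \<rho>)) \<le> hext f d \<rho>" if "psd (prod_list d) \<rho>" for \<rho>
    using LOCC_seq.IH LOCC_seq.prems that by (simp add: sum_list_sum_nth atLeast0LessThan)
  have Ts1: "length (fst t) = n" "\<And>\<rho>. psd (prod_list (fst (T ! i))) \<rho> \<Longrightarrow> psd (prod_list (fst t)) (snd t \<rho>)"
    if "i < length T" "t \<in> set (Ts ! i)" for i t
    using LOCC_seq that T1(1)[OF that(1)] by auto
  have Ts2: "(\<Sum>t\<leftarrow>Ts ! i. hext f (fst t) (snd t \<rho>)) \<le> hext f (fst (T ! i)) \<rho>"
    if "i < length T" "psd (prod_list (fst (T ! i))) \<rho>" for i \<rho>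
    using LOCC_seq that T1(1)[OF that(1)] by auto
  let ?C = "concat (map (\<lambda>i. map (\<lambda>(d'', F). (d'', F \<circ> snd (T ! i))) (Ts ! i)) [0..<length T])"
  have "(\<Sum>t\<leftarrow>?C. hext f (fst t) (snd t \<rho>)) \<le> hext f d \<rho>" if "psd (prod_list d) \<rho>" for \<rho>
  proof -
    have sc: "(\<Sum>t\<leftarrow>concat xss. g t) = (\<Sum>xs\<leftarrow>xss. \<Sum>t\<leftarrow>xs. g t)" for g :: "nat list \<times> (complex mat \<Rightarrow> complex mat) \<Rightarrow> real" and xss
      by (induction xss) auto
    have "(\<Sum>t\<leftarrow>?C. hext f (fst t) (snd t \<rho>)) = (\<Sum>i<length T. \<Sum>t\<leftarrow>Ts ! i. hext f (fst t) (snd t (snd (T ! i) \<rho>)))"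
      unfolding sc by (simp add: o_def case_prod_unfold interv_sum_list_conv_sum_set_nat atLeast0LessThan)
    also have "\<dots> \<le> (\<Sum>i<length T. hext f (fst (T ! i)) (snd (T ! i) \<rho>))"
      by (intro sum_mono Ts2 T1(2)[OF _ that]) auto
    also have "\<dots> \<le> hext f d \<rho>" by (rule T2[OF that])
    finally show ?thesis .
  qed
  moreover have "\<forall>t\<in>set ?C. length (fst t) = n \<and> (\<forall>\<rho>. psd (prod_list d) \<rho> \<longrightarrow> psd (prod_list (fst t)) (snd t \<rho>))"
  proof
    fix t assume "t \<in> set ?C"
    then obtain i u where i: "i < length T" and u: "u \<in> set (Ts ! i)" and t: "t = (fst u, snd u \<circ> snd (T ! i))"
      by (auto simp: case_prod_unfold)
    show "length (fst t) = n \<and> (\<forall>\<rho>. psd (prod_list d) \<rho> \<longrightarrow> psd (prod_list (fst t)) (snd t \<rho>))"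
      unfolding t using Ts1[OF i u] T1[OF i] by simp
  qed
  ultimately show ?case by blast
next
  case (LOCC_merge d xs d' E1 ys E2 zs)
  let ?T = "xs @ [(d', E1)] @ ys @ [(d', E2)] @ zs" and ?T' = "xs @ [(d', \<lambda>\<rho>. E1 \<rho> + E2 \<rho>)] @ ys @ zs"
  have IH1: "length (fst t) = n" "\<And>\<rho>. psd (prod_list d) \<rho> \<Longrightarrow> psd (prod_list (fst t)) (snd t \<rho>)" if "t \<in> set ?T" for t
    using LOCC_merge.IH[OF LOCC_merge.prems] that by blast+
  have IH2: "(\<Sum>t\<leftarrow>?T. hext f (fst t) (snd t \<rho>)) \<le> hext f d \<rho>" if "psd (prod_list d) \<rho>" for \<rho>
    using LOCC_merge.IH[OF LOCC_merge.prems] that by blast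
  have len: "length d' = n" using IH1(1)[of "(d', E1)"] by simp
  have p: "psd (prod_list d') (E1 \<rho>)" "psd (prod_list d') (E2 \<rho>)" if "psd (prod_list d) \<rho>" for \<rho>
    using IH1(2)[of "(d', E1)"] IH1(2)[of "(d', E2)"] that by simp_all
  \<comment> \<open>Merging replaces two summands by the value at their sum, which subadditivity
    shows to be no larger.\<close>
  have "(\<Sum>t\<leftarrow>?T'. hext f (fst t) (snd t \<rho>)) \<le> hext f d \<rho>" if r: "psd (prod_list d) \<rho>" for \<rho>
    using IH2[OF r] hext_add_le[OF cv len p[OF r]] by simp
  moreover have "length (fst t) = n \<and> (\<forall>\<rho>. psd (prod_list d) \<rho> \<longrightarrow> psd (prod_list (fst t)) (snd t \<rho>))" if "t \<in> set ?T'" for t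
  proof (cases "t = (d', \<lambda>\<rho>. E1 \<rho> + E2 \<rho>)")
    case True
    then show ?thesis using len psd_add[OF p] by simp
  next
    case False
    then have "t \<in> set ?T" using that by auto
    then show ?thesis using IH1 by blast
  qed
  ultimately show ?case by blast
qed

lemma LOCC_monotone_hext:
  "LOCC_monotone n f \<longleftrightarrow>
    (\<forall>d T \<rho>. length d = n \<longrightarrow> LOCC d T \<longrightarrow> is_state d \<rho> \<longrightarrow> (\<Sum>t\<leftarrow>T. hext f (fst t) (snd t \<rho>)) \<le> f d \<rho>)"
  by (simp add: LOCC_monotone_def hext_def Let_def sum_list_sum_nth atLeast0LessThan)

section \<open>Necessity of the three conditions\<close>

lemma LOCC_monotone_single:
  fixes J :: nat
  assumes mo: "LOCC_monotone n f" and d: "length d = n" "k < n" and s: "is_state d \<rho>"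
    and K: "\<And>j. j < J \<Longrightarrow> K j \<in> carrier_mat e (d ! k)"
    and one: "msum (d ! k) (d ! k) {..<J} (\<lambda>j. adj (K j) * K j) = 1\<^sub>m (d ! k)"
  shows "hext f (d[k := e]) (msum (prod_list (d[k := e])) (prod_list (d[k := e])) {..<J} (\<lambda>j. lconj d k (K j) \<rho>)) \<le> f d \<rho>"
proof -
  let ?Ks = "[(e, map K [0..<J])]"
  have b: "bij_betw (\<lambda>j. (0::nat, j)) {..<J} {(x, j). x < length ?Ks \<and> j < length (snd (?Ks ! x))}"
    by (auto simp: bij_betw_def inj_on_def)
  have "local_instrument (d ! k) ?Ks"
    unfolding local_instrument_def msum_reindex[OF b, symmetric]
    using K one by (auto cong: msum_cong_simp)
  then have "LOCC d (map (\<lambda>ex. (d[k := fst ex], local_map d k ex)) ?Ks)"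
    using d by (intro LOCC_local) auto
  then have "(\<Sum>t\<leftarrow>map (\<lambda>ex. (d[k := fst ex], local_map d k ex)) ?Ks. hext f (fst t) (snd t \<rho>)) \<le> f d \<rho>"
    using mo d(1) s unfolding LOCC_monotone_hext by blast
  moreover have "local_map d k (e, map K [0..<J]) \<rho> = msum (prod_list (d[k := e])) (prod_list (d[k := e])) {..<J} (\<lambda>j. lconj d k (K j) \<rho>)"
    unfolding local_map_lconj fst_conv snd_conv by (intro msum_cong) auto
  ultimately show ?thesis by simp
qed

text \<open>Here every Kraus operator is an outcome of its own, so values are averaged over
  measurement results; with a single outcome, f is evaluated at the mixed output instead. Measuring
  a flag needs this form, adding and discarding an ancilla the other.\<close>

lemma LOCC_monotone_selective:
  fixes J :: nat
  assumes mo: "LOCC_monotone n f" and d: "length d = n" "k < n" and s: "is_state d \<rho>"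
    and K: "\<And>j. j < J \<Longrightarrow> K j \<in> carrier_mat e (d ! k)"
    and one: "msum (d ! k) (d ! k) {..<J} (\<lambda>j. adj (K j) * K j) = 1\<^sub>m (d ! k)"
  shows "(\<Sum>j<J. hext f (d[k := e]) (lconj d k (K j) \<rho>)) \<le> f d \<rho>"
proof -
  let ?Ks = "map (\<lambda>j. (e, [K j])) [0..<J]"
  have k: "k < length d" using d by simp
  have b: "bij_betw (\<lambda>j. (j, 0::nat)) {..<J} {(x, j). x < length ?Ks \<and> j < length (snd (?Ks ! x))}"
    by (auto simp: bij_betw_def inj_on_def)
  have "local_instrument (d ! k) ?Ks"
    unfolding local_instrument_def msum_reindex[OF b, symmetric]
    using K one by (auto cong: msum_cong_simp)
  then have "LOCC d (map (\<lambda>ex. (d[k := fst ex], local_map d k ex)) ?Ks)"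
    using k by (intro LOCC_local)
  then have "(\<Sum>t\<leftarrow>map (\<lambda>ex. (d[k := fst ex], local_map d k ex)) ?Ks. hext f (fst t) (snd t \<rho>)) \<le> f d \<rho>"
    using mo d(1) s unfolding LOCC_monotone_hext by blast
  moreover have "local_map d k (e, [K j]) \<rho> = lconj d k (K j) \<rho>" if "j < J" for j
    unfolding local_map_lconj using lconj_carrier[OF k K[OF that] is_stateD(3)[OF s]]
    by (intro eq_matI) auto
  ultimately show ?thesis
    by (simp add: o_def interv_sum_list_conv_sum_set_nat atLeast0LessThan)
qed

lemma LOCC_monotone_isometry:
  assumes "LOCC_monotone n f" "length d = n" "k < n" "is_state d \<rho>"
    "V \<in> carrier_mat e (d ! k)" "adj V * V = 1\<^sub>m (d ! k)"
  shows "f (d[k := e]) (lconj d k V \<rho>) \<le> f d \<rho>"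
proof -
  have st: "is_state (d[k := e]) (lconj d k V \<rho>)" using assms by (intro is_state_lconj) auto
  have "(\<Sum>j<1::nat. hext f (d[k := e]) (lconj d k V \<rho>)) \<le> f d \<rho>"
  proof (rule LOCC_monotone_selective[OF assms(1-4)])
    have "msum (d ! k) (d ! k) {..<1} (\<lambda>j::nat. adj V * V) = adj V * V"
      using msum_singleton[of "\<lambda>j::nat. adj V * V" 0] assms(5,6) by (simp add: lessThan_Suc)
    then show "msum (d ! k) (d ! k) {..<1} (\<lambda>j::nat. adj V * V) = 1\<^sub>m (d ! k)" using assms(6) by simp
  qed (use assms in simp)
  then show ?thesis by (simp add: hext_state[OF st])
qed


lemma LOCC_monotone_unitary:
  assumes mo: "LOCC_monotone n f" and d: "length d = n" "k < n" and s: "is_state d \<rho>" and U: "unitary (d ! k) U"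
  shows "f d (lconj d k U \<rho>) = f d \<rho>"
proof (rule antisym)
  have k: "k < length d" using d by simp
  have U: "U \<in> carrier_mat (d ! k) (d ! k)" "adj U * U = 1\<^sub>m (d ! k)" "U * adj U = 1\<^sub>m (d ! k)"
    using U by (auto simp: unitary_def)
  show "f d (lconj d k U \<rho>) \<le> f d \<rho>"
    using LOCC_monotone_isometry[OF mo d s U(1,2)] by simp
  have s': "is_state d (lconj d k U \<rho>)" using is_state_lconj[OF k U(1,2) s] by simp
  have "f (d[k := d ! k]) (lconj d k (adj U) (lconj d k U \<rho>)) \<le> f d (lconj d k U \<rho>)"
    by (rule LOCC_monotone_isometry[OF mo d s']) (use U in auto)
  moreover have "lconj d k (adj U) (lconj d k U \<rho>) = \<rho>"
    using lconj_lconj[OF k U(1) adj_carrier[OF U(1)] is_stateD(3)[OF s]] U(2) lconj_one[OF k is_stateD(3)[OF s]] by simp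
  ultimately show "f d \<rho> \<le> f d (lconj d k U \<rho>)" by simp
qed

lemma LOCC_monotone_unitary_invariant:
  assumes mo: "LOCC_monotone n f"
  shows "local_unitary_invariant n f"
  unfolding local_unitary_invariant_def
proof (intro allI impI)
  fix d \<rho> Us
  assume d: "length d = n" and s: "is_state d \<rho>" and Us: "length Us = n" and u: "\<forall>k<n. unitary (d ! k) (Us ! k)"
  \<comment> \<open>Unitaries on the first j parties and identities on the rest: this interpolates
    between the identity at j = 0 and the full product at j = n.\<close>
  let ?A = "\<lambda>j. kron_list (take j Us @ map (\<lambda>m. 1\<^sub>m m) (drop j d))"
  have c: "kron_list (take j Us) \<in> carrier_mat (prod_list (take j d)) (prod_list (take j d))" if "j \<le> n" for j
    using that
  proof (induction j)
    case (Suc j)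
    then have j: "j < length d" "j < length Us" using d Us by auto
    have "Us ! j \<in> carrier_mat (d ! j) (d ! j)" using u Suc by (auto simp: unitary_def)
    then show ?case using Suc j
      by (simp add: take_Suc_conv_app_nth kron_list_append kron_carrier)
  qed simp
  have Ac: "?A j \<in> carrier_mat (prod_list d) (prod_list d)" if "j \<le> n" for j
  proof -
    have "prod_list d = prod_list (take j d) * prod_list (drop j d)" by (simp flip: prod_list.append)
    then show ?thesis using kron_carrier[OF c[OF that] one_carrier_mat] by (simp add: kron_list_append kron_list_one)
  qed
  have step: "?A (Suc j) = ?A j * embed d j (Us ! j)" if j: "j < n" for j
  proof -
    have jd: "j < length d" "j < length Us" using j d Us by auto
    have U: "Us ! j \<in> carrier_mat (d ! j) (d ! j)" using u j by (auto simp: unitary_def)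
    let ?R = "1\<^sub>m (prod_list (drop (Suc j) d)) :: complex mat" and ?L = "kron_list (take j Us)"
    have dr: "drop j d = d ! j # drop (Suc j) d" using jd by (simp add: Cons_nth_drop_Suc)
    have "?A j * embed d j (Us ! j) = kron ?L (kron (1\<^sub>m (d ! j)) ?R) * kron (1\<^sub>m (prod_list (take j d))) (kron (Us ! j) ?R)"
      unfolding embed_kron[OF jd(1)] dr by (simp add: kron_list_append kron_list_one)
    also have "\<dots> = kron (?L * 1\<^sub>m (prod_list (take j d))) (kron (1\<^sub>m (d ! j)) ?R * kron (Us ! j) ?R)"
      by (rule kron_mult[OF c kron_carrier[OF one_carrier_mat one_carrier_mat] one_carrier_mat kron_carrier[OF U one_carrier_mat]]) (use j in simp)
    also have "kron (1\<^sub>m (d ! j)) ?R * kron (Us ! j) ?R = kron (1\<^sub>m (d ! j) * Us ! j) (?R * ?R)"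
      by (rule kron_mult[OF one_carrier_mat one_carrier_mat U one_carrier_mat])
    also have "kron (?L * 1\<^sub>m (prod_list (take j d))) (kron (1\<^sub>m (d ! j) * Us ! j) (?R * ?R)) = kron ?L (kron (Us ! j) ?R)"
      using right_mult_one_mat[OF c[of j]] left_mult_one_mat[OF U] j by simp
    also have "\<dots> = ?A (Suc j)"
      using jd by (simp add: take_Suc_conv_app_nth kron_list_append kron_list_one kron_assoc)
    finally show ?thesis by simp
  qed
  \<comment> \<open>The quantifier over states is part of the induction: the newly added unitary
    acts innermost, so the hypothesis is used at the rotated state.\<close>
  have "\<forall>\<rho>. is_state d \<rho> \<longrightarrow> f d (?A j * \<rho> * adj (?A j)) = f d \<rho>" if "j \<le> n" for j
    using that
  proof (induction j)
    case 0
    have "?A 0 = 1\<^sub>m (prod_list d)" by (simp add: kron_list_one)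
    then show ?case by (simp add: left_mult_one_mat[OF is_stateD(3)] right_mult_one_mat[OF is_stateD(3)])
  next
    case (Suc j)
    then have j: "j < n" "j \<le> n" and jd: "j < length d" using d by auto
    show ?case
    proof (intro allI impI)
      fix \<rho> assume s: "is_state d \<rho>"
      have uj: "unitary (d ! j) (Us ! j)" using u j by simp
      then have U: "Us ! j \<in> carrier_mat (d ! j) (d ! j)" "adj (Us ! j) * Us ! j = 1\<^sub>m (d ! j)" by (auto simp: unitary_def)
      have E: "embed d j (Us ! j) \<in> carrier_mat (prod_list d) (prod_list d)" using embed_carrier'[OF jd U(1)] by simp
      note A = Ac[OF j(2)]
      have "?A (Suc j) * \<rho> * adj (?A (Suc j)) = ?A j * lconj d j (Us ! j) \<rho> * adj (?A j)"
        unfolding step[OF j(1)] adj_mult[OF A E] lconj_def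
        by (rule mult_assoc_conj[OF A E is_stateD(3)[OF s] adj_carrier[OF E] adj_carrier[OF A], symmetric])
      moreover have "is_state d (lconj d j (Us ! j) \<rho>)" using is_state_lconj[OF jd U s] by simp
      ultimately show "f d (?A (Suc j) * \<rho> * adj (?A (Suc j))) = f d \<rho>"
        using Suc.IH[OF j(2)] LOCC_monotone_unitary[OF mo d j(1) s uj] by simp
    qed
  qed
  from this[of n] show "f d (kron_list Us * \<rho> * adj (kron_list Us)) = f d \<rho>"
    using s d Us by simp
qed

lemma adj_ket_unit_vec_attach:
  assumes "w \<in> carrier_vec e" "j < e"
  shows "adj (attach m (unit_vec e j)) * attach m w = (w $ j) \<cdot>\<^sub>m 1\<^sub>m m"
proof -
  have "conjugate (unit_vec e j) = (unit_vec e j :: complex vec)"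
    by (intro eq_vecI) (auto simp: unit_vec_def)
  then have "conjugate (unit_vec e j) \<bullet> w = w $ j" using assms by simp
  then show ?thesis using adj_attach_attach[of "unit_vec e j" e w m] assms by simp
qed

lemma LOCC_monotone_ancilla_invariant:
  assumes mo: "LOCC_monotone n f"
  shows "local_ancilla_invariant n f"
  unfolding local_ancilla_invariant_def anc_dims_def
proof (intro allI impI)
  fix d k e \<rho> \<sigma>
  assume d: "length d = n" "k < n" and s: "is_state d \<rho>" and t: "is_state [e] \<sigma>"
  let ?D = "d[k := d ! k * e]"
  let ?N' = "prod_list ?D" and ?m = "d ! k"
  have k: "k < length d" using d by simp
  note r = is_stateD(3)[OF s]
  have p: "psd e \<sigma>" using is_stateD(1)[OF t] by simp
  obtain w where w: "\<And>i. i < e \<Longrightarrow> w i \<in> carrier_vec e" "\<sigma> = msum e e {..<e} (\<lambda>i. ketbra (w i))"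
    using psd_eq_sum_ketbra[OF p] by blast
  have tr: "(\<Sum>i<e. conjugate (w i) \<bullet> w i) = 1"
  proof -
    have "mtrace \<sigma> = (\<Sum>i<e. mtrace (ketbra (w i)))"
      unfolding w(2) by (rule mtrace_msum) (use w in auto)
    also have "\<dots> = (\<Sum>i<e. conjugate (w i) \<bullet> w i)"
    proof (intro sum.cong refl)
      fix i assume "i \<in> {..<e}"
      then have "w i \<in> carrier_vec e" using w by simp
      then show "mtrace (ketbra (w i)) = conjugate (w i) \<bullet> w i"
        by (auto simp: mtrace_def ketbra_def scalar_prod_def atLeast0LessThan mult.commute intro!: sum.cong)
    qed
    finally show ?thesis using is_stateD(2)[OF t] by simp
  qed
  \<comment> \<open>The unnormalised vectors of a rank-one decomposition of \<sigma> give the Kraus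
    operators that append \<sigma>. They are complete because \<sigma> has trace one.\<close>
  let ?W = "\<lambda>i. attach ?m (w i)"
  have Wc: "?W i \<in> carrier_mat (?m * e) ?m" if "i < e" for i by (rule attach_carrier[OF w(1)[OF that]])
  have one: "msum ?m ?m {..<e} (\<lambda>i. adj (?W i) * ?W i) = 1\<^sub>m ?m"
  proof -
    have "msum ?m ?m {..<e} (\<lambda>i. adj (?W i) * ?W i) = msum ?m ?m {..<e} (\<lambda>i. (conjugate (w i) \<bullet> w i) \<cdot>\<^sub>m 1\<^sub>m ?m)"
      by (intro msum_cong refl adj_attach_attach) (use w in auto)
    also have "\<dots> = (\<Sum>i<e. conjugate (w i) \<bullet> w i) \<cdot>\<^sub>m 1\<^sub>m ?m"
      by (rule eq_matI) auto
    finally show ?thesis unfolding tr by (simp add: one_smult_mat)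
  qed
  let ?\<tau> = "add_anc d k e \<rho> \<sigma>"
  have \<tau>: "?\<tau> = msum ?N' ?N' {..<e} (\<lambda>i. lconj d k (?W i) \<rho>)"
    unfolding w(2) by (subst add_anc_msum[OF k r]) (use w add_anc_ketbra[OF k r] in \<open>auto intro!: msum_cong\<close>)
  have st: "is_state ?D ?\<tau>" unfolding is_state_def
  proof
    show "psd ?N' ?\<tau>" unfolding \<tau>
      by (intro psd_msum lconj_psd[OF k Wc is_stateD(1)[OF s]]) auto
    have "mtrace ?\<tau> = (\<Sum>i<e. mtrace (lconj d k (?W i) \<rho>))"
      unfolding \<tau> by (rule mtrace_msum) (use lconj_carrier[OF k Wc r] in auto)
    also have "\<dots> = mtrace \<rho>"
      by (rule mtrace_lconj_complete[OF k _ r one]) (use Wc in auto)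
    finally show "mtrace ?\<tau> = 1" using is_stateD(2)[OF s] by simp
  qed
  have "hext f ?D ?\<tau> \<le> f d \<rho>"
    unfolding \<tau> by (rule LOCC_monotone_single[OF mo d s Wc one])
  then have le: "f ?D ?\<tau> \<le> f d \<rho>" unfolding hext_state[OF st] .
  \<comment> \<open>The adjoints contract the ancilla with the basis bras and so are the Kraus
    operators of the partial trace; completeness is the resolution of the identity below.\<close>
  let ?B = "\<lambda>j. attach ?m (unit_vec e j)"
  have Bc: "?B j \<in> carrier_mat (?m * e) ?m" for j by (rule attach_carrier) simp
  have Dk: "?D ! k = ?m * e" "length ?D = n" "k < length ?D" "?D[k := ?m] = d" using d by auto
  have aBc: "adj (?B j) \<in> carrier_mat ?m (?D ! k)" for j using adj_carrier[OF Bc] by (simp add: Dk)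
  have id: "1\<^sub>m e = msum e e {..<e} (\<lambda>j. ketbra (unit_vec e j))"
    by (rule eq_matI) (auto simp: index_ketbra[of _ e] unit_vec_def if_distrib[of cnj] if_distrib[of "\<lambda>x. x * _"] cong: if_cong)
  have "msum (?D ! k) (?D ! k) {..<e} (\<lambda>j. adj (adj (?B j)) * adj (?B j)) = msum (?m * e) (?m * e) {..<e} (\<lambda>j. kron (1\<^sub>m ?m) (ketbra (unit_vec e j)))"
    unfolding Dk
  proof (intro msum_cong refl)
    fix j
    have "kron (1\<^sub>m ?m) (ket (unit_vec e j)) * kron (1\<^sub>m ?m) (adj (ket (unit_vec e j))) = kron (1\<^sub>m ?m * 1\<^sub>m ?m) (ketbra (unit_vec e j))"
      unfolding ketbra_eq by (rule kron_mult[of _ ?m ?m _ e 1 _ ?m _ e]) (auto intro: ket_carrier)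
    then show "adj (adj (?B j)) * adj (?B j) = kron (1\<^sub>m ?m) (ketbra (unit_vec e j))"
      by (simp add: attach_def adj_kron)
  qed
  also have "\<dots> = kron (1\<^sub>m ?m) (msum e e {..<e} (\<lambda>j. ketbra (unit_vec e j)))"
    by (rule kron_msum_right[symmetric]) auto
  also have "\<dots> = 1\<^sub>m (?D ! k)" unfolding id[symmetric] kron_one Dk ..
  finally have one': "msum (?D ! k) (?D ! k) {..<e} (\<lambda>j. adj (adj (?B j)) * adj (?B j)) = 1\<^sub>m (?D ! k)" .
  have "hext f (?D[k := ?m]) (msum (prod_list (?D[k := ?m])) (prod_list (?D[k := ?m])) {..<e} (\<lambda>j. lconj ?D k (adj (?B j)) ?\<tau>)) \<le> f ?D ?\<tau>"
    by (rule LOCC_monotone_single[OF mo Dk(2) d(2) st aBc one'])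
  also have "msum (prod_list (?D[k := ?m])) (prod_list (?D[k := ?m])) {..<e} (\<lambda>j. lconj ?D k (adj (?B j)) ?\<tau>) = \<rho>"
  proof -
    let ?N = "prod_list d"
    \<comment> \<open>Contracting the i-th vector with the j-th bra leaves \<rho> times the squared
      modulus of \<open>w i $ j\<close>; over all i and j these weights add up to the trace of
      \<sigma>.\<close>
    have "lconj ?D k (adj (?B j)) ?\<tau> = msum ?N ?N {..<e} (\<lambda>i. (w i $ j * cnj (w i $ j)) \<cdot>\<^sub>m \<rho>)" if j: "j < e" for j
    proof -
      have "lconj ?D k (adj (?B j)) ?\<tau> = msum ?N ?N {..<e} (\<lambda>i. lconj ?D k (adj (?B j)) (lconj d k (?W i) \<rho>))"
        unfolding \<tau> using lconj_msum[OF Dk(3) aBc, of "{..<e}" "\<lambda>i. lconj d k (?W i) \<rho>"] lconj_carrier[OF k Wc r] by (simp add: Dk)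
      also have "\<dots> = msum ?N ?N {..<e} (\<lambda>i. (w i $ j * cnj (w i $ j)) \<cdot>\<^sub>m \<rho>)"
      proof (intro msum_cong refl)
        fix i assume "i \<in> {..<e}"
        then have i: "i < e" by simp
        have "lconj ?D k (adj (?B j)) (lconj d k (?W i) \<rho>) = lconj d k (adj (?B j) * ?W i) \<rho>"
          by (rule lconj_lconj[OF k Wc[OF i] adj_carrier[OF Bc] r])
        then show "lconj ?D k (adj (?B j)) (lconj d k (?W i) \<rho>) = (w i $ j * cnj (w i $ j)) \<cdot>\<^sub>m \<rho>"
          unfolding adj_ket_unit_vec_attach[OF w(1)[OF i] j] lconj_smult_op[OF k one_carrier_mat r] lconj_one[OF k r] .
      qed
      finally show ?thesis .
    qed
    then have "msum ?N ?N {..<e} (\<lambda>j. lconj ?D k (adj (?B j)) ?\<tau>) = msum ?N ?N {..<e} (\<lambda>j. msum ?N ?N {..<e} (\<lambda>i. (w i $ j * cnj (w i $ j)) \<cdot>\<^sub>m \<rho>))"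
      by (intro msum_cong refl) auto
    also have "\<dots> = (\<Sum>j<e. \<Sum>i<e. w i $ j * cnj (w i $ j)) \<cdot>\<^sub>m \<rho>"
      using r by (intro eq_matI) (auto simp: sum_distrib_right)
    also have "(\<Sum>j<e. \<Sum>i<e. w i $ j * cnj (w i $ j)) = (\<Sum>i<e. conjugate (w i) \<bullet> w i)"
    proof (subst sum.swap, intro sum.cong refl)
      fix i assume "i \<in> {..<e}"
      then have "w i \<in> carrier_vec e" using w by simp
      then show "(\<Sum>j<e. w i $ j * cnj (w i $ j)) = conjugate (w i) \<bullet> w i"
        by (auto simp: scalar_prod_def atLeast0LessThan mult.commute intro!: sum.cong)
    qed
    finally show ?thesis using tr k by (simp add: one_smult_mat)
  qed
  finally have "f d \<rho> \<le> f ?D ?\<tau>" using hext_state[OF s, of f] k by simp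
  with le show "f ?D ?\<tau> = f d \<rho>" by simp
qed

lemma LOCC_monotone_flagged_affine:
  assumes cv: "convex_measure n f" and mo: "LOCC_monotone n f"
  shows "flagged_affine n f"
  unfolding flagged_affine_def anc_dims_def Let_def
proof (intro allI impI)
  fix d k e and I :: "nat set" and p :: "nat \<Rightarrow> real" and \<rho> and v :: "nat \<Rightarrow> complex vec"
  assume d: "length d = n" "k < n" and I: "finite I" and p: "\<forall>i\<in>I. 0 \<le> p i" "(\<Sum>i\<in>I. p i) = 1"
    and s: "\<forall>i\<in>I. is_state d (\<rho> i)" and v: "\<forall>i\<in>I. v i \<in> carrier_vec e"
    and o: "\<forall>i\<in>I. \<forall>j\<in>I. conjugate (v i) \<bullet> v j = (if i = j then 1 else 0)"
  let ?D = "d[k := d ! k * e]" and ?m = "d ! k"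
  let ?N' = "prod_list ?D" and ?M = "d ! k * e"
  have k: "k < length d" using d by simp
  have Dk: "?D ! k = ?M" "length ?D = n" "k < length ?D" "?D[k := ?M] = ?D" using d by auto
  let ?W = "\<lambda>i. attach ?m (v i)"
  have Wc: "?W i \<in> carrier_mat ?M ?m" if "i \<in> I" for i using attach_carrier v that by blast
  have WW: "adj (?W i) * ?W j = (if i = j then 1 else 0) \<cdot>\<^sub>m 1\<^sub>m ?m" if "i \<in> I" "j \<in> I" for i j
    using adj_attach_attach[of "v i" e "v j" ?m] v o that by simp
  define X where "X = (\<lambda>i. lconj d k (?W i) (\<rho> i))"
  have aX: "add_anc d k e (\<rho> i) (ketbra (v i)) = X i" if "i \<in> I" for i
    unfolding X_def using that s v is_stateD(3) by (intro add_anc_ketbra[OF k]) auto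
  have Xs: "is_state ?D (X i)" if "i \<in> I" for i
    unfolding X_def using that s Wc WW[OF that that] by (intro is_state_lconj[OF k]) (auto simp: one_smult_mat)
  define \<tau> where "\<tau> = msum ?N' ?N' I (\<lambda>i. complex_of_real (p i) \<cdot>\<^sub>m X i)"
  have \<tau>s: "is_state ?D \<tau>" unfolding is_state_def
  proof
    show "psd ?N' \<tau>" unfolding \<tau>_def using I p is_stateD(1)[OF Xs] by (intro psd_msum psd_smult) auto
    have "mtrace \<tau> = (\<Sum>i\<in>I. mtrace (complex_of_real (p i) \<cdot>\<^sub>m X i))"
      unfolding \<tau>_def by (rule mtrace_msum) (use is_stateD(3)[OF Xs] in auto)
    also have "\<dots> = (\<Sum>i\<in>I. complex_of_real (p i))"
      by (intro sum.cong refl) (simp add: mtrace_smult[OF is_stateD(3)[OF Xs]] is_stateD(2)[OF Xs])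
    finally show "mtrace \<tau> = 1" using p(2) by (simp flip: of_real_sum)
  qed
  have le: "f ?D \<tau> \<le> (\<Sum>i\<in>I. p i * f ?D (X i))"
    unfolding \<tau>_def by (rule cv[unfolded convex_measure_def, rule_format]) (use d I p Xs in auto)
  \<comment> \<open>Projections onto the flags. The vectors \<open>v i\<close> need not span the
    ancilla, so the projection \<open>R\<close> onto the complement is added to make the measurement
    complete.\<close>
  define Q where "Q = (\<lambda>i. ?W i * adj (?W i))"
  define S where "S = msum ?M ?M I Q"
  define R where "R = 1\<^sub>m ?M - S"
  have Qc: "Q i \<in> carrier_mat ?M ?M" if "i \<in> I" for i
    unfolding Q_def by (rule mult_carrier_mat[OF Wc[OF that] adj_carrier[OF Wc[OF that]]])
  have adjQ: "adj (Q i) = Q i" if "i \<in> I" for i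
    unfolding Q_def adj_mult[OF Wc[OF that] adj_carrier[OF Wc[OF that]]] by simp
  have QW: "Q i * ?W j = (if i = j then 1 else 0) \<cdot>\<^sub>m ?W i" if ij: "i \<in> I" "j \<in> I" for i j
    unfolding Q_def assoc_mult_mat[OF Wc[OF ij(1)] adj_carrier[OF Wc[OF ij(1)]] Wc[OF ij(2)]] WW[OF ij]
      mult_smult_distrib[OF Wc[OF ij(1)] one_carrier_mat] right_mult_one_mat[OF Wc[OF ij(1)]] ..
  have QQ: "Q i * Q j = (if i = j then 1 else 0) \<cdot>\<^sub>m Q i" if ij: "i \<in> I" "j \<in> I" for i j
  proof -
    have Qj: "Q j = ?W j * adj (?W j)" by (simp add: Q_def)
    have "Q i * Q j = Q i * ?W j * adj (?W j)"
      unfolding Qj by (rule assoc_mult_mat[OF Qc[OF ij(1)] Wc[OF ij(2)] adj_carrier[OF Wc[OF ij(2)]], symmetric])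
    also have "\<dots> = (if i = j then 1 else 0) \<cdot>\<^sub>m (?W i * adj (?W j))"
      unfolding QW[OF ij] by (rule mult_smult_assoc_mat[OF Wc[OF ij(1)] adj_carrier[OF Wc[OF ij(2)]]])
    also have "\<dots> = (if i = j then 1 else 0) \<cdot>\<^sub>m Q i"
      using Qc[OF ij(1)] Wc[OF ij(1)] Wc[OF ij(2)] by (cases "i = j") (auto simp: Q_def intro!: eq_matI)
    finally show ?thesis .
  qed
  have single: "msum a b I (\<lambda>i. (if i = j then 1 else 0) \<cdot>\<^sub>m g i) = g j"
    if "j \<in> I" "\<And>i. i \<in> I \<Longrightarrow> g i \<in> carrier_mat a b" for a b j g
  proof -
    have "msum a b I (\<lambda>i. (if i = j then 1 else 0) \<cdot>\<^sub>m g i) = msum a b {j} (\<lambda>i. (if i = j then 1 else 0) \<cdot>\<^sub>m g i)"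
    proof (rule msum_mono_neutral[OF I])
      fix i assume "i \<in> I - {j}"
      then have "g i \<in> carrier_mat a b" "i \<noteq> j" using that by auto
      then show "(if i = j then 1 else 0) \<cdot>\<^sub>m g i = 0\<^sub>m a b" by (intro eq_matI) auto
    qed (use that in simp)
    also have "\<dots> = g j" using that by (subst msum_singleton) (auto simp: one_smult_mat)
    finally show ?thesis .
  qed
  have Sc: "S \<in> carrier_mat ?M ?M" by (simp add: S_def)
  have Rc: "R \<in> carrier_mat ?M ?M" unfolding R_def using Sc by (rule minus_carrier_mat)
  have SW: "S * ?W j = ?W j" if j: "j \<in> I" for j
  proof -
    have "S * ?W j = msum ?M ?m I (\<lambda>i. Q i * ?W j)"
      unfolding S_def by (rule msum_mult[OF Wc[OF j]]) (rule Qc)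
    also have "\<dots> = msum ?M ?m I (\<lambda>i. (if i = j then 1 else 0) \<cdot>\<^sub>m ?W i)"
      by (intro msum_cong refl QW j)
    also have "\<dots> = ?W j" by (rule single[OF j]) (rule Wc)
    finally show ?thesis .
  qed
  have SQ: "S * Q j = Q j" if j: "j \<in> I" for j
    unfolding Q_def using assoc_mult_mat[OF Sc Wc[OF j] adj_carrier[OF Wc[OF j]]] SW[OF j] by simp
  have SS: "S * S = S"
  proof -
    have "S * msum ?M ?M I Q = msum ?M ?M I (\<lambda>j. S * Q j)"
      by (rule mult_msum[OF Sc]) (rule Qc)
    also have "\<dots> = msum ?M ?M I Q" by (intro msum_cong refl SQ)
    finally show ?thesis by (simp flip: S_def)
  qed
  have adjS: "adj S = S"
    unfolding S_def by (subst adj_msum[OF Qc]) (auto intro: msum_cong adjQ)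
  have adjR: "adj R = R" unfolding R_def adj_minus[OF one_carrier_mat Sc] adjS by simp
  have RW: "R * ?W j = 0\<^sub>m ?M ?m" if j: "j \<in> I" for j
    unfolding R_def minus_mult_distrib_mat[OF one_carrier_mat Sc Wc[OF j]] SW[OF j] left_mult_one_mat[OF Wc[OF j]]
    using Wc[OF j] by (intro eq_matI) auto
  have RR: "R * R = R"
  proof -
    have "R * R = 1\<^sub>m ?M * R - S * R" using minus_mult_distrib_mat[OF one_carrier_mat Sc Rc] by (simp add: R_def)
    moreover have "S * R = 0\<^sub>m ?M ?M"
      unfolding R_def mult_minus_distrib_mat[OF Sc one_carrier_mat Sc] SS right_mult_one_mat[OF Sc]
      using Sc by (intro eq_matI) auto
    ultimately show ?thesis using Rc by (simp, intro eq_matI) auto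
  qed
  obtain h where h0: "bij_betw h {0..<card I} I" using ex_bij_betw_nat_finite[OF I] by blast
  then have h: "bij_betw h {..<card I} I" by (simp add: atLeast0LessThan)
  have hI: "h x \<in> I" if "x < card I" for x using bij_betwE[OF h] that by auto
  \<comment> \<open>Indices below \<open>card I\<close> enumerate the flags, and the one remaining
    index is the complement.\<close>
  let ?K = "\<lambda>x. if x < card I then Q (h x) else R"
  have Kc: "?K x \<in> carrier_mat ?M (?D ! k)" for x using Qc[OF hI] Rc Dk by auto
  have one: "msum (?D ! k) (?D ! k) {..<Suc (card I)} (\<lambda>x. adj (?K x) * ?K x) = 1\<^sub>m (?D ! k)"
  proof -
    \<comment> \<open>All of them are Hermitian idempotents, so completeness is just the sum of the
      projections.\<close>
    have KK: "adj (?K x) * ?K x = ?K x" for x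
      using hI[of x] adjQ[OF hI] QQ[OF hI hI] adjR RR by (auto simp: one_smult_mat)
    have "msum ?M ?M {..<Suc (card I)} ?K = R + msum ?M ?M {..<card I} ?K"
      unfolding lessThan_Suc by (subst msum_insert) (use Rc in auto)
    also have "msum ?M ?M {..<card I} ?K = msum ?M ?M {..<card I} (\<lambda>x. Q (h x))"
      by (intro msum_cong refl) simp
    also have "\<dots> = S" unfolding S_def by (rule msum_reindex[OF h])
    also have "R + S = 1\<^sub>m ?M" unfolding R_def using Sc by (intro eq_matI) auto
    finally show ?thesis unfolding KK Dk .
  qed
  have lX: "lconj ?D k A \<tau> = msum ?N' ?N' I (\<lambda>i. complex_of_real (p i) \<cdot>\<^sub>m lconj d k (A * ?W i) (\<rho> i))"
    if A: "A \<in> carrier_mat ?M ?M" for A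
  proof -
    have A': "A \<in> carrier_mat ?M (?D ! k)" using A Dk by simp
    have "lconj ?D k A \<tau> = msum ?N' ?N' I (\<lambda>i. lconj ?D k A (complex_of_real (p i) \<cdot>\<^sub>m X i))"
      unfolding \<tau>_def using lconj_msum[OF Dk(3) A', of I "\<lambda>i. complex_of_real (p i) \<cdot>\<^sub>m X i"] is_stateD(3)[OF Xs]
      by (simp add: Dk(4))
    also have "\<dots> = msum ?N' ?N' I (\<lambda>i. complex_of_real (p i) \<cdot>\<^sub>m lconj d k (A * ?W i) (\<rho> i))"
    proof (intro msum_cong refl)
      fix i assume i: "i \<in> I"
      have "is_state d (\<rho> i)" using s i by simp
      from lconj_lconj[OF k Wc[OF i] A is_stateD(3)[OF this]]
      show "lconj ?D k A (complex_of_real (p i) \<cdot>\<^sub>m X i) = complex_of_real (p i) \<cdot>\<^sub>m lconj d k (A * ?W i) (\<rho> i)"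
        unfolding lconj_smult[OF Dk(3) A' is_stateD(3)[OF Xs[OF i]]] by (simp add: X_def)
    qed
    finally show ?thesis .
  qed
  \<comment> \<open>\<open>Q j\<close> annihilates every flag but its own, so outcome j recovers
    \<open>X j\<close> with probability \<open>p j\<close>.\<close>
  have lQ: "lconj ?D k (Q j) \<tau> = complex_of_real (p j) \<cdot>\<^sub>m X j" if j: "j \<in> I" for j
  proof -
    have "lconj ?D k (Q j) \<tau> = msum ?N' ?N' I (\<lambda>i. (if i = j then 1 else 0) \<cdot>\<^sub>m (complex_of_real (p i) \<cdot>\<^sub>m X i))"
      unfolding lX[OF Qc[OF j]]
    proof (intro msum_cong refl)
      fix i assume i: "i \<in> I"
      have r: "\<rho> i \<in> carrier_mat (prod_list d) (prod_list d)" using s i is_stateD(3) by blast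
      have "Q j * ?W i = (if i = j then 1 else 0) \<cdot>\<^sub>m ?W i"
        using QW[OF j i] Wc[OF i] Wc[OF j] by (cases "i = j") (auto intro!: eq_matI)
      then have "lconj d k (Q j * ?W i) (\<rho> i) = (if i = j then 1 else 0) \<cdot>\<^sub>m X i"
        using lconj_smult_op[OF k Wc[OF i] r, of "if i = j then 1 else 0"] by (simp add: X_def)
      then show "complex_of_real (p i) \<cdot>\<^sub>m lconj d k (Q j * ?W i) (\<rho> i) = (if i = j then 1 else 0) \<cdot>\<^sub>m (complex_of_real (p i) \<cdot>\<^sub>m X i)"
        by (simp add: smult_smult mult.commute)
    qed
    also have "\<dots> = complex_of_real (p j) \<cdot>\<^sub>m X j"
      by (rule single[OF j]) (use is_stateD(3)[OF Xs] in auto)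
    finally show ?thesis .
  qed
  have lR: "lconj ?D k R \<tau> = 0\<^sub>m ?N' ?N'"
  proof -
    have "lconj d k (R * ?W i) (\<rho> i) = 0\<^sub>m ?N' ?N'" if i: "i \<in> I" for i
    proof -
      have r: "\<rho> i \<in> carrier_mat (prod_list d) (prod_list d)" using s i is_stateD(3) by blast
      have "R * ?W i = 0 \<cdot>\<^sub>m ?W i" unfolding RW[OF i] using Wc[OF i] by (intro eq_matI) auto
      then show ?thesis
        using lconj_smult_op[OF k Wc[OF i] r, of 0] lconj_carrier[OF k Wc[OF i] r] by (simp, intro eq_matI) auto
    qed
    then show ?thesis unfolding lX[OF Rc] by (intro eq_matI) auto
  qed
  have "(\<Sum>x<Suc (card I). hext f (?D[k := ?M]) (lconj ?D k (?K x) \<tau>)) \<le> f ?D \<tau>"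
    by (rule LOCC_monotone_selective[OF mo Dk(2) d(2) \<tau>s Kc one])
  \<comment> \<open>The complement outcome yields the zero matrix, where the extension is 0, so the
    last summand drops out.\<close>
  then have "(\<Sum>x<card I. hext f ?D (lconj ?D k (Q (h x)) \<tau>)) \<le> f ?D \<tau>"
    unfolding Dk by (simp add: lR)
  moreover have "(\<Sum>x<card I. hext f ?D (lconj ?D k (Q (h x)) \<tau>)) = (\<Sum>i\<in>I. hext f ?D (lconj ?D k (Q i) \<tau>))"
    by (rule sum.reindex_bij_betw[OF h])
  moreover have "hext f ?D (lconj ?D k (Q i) \<tau>) = p i * f ?D (X i)" if i: "i \<in> I" for i
    using hext_smult[OF is_stateD(3)[OF Xs[OF i]], of "p i" f ?D] hext_state[OF Xs[OF i], of f] p i by (simp add: lQ)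
  ultimately have "(\<Sum>i\<in>I. p i * f ?D (X i)) \<le> f ?D \<tau>" by simp
  with le have "f ?D \<tau> = (\<Sum>i\<in>I. p i * f ?D (X i))" by simp
  moreover have "msum ?N' ?N' I (\<lambda>i. complex_of_real (p i) \<cdot>\<^sub>m add_anc d k e (\<rho> i) (ketbra (v i))) = \<tau>"
    unfolding \<tau>_def by (intro msum_cong refl) (simp add: aX)
  ultimately show "f ?D (msum ?N' ?N' I (\<lambda>i. complex_of_real (p i) \<cdot>\<^sub>m add_anc d k e (\<rho> i) (ketbra (v i))))
      = (\<Sum>i\<in>I. p i * f ?D (add_anc d k e (\<rho> i) (ketbra (v i))))"
    by (simp add: aX)
qed

theorem theorem2:
  fixes n :: nat and f :: "nat list \<Rightarrow> complex mat \<Rightarrow> real"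
  assumes "2 \<le> n"
    and "convex_measure n f"
  shows "LOCC_monotone n f \<longleftrightarrow>
           local_unitary_invariant n f \<and> local_ancilla_invariant n f \<and> flagged_affine n f"
proof
  assume "LOCC_monotone n f"
  then show "local_unitary_invariant n f \<and> local_ancilla_invariant n f \<and> flagged_affine n f"
    using LOCC_monotone_unitary_invariant LOCC_monotone_ancilla_invariant LOCC_monotone_flagged_affine[OF assms(2)]
    by blast
next
  assume inv: "local_unitary_invariant n f \<and> local_ancilla_invariant n f \<and> flagged_affine n f"
  show "LOCC_monotone n f"
    unfolding LOCC_monotone_hext
  proof (intro allI impI)
    fix d T \<rho> assume "length d = n" "LOCC d T" and s: "is_state d \<rho>"
    then have "(\<Sum>t\<leftarrow>T. hext f (fst t) (snd t \<rho>)) \<le> hext f d \<rho>"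
      using LOCC_hext_monotone[OF assms(2), of d T] inv is_stateD(1)[OF s] by blast
    then show "(\<Sum>t\<leftarrow>T. hext f (fst t) (snd t \<rho>)) \<le> f d \<rho>"
      by (simp only: hext_state[OF s])
  qed
qed

end
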